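(* Let $n\ge1$ be an integer, $\delta>0$, $D\in\mathbb{R}$, and set $\epsilon=\frac{\mu_1-\mu_2}{8}\delta$. If $m$ is a positive integer with $$m\ge 2\epsilon^{-2}\left(8\beta n\log\left(1+128\frac{\sqrt{2\beta n-1}}{2\sqrt{2\pi}}\epsilon^{-1}\right)+2\log(2)+D\right)$$ and $\mathcal{P}=\{P_j\}_{j=1}^m$ is an independent sequence of uniformly distributed projections in $\mathrm{Proj}_{\mathbb{F}}(n,2n)$, then with probability at least $1-\exp(-D)$ $$\|\hat X-X\|<\delta\quad\text{for all } X\in\mathrm{Proj}_{\mathbb{F}}(1,2n)$$ (simultaneously), where $\hat X$ is the solution to the Principal Eigenspace Program (PEP) with input $\Phi_{\mathcal{P}}(X)$.
   Context: $\mathbb{F}$ is either $\mathbb{R}$ or $\mathbb{C}$; $\beta=\frac12$ if $\mathbb{F}=\mathbb{R}$ and $\beta=1$ if $\mathbb{F}=\mathbb{C}$. $\mathrm{Proj}_{\mathbb{F}}(k,d)$ is the set of rank-$k$ orthogonal projections on $\mathbb{F}^d$; its uniform distribution is the unique probability measure invariant under conjugation by all orthogonal ($\mathbb{F}=\mathbb{R}$) or unitary ($\mathbb{F}=\mathbb{C}$) $d\times d$ matrices. $\|\cdot\|$ on matrices is the operator norm. The constants are $$\mu_1=\frac12+\frac{1}{\beta n\,4^{\beta n}B(\beta n,\beta n)},\qquad \mu_2=\frac12-\frac{1}{\beta n(2n-1)4^{\beta n}B(\beta n,\beta n)},$$ where $B(a,b)=\int_0^1 t^{a-1}(1-t)^{b-1}\,dt$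 is the Beta function. For $P\in\mathrm{Proj}_{\mathbb{F}}(n,2n)$ and $X\in\mathrm{Proj}_{\mathbb{F}}(1,2n)$, $\phi_P(X)=1$ if $\mathrm{tr}(PX)\ge\frac12$ and $\phi_P(X)=0$ otherwise. For $\mathcal{P}=\{P_j\}_{j=1}^m$, the binary measurement map is $\Phi_{\mathcal{P}}(X)=(\phi_{P_j}(X))_{j=1}^m\in\{0,1\}^m$. (PEP) with input $b\in\{0,1\}^m$: put $Q_b=\frac1m\sum_{j=1}^m R_j$, where $R_j=P_j$ if $b_j=1$ and $R_j=I-P_j$ if $b_j=0$, and maximize $\mathrm{tr}(Q_bY)$ over positive semidefinite $Y\in\mathbb{F}^{2n\times 2n}$ with $\mathrm{tr}(Y)\le1$. The solution is taken to be a rank-one orthogonal projection onto a line in the eigenspace of the largest eigenvalue of $Q_b$; when that eigenvalue is simple (which happens with probability 1 in this random model) it is the unique solution, namely the orthogonal projection onto that eigenspace. *)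

theory Defs
  imports "HOL-Probability.Probability"
begin

text \<open>
  The scalar field. A real normed field (its norm is multiplicative) of real dimension at most 2
  is \<open>\<real>\<close> or \<open>\<complex>\<close>, and its Euclidean inner product is then the real part of
  \<open>cnj x * y\<close>. A type of this class therefore plays the role of "either the reals or the complex
  numbers"; vectors and matrices are those of HOL-Analysis over this type.
\<close>

class real_or_complex = real_normed_field + euclidean_space +
  assumes card_Basis_le_2: "card (Basis :: 'a set) \<le> 2"

instance real :: real_or_complex
  by standard simp

instance complex :: real_or_complex
  by standard (simp add: Basis_complex_def card_insert_if)

definition rc_re :: "'a::real_or_complex \<Rightarrow> real"
  where "rc_re x = x \<bullet> 1"

definition rc_cnj :: "'a::real_or_complex \<Rightarrow> 'a"
  where "rc_cnj x = of_real (2 * rc_re x) - x"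

definition rc_beta :: "'a::real_or_complex itself \<Rightarrow> real"
  where "rc_beta _ = real DIM('a) / 2"

lemma rc_re_real: "rc_re (x :: real) = x"
  by (simp add: rc_re_def)

lemma rc_re_complex: "rc_re (z :: complex) = Re z"
  by (simp add: rc_re_def inner_complex_def)

lemma rc_cnj_real: "rc_cnj (x :: real) = x"
  by (simp add: rc_cnj_def rc_re_real)

lemma rc_cnj_complex: "rc_cnj (z :: complex) = cnj z"
  by (simp add: rc_cnj_def rc_re_complex complex_eq_iff)

lemma rc_beta_real: "rc_beta TYPE(real) = 1 / 2"
  by (simp add: rc_beta_def)

lemma rc_beta_complex: "rc_beta TYPE(complex) = 1"
  by (simp add: rc_beta_def)

definition ctranspose :: "'a::real_or_complex^'n^'m \<Rightarrow> 'a^'m^'n"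
  where "ctranspose A = (\<chi> i j. rc_cnj (A $ j $ i))"

definition unitary :: "'a::real_or_complex^'d^'d \<Rightarrow> bool"
  where "unitary U \<longleftrightarrow> ctranspose U ** U = mat 1 \<and> U ** ctranspose U = mat 1"

definition Proj :: "nat \<Rightarrow> ('a::real_or_complex^'d^'d) set"
  where "Proj k = {P. P ** P = P \<and> ctranspose P = P \<and> rank P = k}"

abbreviation Proj_borel :: "nat \<Rightarrow> ('a::real_or_complex^'d^'d) measure"
  where "Proj_borel k \<equiv> restrict_space borel (Proj k)"

definition uniform_on_Proj :: "nat \<Rightarrow> ('a::real_or_complex^'d^'d) measure \<Rightarrow> bool"
  where "uniform_on_Proj k \<mu> \<longleftrightarrow>
    prob_space \<mu> \<and> sets \<mu> = sets (Proj_borel k) \<and>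
    (\<forall>U. unitary U \<longrightarrow> distr \<mu> \<mu> (\<lambda>A. U ** A ** ctranspose U) = \<mu>)"

definition mu1 :: "real \<Rightarrow> nat \<Rightarrow> real"
  where "mu1 \<beta> n = 1 / 2 +
    1 / (\<beta> * real n * 4 powr (\<beta> * real n) * Beta (\<beta> * real n) (\<beta> * real n))"

definition mu2 :: "real \<Rightarrow> nat \<Rightarrow> real"
  where "mu2 \<beta> n = 1 / 2 -
    1 / (\<beta> * real n * (2 * real n - 1) * 4 powr (\<beta> * real n) * Beta (\<beta> * real n) (\<beta> * real n))"

text \<open>
  Binary measurements take values in \<open>bool\<close>, with \<open>True\<close> for 1 and \<open>False\<close> for 0. The trace of a
  product of two Hermitian matrices is real, so taking its real part loses nothing. A family of
  \<open>m\<close> matrices or bits is a function on \<open>nat\<close> of which only the values below \<open>m\<close> matter.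
\<close>

definition phi :: "'a::real_or_complex^'d^'d \<Rightarrow> 'a^'d^'d \<Rightarrow> bool"
  where "phi P X \<longleftrightarrow> rc_re (trace (P ** X)) \<ge> 1 / 2"

definition Phi :: "(nat \<Rightarrow> 'a::real_or_complex^'d^'d) \<Rightarrow> 'a^'d^'d \<Rightarrow> nat \<Rightarrow> bool"
  where "Phi P X = (\<lambda>j. phi (P j) X)"

definition Q_mat :: "nat \<Rightarrow> (nat \<Rightarrow> 'a::real_or_complex^'d^'d) \<Rightarrow> (nat \<Rightarrow> bool) \<Rightarrow> 'a^'d^'d"
  where "Q_mat m P b = (1 / real m) *\<^sub>R (\<Sum>j<m. if b j then P j else mat 1 - P j)"

text \<open>
  The inner product on vectors is the real part of the Hermitian one, so \<open>v \<bullet> (Y *v v)\<close> is the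
  (real) value of the quadratic form of a Hermitian \<open>Y\<close>.
\<close>

definition psd :: "'a::real_or_complex^'d^'d \<Rightarrow> bool"
  where "psd Y \<longleftrightarrow> ctranspose Y = Y \<and> (\<forall>v. 0 \<le> v \<bullet> (Y *v v))"

definition pep_optimal :: "'a::real_or_complex^'d^'d \<Rightarrow> 'a^'d^'d \<Rightarrow> bool"
  where "pep_optimal Q Y \<longleftrightarrow>
    is_arg_max (\<lambda>Y. rc_re (trace (Q ** Y))) (\<lambda>Y. psd Y \<and> rc_re (trace Y) \<le> 1) Y"

text \<open>Eigenvalues of Hermitian matrices are real, hence only real ones are collected.\<close>

definition real_eigenvalues :: "'a::real_or_complex^'d^'d \<Rightarrow> real set"
  where "real_eigenvalues Q = {l. \<exists>v. v \<noteq> 0 \<and> Q *v v = l *\<^sub>R v}"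

definition top_eigenspace :: "'a::real_or_complex^'d^'d \<Rightarrow> ('a^'d) set"
  where "top_eigenspace Q =
    {v. \<exists>l\<in>real_eigenvalues Q. (\<forall>l'\<in>real_eigenvalues Q. l' \<le> l) \<and> Q *v v = l *\<^sub>R v}"

definition pep_solution ::
    "nat \<Rightarrow> (nat \<Rightarrow> 'a::real_or_complex^'d^'d) \<Rightarrow> (nat \<Rightarrow> bool) \<Rightarrow> 'a^'d^'d \<Rightarrow> bool"
  where "pep_solution m P b Y \<longleftrightarrow>
    pep_optimal (Q_mat m P b) Y \<and> Y \<in> Proj 1 \<and> range ((*v) Y) \<subseteq> top_eigenspace (Q_mat m P b)"

end

theory Submission
  imports Defs
begin

text \<open>
  Write \<open>r\<^sub>j(x, y)\<close> for the value at \<open>y\<close> of the quadratic form of the matrix \<open>R\<^sub>j\<close> that (PEP)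
  uses for the input \<open>X = x x\<^sup>*\<close>: it is \<open>\<langle>y, P\<^sub>j y\<rangle>\<close> if \<open>\<langle>x, P\<^sub>j x\<rangle> \<ge> 1/2\<close> and
  \<open>|y|\<^sup>2 - \<langle>y, P\<^sub>j y\<rangle>\<close> otherwise. The program maximises the average of the \<open>r\<^sub>j(x, \<cdot>)\<close> over unit
  vectors, and the theorem says that this average is close to its mean, uniformly in \<open>x\<close> and \<open>y\<close>.

  The mean. Invariance under the unitary maps that fix \<open>x\<close> leaves only one possible shape for the
  mean of \<open>r(x, y)\<close> on unit vectors, namely \<open>\<mu>\<^sub>2 + (\<mu>\<^sub>1 - \<mu>\<^sub>2) |\<langle>x, y\<rangle>|\<^sup>2\<close> (\<open>mean_form_eq\<close>). Its value at
  \<open>y = x\<close> is \<open>1/2 + E|T - 1/2|\<close> with \<open>T = \<langle>x, P x\<rangle>\<close>, and the other coefficient follows by taking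
  traces. To find the law of \<open>T\<close>, a random \<open>P\<close> and a fixed \<open>x\<close> are exchanged for a fixed \<open>P\<close> and a
  uniform point of the unit ball (\<open>nn_integral_qf\<close>); there \<open>T\<close> is a quotient of squared radii in
  orthogonal subspaces of equal dimension, hence Beta distributed (\<open>nn_integral_ball_ratio\<close>).

  Stability. If the average deviates from its mean by at most \<open>K\<close> on the sphere, then
  \<open>(\<mu>\<^sub>1 - \<mu>\<^sub>2) \<parallel>X' - X\<parallel> \<le> 2 K\<close> for every solution \<open>X'\<close> (\<open>pep_stability\<close>). The mean drops
  quadratically in \<open>\<parallel>X' - X\<parallel>\<close>, while a quadratic form bounded by \<open>K\<close> changes only linearly, so the
  bound is linear in \<open>K\<close>. It remains to reach \<open>K < 4 \<epsilon>\<close>.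

  Uniformity if \<open>\<beta> n \<ge> 1\<close>. Both unit vectors run through a finite net, with Hoeffding's inequality at
  its points. Moving \<open>y\<close> changes \<open>r\<^sub>j\<close> by a Lipschitz bound. Moving \<open>x\<close> by \<open>\<eta>\<close> changes only those
  \<open>r\<^sub>j\<close> whose measurement lies within \<open>2 \<eta>\<close> of the threshold; their number is again controlled by
  Hoeffding's inequality, because the density of \<open>T\<close> is at most \<open>sqrt (2 \<beta> n - 1)\<close>
  (\<open>uniform_deviation_net\<close>).

  Uniformity if \<open>\<beta> n = 1/2\<close>. Then \<open>sqrt (2 \<beta> n - 1) = 0\<close>, the required sample size has no logarithmic
  term, and no net is affordable. But now \<open>P\<^sub>j\<close> is a line in the real plane, and \<open>2 r\<^sub>j - 1\<close> is a
  cosine of its angle up to one change of sign. Summation by parts bounds the deviation by the uniform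
  distance between the empirical and the true distribution function of the angles, and that distance
  obeys a maximal inequality of Doob type with exactly the constant \<open>4 exp (- m \<epsilon>\<^sup>2 / 2)\<close>
  (\<open>uniform_labels_discrepancy\<close>, \<open>uniform_deviation_circle\<close>).

  The recovery event quantifies over uncountably many \<open>X\<close>, and a nonmeasurable event would have measure
  \<open>0\<close> by convention. It is measurable because failure is a countable union of closed conditions
  projected along compact spheres (\<open>recovery_event_measurable\<close>).
\<close>

section \<open>Conjugation in the scalar field\<close>

text \<open>
  The norm is multiplicative, and polarization carries this over to the inner product.
\<close>

lemma inner_mult_right_real_or_complex:
  fixes x y z :: "'a::real_or_complex"
  shows "(x * z) \<bullet> (y * z) = (x \<bullet> y) * (norm z)\<^sup>2"
proof -
  have n: "(norm (u * z))\<^sup>2 = (norm u)\<^sup>2 * (norm z)\<^sup>2" for u :: 'a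
    by (simp add: norm_mult power_mult_distrib)
  have "(x * z) \<bullet> (y * z) = ((norm ((x + y) * z))\<^sup>2 - (norm (x * z))\<^sup>2 - (norm (y * z))\<^sup>2) / 2"
    unfolding distrib_right by (rule dot_norm)
  also have "\<dots> = ((norm (x + y))\<^sup>2 - (norm x)\<^sup>2 - (norm y)\<^sup>2) / 2 * (norm z)\<^sup>2"
    unfolding n by (simp add: algebra_simps diff_divide_distrib)
  also have "\<dots> = (x \<bullet> y) * (norm z)\<^sup>2"
    by (simp only: dot_norm)
  finally show ?thesis .
qed

text \<open>
  Here the bound on the dimension enters. As \<open>1\<close> and \<open>z\<close> span the field and \<open>z * z\<close> is orthogonal
  to \<open>z\<close>, the square is a real number; a positive one would have real square roots only.
\<close>

lemma imaginary_square:
  fixes z :: "'a::real_or_complex"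
  assumes z: "z \<bullet> 1 = 0"
  shows "z * z = - of_real ((norm z)\<^sup>2)"
proof (cases "z = 0")
  case False
  have ind: "independent {1, z}"
  proof (rule pairwise_orthogonal_independent)
    show "pairwise orthogonal {1, z}"
      using z by (auto simp: pairwise_def orthogonal_def inner_commute)
  qed (use False in auto)
  have ne: "z \<noteq> 1" using z by auto
  have "card {1, z} = 2" using ne by auto
  moreover have "DIM('a) \<le> 2" by (rule card_Basis_le_2)
  ultimately have "DIM('a) \<le> card {1, z}" by simp
  then have "UNIV \<subseteq> span {1, z}"
    by (intro card_ge_dim_independent ind) (auto simp: dim_UNIV)
  then obtain a b where zz: "z * z = a *\<^sub>R 1 + b *\<^sub>R z"
    by (force simp: span_insert span_singleton algebra_simps)
  have "(z * z) \<bullet> (1 * z) = 0"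
    by (subst inner_mult_right_real_or_complex) (simp add: z)
  then have "b * (norm z)\<^sup>2 = 0"
    unfolding zz by (simp add: inner_add_left z inner_commute[of 1] power2_norm_eq_inner)
  then have b: "b = 0" using False by simp
  then have a: "z * z = of_real a" using zz by (simp add: of_real_def)
  then have "norm (z * z) = \<bar>a\<bar>" by simp
  then have "\<bar>a\<bar> = (norm z)\<^sup>2" by (simp add: norm_mult power2_eq_square)
  moreover have "a \<noteq> (norm z)\<^sup>2"
  proof
    assume "a = (norm z)\<^sup>2"
    then have "z * z = of_real (norm z) * of_real (norm z)"
      using a by (simp add: power2_eq_square)
    then have "(z - of_real (norm z)) * (z + of_real (norm z)) = 0"
      by (simp add: algebra_simps)
    then have "z = of_real (norm z) \<or> z = of_real (- norm z)"
      by (auto simp: add_eq_0_iff)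
    then obtain r where r: "z = of_real r" by metis
    then have "r * (norm (1::'a))\<^sup>2 = 0" using z by (simp add: of_real_def power2_norm_eq_inner)
    then show False using r False by simp
  qed
  ultimately have "a = - ((norm z)\<^sup>2)" by (auto simp: abs_if split: if_splits)
  then show ?thesis using a by simp
qed auto

lemma inner_one_one [simp]: "(1::'a::real_or_complex) \<bullet> 1 = 1"
  using power2_norm_eq_inner[of "1::'a"] by simp

lemma rc_re_of_real [simp]: "rc_re (of_real r) = r"
  by (simp add: rc_re_def of_real_def)

lemma rc_re_0 [simp]: "rc_re 0 = 0"
  by (simp add: rc_re_def)

lemma rc_re_add: "rc_re (x + y) = rc_re x + rc_re y"
  by (simp add: rc_re_def inner_add_left)

lemma rc_re_diff: "rc_re (x - y) = rc_re x - rc_re y"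
  by (simp add: rc_re_def inner_diff_left)

lemma rc_re_scaleR: "rc_re (r *\<^sub>R x) = r * rc_re x"
  by (simp add: rc_re_def)

lemma rc_re_two_of_real [simp]: "rc_re (2 * of_real r) = 2 * r"
  using rc_re_of_real[of "2 * r"] by simp

lemma rc_re_sum: "rc_re (sum f A) = (\<Sum>i\<in>A. rc_re (f i))"
  by (simp add: rc_re_def inner_sum_left)

lemma continuous_rc_re [continuous_intros]:
  "continuous_on S f \<Longrightarrow> continuous_on S (\<lambda>x. rc_re (f x))"
  unfolding rc_re_def by (intro continuous_intros)

text \<open>
  For \<open>x = r + z\<close> with \<open>r\<close> real and \<open>z\<close> imaginary, \<open>rc_cnj x = r - z\<close>. This identity determines
  \<open>rc_cnj\<close> as \<open>(norm x)\<^sup>2 / x\<close>, from which multiplicativity is immediate.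
\<close>

lemma mult_rc_cnj: "x * rc_cnj x = of_real ((norm x)\<^sup>2)"
proof -
  define r where "r = rc_re x"
  define z where "z = x - of_real r"
  have z: "z \<bullet> 1 = 0"
    by (simp add: z_def r_def rc_re_def inner_diff_left of_real_def)
  have x: "x = of_real r + z" by (simp add: z_def)
  have "rc_cnj x = of_real r - z"
    unfolding rc_cnj_def r_def[symmetric] by (simp add: z_def)
  then have "x * rc_cnj x = (of_real r + z) * (of_real r - z)"
    by (simp add: x)
  also have "\<dots> = of_real (r\<^sup>2) - z * z"
    by (simp add: algebra_simps power2_eq_square)
  also have "\<dots> = of_real (r\<^sup>2 + (norm z)\<^sup>2)"
    unfolding imaginary_square[OF z] by simp
  also have "r\<^sup>2 + (norm z)\<^sup>2 = (norm x)\<^sup>2"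
  proof -
    have "(norm x)\<^sup>2 = (r *\<^sub>R 1 + z) \<bullet> (r *\<^sub>R 1 + z)"
      unfolding x power2_norm_eq_inner by (simp only: of_real_def)
    also have "\<dots> = r * r + z \<bullet> z"
      using z inner_commute[of 1 z] by (simp add: inner_add_left inner_add_right)
    finally show ?thesis using power2_norm_eq_inner[of z] by (simp add: power2_eq_square)
  qed
  finally show ?thesis .
qed

lemma rc_cnj_eq_divide: "x \<noteq> 0 \<Longrightarrow> rc_cnj x = of_real ((norm x)\<^sup>2) / x"
  using mult_rc_cnj[of x] by (simp add: field_simps)

lemma rc_cnj_of_real [simp]: "rc_cnj (of_real r) = of_real r"
  by (simp add: rc_cnj_def)

lemma rc_cnj_0 [simp]: "rc_cnj 0 = 0" and rc_cnj_1 [simp]: "rc_cnj 1 = 1"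
  using rc_cnj_of_real[of 0] rc_cnj_of_real[of 1] by simp_all

lemma rc_cnj_mult: "rc_cnj (x * y) = rc_cnj x * rc_cnj y"
  by (cases "x = 0 \<or> y = 0")
     (auto simp: rc_cnj_eq_divide norm_mult power_mult_distrib)

lemma rc_cnj_add: "rc_cnj (x + y) = rc_cnj x + rc_cnj y"
  by (simp add: rc_cnj_def rc_re_add algebra_simps)

lemma rc_cnj_diff: "rc_cnj (x - y) = rc_cnj x - rc_cnj y"
  by (simp add: rc_cnj_def rc_re_diff algebra_simps)

lemma rc_cnj_sum: "rc_cnj (sum f A) = (\<Sum>i\<in>A. rc_cnj (f i))"
  by (induction A rule: infinite_finite_induct) (auto simp: rc_cnj_add)

lemma rc_cnj_cnj [simp]: "rc_cnj (rc_cnj x) = x"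
  by (simp add: rc_cnj_def rc_re_diff)

lemma norm_rc_cnj [simp]: "norm (rc_cnj x) = norm x"
proof (cases "x = 0")
  case False
  then show ?thesis unfolding rc_cnj_eq_divide[OF False]
    by (simp add: norm_divide norm_mult power2_eq_square)
qed simp

lemma rc_cnj_scaleR: "rc_cnj (r *\<^sub>R x) = r *\<^sub>R rc_cnj x"
  by (simp add: rc_cnj_mult scaleR_conv_of_real)

lemma continuous_rc_cnj [continuous_intros]:
  "continuous_on S f \<Longrightarrow> continuous_on S (\<lambda>x. rc_cnj (f x))"
  unfolding rc_cnj_def by (intro continuous_intros)

lemma rc_re_cnj_mult: "rc_re (rc_cnj x * y) = x \<bullet> y"
proof (cases "x = 0")
  case False
  have "rc_re (rc_cnj x * y) * (norm x)\<^sup>2 = ((rc_cnj x * y) * x) \<bullet> (1 * x)"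
    unfolding rc_re_def by (rule inner_mult_right_real_or_complex[symmetric])
  also have "(rc_cnj x * y) * x = (norm x)\<^sup>2 *\<^sub>R y"
    using mult_rc_cnj[of x] by (simp add: mult_ac scaleR_conv_of_real)
  finally show ?thesis using False by (simp add: inner_commute)
qed simp

section \<open>The Hermitian product\<close>

definition cip :: "'a::real_or_complex^'d \<Rightarrow> 'a^'d \<Rightarrow> 'a"
  where "cip x y = (\<Sum>i\<in>UNIV. rc_cnj (x $ i) * y $ i)"

lemma rc_re_cip: "rc_re (cip x y) = x \<bullet> y"
  by (simp add: cip_def rc_re_sum rc_re_cnj_mult inner_vec_def)

lemma rc_cnj_cip: "rc_cnj (cip x y) = cip y x"
  by (simp add: cip_def rc_cnj_sum rc_cnj_mult mult.commute)

lemma cip_self: "cip x x = of_real ((norm x)\<^sup>2)"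
proof -
  have "cip x x = of_real (\<Sum>i\<in>UNIV. (norm (x $ i))\<^sup>2)"
    by (simp add: cip_def mult.commute[of "rc_cnj _"] mult_rc_cnj)
  also have "(\<Sum>i\<in>UNIV. (norm (x $ i))\<^sup>2) = (norm x)\<^sup>2"
    by (simp add: power2_norm_eq_inner inner_vec_def)
  finally show ?thesis .
qed

lemma cip_add_right: "cip x (y + z) = cip x y + cip x z"
  by (simp add: cip_def distrib_left sum.distrib)
lemma cip_add_left: "cip (x + y) z = cip x z + cip y z"
  by (simp add: cip_def distrib_right rc_cnj_add sum.distrib)
lemma cip_diff_right: "cip x (y - z) = cip x y - cip x z"
  by (simp add: cip_def right_diff_distrib sum_subtractf)
lemma cip_diff_left: "cip (x - y) z = cip x z - cip y z"
  by (simp add: cip_def left_diff_distrib rc_cnj_diff sum_subtractf)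
lemma cip_smult_right: "cip x (c *s y) = c * cip x y"
  by (simp add: cip_def sum_distrib_left mult_ac)
lemma cip_smult_left: "cip (c *s x) y = rc_cnj c * cip x y"
  by (simp add: cip_def sum_distrib_left rc_cnj_mult mult_ac)
lemma scaleR_eq_smult: "r *\<^sub>R x = (of_real r) *s (x :: 'a::real_or_complex^'d)"
  by (simp add: vec_eq_iff scaleR_conv_of_real[where 'a='a])
lemma cip_scaleR_right: "cip x (r *\<^sub>R y) = r *\<^sub>R cip x y"
  by (simp add: scaleR_eq_smult cip_smult_right scaleR_conv_of_real)
lemma cip_scaleR_left: "cip (r *\<^sub>R x) y = r *\<^sub>R cip x y"
  by (simp add: scaleR_eq_smult cip_smult_left scaleR_conv_of_real)
lemma cip_0 [simp]: "cip 0 x = 0" "cip x 0 = 0"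
  by (simp_all add: cip_def)

lemmas cip_simps = cip_add_right cip_add_left cip_diff_right cip_diff_left
  cip_smult_right cip_smult_left cip_scaleR_right cip_scaleR_left

lemma norm_cip_commute: "norm (cip x y) = norm (cip y x)"
  using norm_rc_cnj[of "cip x y"] by (simp add: rc_cnj_cip)

lemma continuous_cip [continuous_intros]:
  "continuous_on S f \<Longrightarrow> continuous_on S g \<Longrightarrow> continuous_on S (\<lambda>x. cip (f x) (g x))"
  unfolding cip_def by (intro continuous_intros)

lemma norm_smult: "norm (c *s x) = norm c * norm (x :: 'a::real_or_complex^'d)"
proof -
  have "of_real ((norm (c *s x))\<^sup>2) = (of_real ((norm c * norm x)\<^sup>2) :: 'a)"
    unfolding cip_self[symmetric] cip_simps
    using mult_rc_cnj[of c] by (simp add: cip_self power_mult_distrib mult_ac)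
  then have "(norm (c *s x))\<^sup>2 = (norm c * norm x)\<^sup>2" by (simp only: of_real_eq_iff)
  then show ?thesis by (simp add: power2_eq_iff_nonneg)
qed

text \<open>
  A vector may be multiplied by a phase so that a given Hermitian product becomes real and
  nonnegative; projections do not see the phase.
\<close>

lemma phase_exists:
  fixes x y :: "'a::real_or_complex^'d"
  obtains u where "norm u = 1" "cip x (u *s y) = of_real (norm (cip x y))"
proof (cases "cip x y = 0")
  case True
  then show ?thesis by (intro that[of 1]) (auto simp: cip_simps)
next
  case False
  show ?thesis
  proof (rule that)
    show "norm (rc_cnj (cip x y) / of_real (norm (cip x y))) = 1"
      using False by (simp add: norm_divide)
    show "cip x ((rc_cnj (cip x y) / of_real (norm (cip x y))) *s y) = of_real (norm (cip x y))"
      using False mult_rc_cnj[of "cip x y"]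
      by (simp add: cip_simps power2_eq_square mult.commute)
  qed
qed

text \<open>
  After a phase change of \<open>y\<close>, its component along \<open>x\<close> has a nonnegative real coefficient.
\<close>

lemma orthogonal_split:
  fixes x y :: "'a::real_or_complex^'d"
  assumes x: "norm x = 1" and y: "norm y = 1"
  obtains u w where "norm u = 1" "u *s y = norm (cip x y) *\<^sub>R x + w" "cip x w = 0"
    "(norm w)\<^sup>2 = 1 - (norm (cip x y))\<^sup>2"
proof -
  obtain u where u: "norm u = 1" "cip x (u *s y) = of_real (norm (cip x y))" by (rule phase_exists)
  define w where "w = u *s y - norm (cip x y) *\<^sub>R x"
  have y': "u *s y = norm (cip x y) *\<^sub>R x + w" by (simp add: w_def)
  have xw: "cip x w = 0"
    using u(2) x unfolding w_def cip_diff_right cip_scaleR_right cip_self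
    by (simp add: scaleR_conv_of_real)
  have "x \<bullet> w = 0" using xw rc_re_cip[of x w] by simp
  moreover have "(norm (norm (cip x y) *\<^sub>R x + w))\<^sup>2 = 1"
    using u(1) y unfolding y'[symmetric] by (simp add: norm_smult)
  ultimately have "(norm w)\<^sup>2 = 1 - (norm (cip x y))\<^sup>2"
    using x norm_add_Pythagorean[of "norm (cip x y) *\<^sub>R x" w] by (simp add: orthogonal_def)
  then show ?thesis by (rule that[OF u(1) y' xw])
qed

lemma cip_matrix: "cip x (A *v y) = cip (ctranspose A *v x) y"
proof -
  have "cip x (A *v y) = (\<Sum>i\<in>UNIV. \<Sum>j\<in>UNIV. rc_cnj (x $ i) * A $ i $ j * y $ j)"
    by (simp add: cip_def matrix_vector_mult_def sum_distrib_left mult_ac)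
  also have "\<dots> = (\<Sum>j\<in>UNIV. \<Sum>i\<in>UNIV. rc_cnj (x $ i) * A $ i $ j * y $ j)"
    by (rule sum.swap)
  also have "\<dots> = cip (ctranspose A *v x) y"
    by (simp add: cip_def matrix_vector_mult_def ctranspose_def rc_cnj_sum rc_cnj_mult
        sum_distrib_left mult_ac)
  finally show ?thesis .
qed

lemma inner_hermitian:
  "ctranspose A = A \<Longrightarrow> x \<bullet> (A *v y) = (A *v x) \<bullet> y"
  using cip_matrix[of x A y] rc_re_cip[of x "A *v y"] rc_re_cip[of "A *v x" y] by simp

text \<open>
  The matrix \<open>x x\<^sup>*\<close>; for a unit vector it is the orthogonal projection onto the line of \<open>x\<close>.
\<close>

definition outer :: "'a::real_or_complex^'d \<Rightarrow> 'a^'d^'d"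
  where "outer x = (\<chi> i j. x $ i * rc_cnj (x $ j))"

lemma outer_mult: "outer x *v y = cip x y *s x"
  by (simp add: vec_eq_iff outer_def matrix_vector_mult_def cip_def sum_distrib_left mult_ac)

lemma ctranspose_outer: "ctranspose (outer x) = outer x"
  by (simp add: vec_eq_iff outer_def ctranspose_def rc_cnj_mult mult.commute)

lemma inner_outer: "y \<bullet> (outer x *v y) = (norm (cip x y))\<^sup>2"
proof -
  have "cip y (outer x *v y) = of_real ((norm (cip x y))\<^sup>2)"
    using mult_rc_cnj[of "cip x y"] by (simp add: outer_mult cip_simps rc_cnj_cip)
  then show ?thesis unfolding rc_re_cip[symmetric] by (simp only: rc_re_of_real)
qed

lemma trace_mult_outer: "rc_re (trace (A ** outer x)) = x \<bullet> (A *v x)"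
proof -
  have "trace (A ** outer x) = cip x (A *v x)"
    by (simp add: trace_def matrix_matrix_mult_def outer_def cip_def matrix_vector_mult_def
        sum_distrib_left sum_distrib_right mult_ac)
  then show ?thesis by (simp add: rc_re_cip)
qed

lemma trace_outer: "rc_re (trace (outer x)) = (norm x)\<^sup>2"
  using trace_mult_outer[of "mat 1" x] by (simp add: power2_norm_eq_inner)

lemma linear_matrix [simp]: "linear ((*v) (A :: 'a::real_or_complex^'d^'e))"
  by simp

lemma matrix_scaleR_vector: "A *v (r *\<^sub>R x) = r *\<^sub>R (A *v (x :: 'a::real_or_complex^'d))"
  by (rule linear_cmul[OF linear_matrix])

lemma matrix_smult_vector: "A *v (c *s x) = c *s (A *v (x :: 'a::real_or_complex^'d))"
  by (simp add: vec_eq_iff matrix_vector_mult_def sum_distrib_left mult_ac)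

section \<open>Householder reflections\<close>

definition householder :: "'a::real_or_complex^'d \<Rightarrow> 'a^'d^'d"
  where "householder v = mat 1 - (2 / (norm v)\<^sup>2) *\<^sub>R outer v"

lemma scaleR_matrix_vector: "(r *\<^sub>R A) *v x = r *\<^sub>R (A *v (x :: 'a::real_or_complex^'d))"
  by (simp add: vec_eq_iff matrix_vector_mult_def scaleR_sum_right)

lemma householder_mult:
  "householder v *v z = z - (2 / (norm v)\<^sup>2) *\<^sub>R (cip v z *s v)"
  by (simp add: householder_def matrix_vector_mult_diff_rdistrib scaleR_matrix_vector outer_mult)

lemma ctranspose_householder: "ctranspose (householder v) = householder v"
  by (simp add: vec_eq_iff householder_def ctranspose_def outer_def mat_def rc_cnj_diff
      rc_cnj_scaleR rc_cnj_mult mult.commute)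

lemma householder_involution:
  assumes "v \<noteq> 0"
  shows "householder v *v (householder v *v z) = z"
proof -
  define k where "k = 2 / (norm v)\<^sup>2"
  have k: "k * (norm v)\<^sup>2 = 2" using assms by (simp add: k_def)
  have "cip v (householder v *v z) = cip v z - k *\<^sub>R (cip v z * cip v v)"
    unfolding householder_mult k_def[symmetric]
    by (simp only: cip_diff_right cip_scaleR_right cip_smult_right)
  also have "\<dots> = cip v z - (k * (norm v)\<^sup>2) *\<^sub>R cip v z"
    unfolding cip_self scaleR_conv_of_real[where 'a='a] by simp
  finally have "cip v (householder v *v z) = cip v z - (k * (norm v)\<^sup>2) *\<^sub>R cip v z" .
  then have "cip v (householder v *v z) = - cip v z"
    unfolding k by (simp add: scaleR_2)
  then have "householder v *v (householder v *v z)
      = householder v *v z - (2 / (norm v)\<^sup>2) *\<^sub>R ((- cip v z) *s v)"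
    using householder_mult[of v "householder v *v z"] by simp
  also have "\<dots> = z"
    unfolding householder_mult[of v z] by (simp add: vec_eq_iff)
  finally show ?thesis .
qed

lemma unitary_householder:
  assumes "v \<noteq> 0"
  shows "unitary (householder v)"
proof -
  have "householder v ** householder v = mat 1"
    unfolding matrix_eq
    by (simp add: matrix_vector_mul_assoc[symmetric] householder_involution[OF assms])
  then show ?thesis by (simp add: unitary_def ctranspose_householder)
qed

lemma householder_fix: "cip v z = 0 \<Longrightarrow> householder v *v z = z"
  by (simp add: householder_mult)

text \<open>
  As \<open>cip x y\<close> is real, \<open>x + y\<close> is orthogonal to \<open>x - y\<close> and hence fixed. Together with
  \<open>phase_exists\<close> this makes the reflections transitive on lines, so they can replace the full unitary
  group in all symmetry arguments.
\<close>

lemma householder_swap: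
  assumes "norm x = 1" "norm y = 1" "cip x y = of_real c" "x \<noteq> y"
  shows "householder (x - y) *v x = y"
proof -
  have yx: "cip y x = of_real c" using assms(3) rc_cnj_cip[of x y] by simp
  have c1: "cip (x - y) x = of_real (1 - c)"
    by (simp add: cip_simps cip_self assms yx)
  have "x \<bullet> y = c" unfolding rc_re_cip[symmetric] assms by simp
  then have n: "(norm (x - y))\<^sup>2 = 2 * (1 - c)"
    using dot_norm_neg[of x y] assms by simp
  moreover have "norm (x - y) \<noteq> 0" using assms(4) by simp
  ultimately have "1 - c \<noteq> 0" by auto
  then have "(2 / (norm (x - y))\<^sup>2) *\<^sub>R (cip (x - y) x *s (x - y)) = x - y"
    unfolding c1 n scaleR_eq_smult[symmetric] by simp
  then show ?thesis by (simp add: householder_mult)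
qed

section \<open>Projections and their quadratic forms\<close>

text \<open>
  Multiplying a basis over the scalar field by the real basis of that field gives a real basis.
\<close>

lemma dim_vec_span:
  fixes S :: "('a::real_or_complex^'d) set"
  shows "dim (vec.span S) = DIM('a) * vec.dim S"
proof -
  obtain B where B: "B \<subseteq> S" "vec.independent B" "S \<subseteq> vec.span B" "card B = vec.dim S"
    by (rule vec.basis_exists)
  have finB: "finite B" using B(2) by (rule vec.finiteI_independent)
  have spanB: "vec.span B = vec.span S"
    using B(1,3) by (metis vec.span_mono vec.span_span subset_antisym)
  define g where "g = (\<lambda>(b::'a, v::'a^'d). b *s v)"
  have inj: "inj_on g (Basis \<times> B)"
  proof (rule inj_onI, clarsimp simp: g_def)
    fix b v b' v' assume b: "b \<in> Basis" "b' \<in> Basis" and v: "v \<in> B" "v' \<in> B" and eq: "b *s v = b' *s v'"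
    have v0: "v \<noteq> 0" using v B(2) vec.dependent_zero by blast
    have b0: "b \<noteq> 0" using b by auto
    have "v = v'"
    proof (rule ccontr)
      assume "v \<noteq> v'"
      then have "v' \<in> vec.span (B - {v})" using v by (intro vec.span_base) auto
      then have "inverse b *s (b' *s v') \<in> vec.span (B - {v})" by (intro vec.span_scale)
      then have "v \<in> vec.span (B - {v})" unfolding eq[symmetric] using b0 by simp
      then show False using B(2) v by (auto simp: vec.dependent_def)
    qed
    then show "b = b' \<and> v = v'" using eq v0 by simp
  qed
  have lin0: "f (g (b, v)) = 0"
    if sum0: "(\<Sum>c\<in>g ` (Basis \<times> B). f c *\<^sub>R c) = 0" and bv: "b \<in> Basis" "v \<in> B" for f b v
  proof -
    have "0 = (\<Sum>(b, v)\<in>Basis \<times> B. f (g (b, v)) *\<^sub>R (b *s v))"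
      unfolding sum0[symmetric] by (subst sum.reindex[OF inj]) (simp add: g_def case_prod_beta)
    also have "\<dots> = (\<Sum>b\<in>Basis. \<Sum>v\<in>B. f (g (b, v)) *\<^sub>R (b *s v))"
      by (subst sum.cartesian_product) simp
    also have "\<dots> = (\<Sum>v\<in>B. \<Sum>b\<in>Basis. f (g (b, v)) *\<^sub>R (b *s v))"
      by (rule sum.swap)
    also have "\<dots> = (\<Sum>v\<in>B. (\<Sum>b\<in>Basis. f (g (b, v)) *\<^sub>R b) *s v)"
      by (simp add: vec_eq_iff sum_distrib_right)
    finally have "(\<Sum>v\<in>B. (\<Sum>b\<in>Basis. f (g (b, v)) *\<^sub>R b) *s v) = 0" ..
    then have "(\<Sum>b\<in>Basis. f (g (b, v)) *\<^sub>R b) = 0"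
      using B(2) finB bv(2) vec.independentD[of B B "\<lambda>v. \<Sum>b\<in>Basis. f (g (b, v)) *\<^sub>R b" v] by simp
    then have "(\<Sum>b\<in>Basis. f (g (b, v)) *\<^sub>R b) \<bullet> b = 0" by simp
    then show ?thesis using bv(1) by (simp add: inner_sum_left inner_Basis if_distrib sum.delta cong: if_cong)
  qed
  have ind: "independent (g ` (Basis \<times> B))"
    by (rule independent_if_scalars_zero) (use lin0 finB in auto)
  have "dim (vec.span S) = card (g ` (Basis \<times> B))"
  proof (rule dim_unique[OF _ _ ind refl])
    show "g ` (Basis \<times> B) \<subseteq> vec.span S"
      unfolding spanB[symmetric] by (auto simp: g_def intro: vec.span_scale vec.span_base)
    have bspan: "c *s v \<in> span (g ` (Basis \<times> B))" if "v \<in> B" for c v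
    proof -
      have "c *s v = (\<Sum>b\<in>Basis. (c \<bullet> b) *\<^sub>R b) *s v" by (simp add: euclidean_representation)
      also have "\<dots> = (\<Sum>b\<in>Basis. (c \<bullet> b) *\<^sub>R (b *s v))"
        by (simp add: vec_eq_iff sum_distrib_right)
      also have "\<dots> \<in> span (g ` (Basis \<times> B))"
        using that by (intro span_sum span_scale span_base) (force simp: g_def)
      finally show ?thesis .
    qed
    show "vec.span S \<subseteq> span (g ` (Basis \<times> B))"
      unfolding spanB[symmetric] vec.span_finite[OF finB]
      by (auto intro!: span_sum bspan)
  qed
  also have "\<dots> = DIM('a) * vec.dim S"
    by (simp add: card_image[OF inj] card_cartesian_product B(4))
  finally show ?thesis .
qed

text \<open>
  The rank counts rows, and for a Hermitian matrix entrywise conjugation, a real-linear bijection,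
  carries the row space onto the range.
\<close>

lemma dim_range_hermitian:
  fixes P :: "'a::real_or_complex^'d^'d"
  assumes herm: "ctranspose P = P"
  shows "dim (range ((*v) P)) = DIM('a) * rank P"
proof -
  define cj where "cj = (\<lambda>y::'a^'d. (\<chi> j. rc_cnj (y $ j)) :: 'a^'d)"
  have lin: "linear cj"
    by (intro linearI) (auto simp: cj_def vec_eq_iff rc_cnj_add rc_cnj_scaleR)
  have invol: "cj (cj y) = y" for y by (simp add: cj_def)
  have cj_smult: "cj (c *s y) = rc_cnj c *s cj y" for c y
    by (simp add: cj_def vec_eq_iff rc_cnj_mult)
  have row: "cj (row i P) = P *v axis i 1" for i
  proof -
    have "rc_cnj (P $ i $ j) = P $ j $ i" for j
    proof -
      have "ctranspose P $ j $ i = P $ j $ i" by (simp only: herm)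
      then show ?thesis by (simp add: ctranspose_def)
    qed
    then show ?thesis
      by (simp add: cj_def row_def vec_eq_iff matrix_vector_mult_def axis_def if_distrib sum.delta cong: if_cong)
  qed
  have "vec.span (rows P) \<subseteq> cj ` range ((*v) P)"
  proof (rule vec.span_minimal)
    show "rows P \<subseteq> cj ` range ((*v) P)"
    proof
      fix y assume "y \<in> rows P"
      then obtain i where "y = row i P" by (auto simp: rows_def)
      then have "y = cj (P *v axis i 1)" using row[of i] invol by metis
      then show "y \<in> cj ` range ((*v) P)" by blast
    qed
    show "vec.subspace (cj ` range ((*v) P))"
    proof (rule vec.subspaceI)
      show "0 \<in> cj ` range ((*v) P)"
        by (rule image_eqI[of _ _ "P *v 0"]) (auto simp: linear_0[OF lin] intro: range_eqI[of _ _ 0])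
      show "x + y \<in> cj ` range ((*v) P)" if xy: "x \<in> cj ` range ((*v) P)" "y \<in> cj ` range ((*v) P)" for x y
      proof -
        from xy obtain u v where "x = cj (P *v u)" "y = cj (P *v v)" by auto
        then have "x + y = cj (P *v (u + v))"
          by (simp add: linear_add[OF lin] matrix_vector_right_distrib)
        then show ?thesis by blast
      qed
      show "c *s x \<in> cj ` range ((*v) P)" if x: "x \<in> cj ` range ((*v) P)" for c x
      proof -
        from x obtain u where "x = cj (P *v u)" by auto
        then have "c *s x = cj (P *v (rc_cnj c *s u))"
          by (simp add: matrix_smult_vector cj_smult)
        then show ?thesis by blast
      qed
    qed
  qed
  moreover have "cj ` range ((*v) P) \<subseteq> vec.span (rows P)"
  proof clarify
    fix x
    have "P *v x = (\<Sum>i\<in>UNIV. x $ i *s column i P)" by (rule matrix_mult_sum)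
    also have "\<dots> = (\<Sum>i\<in>UNIV. x $ i *s cj (row i P))"
      by (simp add: row vec_eq_iff matrix_vector_mult_def axis_def column_def if_distrib sum.delta cong: if_cong)
    finally have "cj (P *v x) = (\<Sum>i\<in>UNIV. rc_cnj (x $ i) *s row i P)"
      by (simp add: linear_sum[OF lin] cj_smult invol)
    also have "\<dots> \<in> vec.span (rows P)"
      by (intro vec.span_sum vec.span_scale vec.span_base) (auto simp: rows_def)
    finally show "cj (P *v x) \<in> vec.span (rows P)" .
  qed
  ultimately have "vec.span (rows P) = cj ` range ((*v) P)" by blast
  moreover have "dim (cj ` range ((*v) P)) = dim (range ((*v) P))"
    by (rule dim_image_eq[OF lin]) (metis inj_onI invol)
  ultimately show ?thesis
    using dim_vec_span[of "rows P"] by (simp add: row_rank_def_gen)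
qed

lemma ProjD:
  assumes "P \<in> Proj k"
  shows Proj_hermitian: "ctranspose P = P"
    and Proj_idem: "P *v (P *v x) = P *v x"
    and Proj_rank: "rank P = k"
  using assms by (auto simp: Proj_def matrix_vector_mul_assoc)

lemma range_outer: 
  assumes "norm x = 1" shows "range ((*v) (outer x)) = vec.span {x}"
proof -
  have "c *s x = outer x *v (c *s x)" for c
    using assms by (simp add: outer_mult cip_simps cip_self)
  then have "c *s x \<in> range ((*v) (outer x))" for c by (metis rangeI)
  then show ?thesis by (auto simp: vec.span_singleton outer_mult)
qed

lemma vec_dim_singleton: "x \<noteq> 0 \<Longrightarrow> vec.dim {x::'a::field^'d} = 1"
  by (subst vec.dim_eq_card_independent) (auto simp: vec.dependent_single)

lemma Proj_1_eq: "Proj 1 = outer ` {x :: 'a::real_or_complex^'d. norm x = 1}"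
proof (intro set_eqI iffI)
  fix X :: "'a^'d^'d" assume X: "X \<in> Proj 1"
  note XD = ProjD[OF X]
  have dimX: "dim (range ((*v) X)) = DIM('a)"
    using dim_range_hermitian[OF XD(1)] XD(3) by simp
  then have "range ((*v) X) \<noteq> {0}" using DIM_positive[where 'a='a] by (metis dim_singleton less_irrefl)
  moreover have "0 \<in> range ((*v) X)" by (metis matrix_vector_mult_0_right rangeI)
  ultimately obtain z where z: "X *v z \<noteq> 0" by auto
  define x where "x = (1 / norm (X *v z)) *\<^sub>R (X *v z)"
  have nx: "norm x = 1" using z by (simp add: x_def)
  have Xx: "X *v x = x" by (simp add: x_def matrix_scaleR_vector XD(2))
  have "c *s x = X *v (c *s x)" for c by (simp add: Xx matrix_smult_vector)
  then have "c *s x \<in> range ((*v) X)" for c by (metis rangeI)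
  then have sub: "vec.span {x} \<subseteq> range ((*v) X)"
    by (auto simp: vec.span_singleton)
  have x0: "x \<noteq> 0" using nx by auto
  have "dim (vec.span {x}) = dim (range ((*v) X))"
    unfolding dimX dim_vec_span using vec_dim_singleton[OF x0] by simp
  moreover have "subspace (vec.span {x})"
    by (rule subspaceI)
       (auto simp: scaleR_eq_smult vec.span_zero intro: vec.span_add vec.span_scale)
  moreover have "subspace (range ((*v) X))"
    by (intro linear_subspace_image linear_matrix subspace_UNIV)
  ultimately have rng: "vec.span {x} = range ((*v) X)"
    using sub by (intro subspace_dim_equal) auto
  have "X *v y = outer x *v y" for y
  proof -
    have "X *v y \<in> vec.span {x}" unfolding rng by blast
    then obtain c where c: "X *v y = c *s x" by (auto simp: vec.span_singleton)
    have "cip x y = cip (X *v x) y" by (simp add: Xx)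
    also have "\<dots> = cip x (X *v y)" by (simp add: cip_matrix XD(1))
    also have "\<dots> = c" unfolding c by (simp add: cip_simps cip_self nx)
    finally show ?thesis unfolding c outer_mult by simp
  qed
  then have "X = outer x" by (simp add: matrix_eq)
  then show "X \<in> outer ` {x. norm x = 1}" using nx by blast
next
  fix X :: "'a^'d^'d" assume "X \<in> outer ` {x. norm x = 1}"
  then obtain x where X: "X = outer x" and nx: "norm x = 1" by auto
  have x0: "x \<noteq> 0" using nx by auto
  have "X ** X = X"
    unfolding matrix_eq X using nx
    by (simp add: matrix_vector_mul_assoc[symmetric] outer_mult cip_simps cip_self)
  moreover have "DIM('a) * rank X = DIM('a) * 1"
    using dim_range_hermitian[of X] unfolding X range_outer[OF nx]
    by (simp add: ctranspose_outer dim_vec_span vec_dim_singleton[OF x0] x0)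
  ultimately show "X \<in> Proj 1" by (simp add: Proj_def X ctranspose_outer)
qed

definition qf :: "'a::real_or_complex^'d^'d \<Rightarrow> 'a^'d \<Rightarrow> real"
  where "qf P y = y \<bullet> (P *v y)"

lemma qf_Proj: "P \<in> Proj k \<Longrightarrow> qf P y = (norm (P *v y))\<^sup>2"
  using inner_hermitian[of P y "P *v y"] Proj_hermitian[of P k] Proj_idem[of P k y]
  by (simp add: qf_def power2_norm_eq_inner)

lemma qf_nonneg: "P \<in> Proj k \<Longrightarrow> 0 \<le> qf P y"
  by (simp add: qf_Proj)

lemma qf_le:
  assumes "P \<in> Proj k"
  shows "qf P y \<le> (norm y)\<^sup>2"
proof -
  have "qf P y \<le> norm y * norm (P *v y)" unfolding qf_def by (rule norm_cauchy_schwarz)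
  then have "(norm (P *v y))\<^sup>2 \<le> norm y * norm (P *v y)" using qf_Proj[OF assms] by simp
  then have "norm (P *v y) \<le> norm y"
    by (cases "norm (P *v y) = 0") (auto simp: power2_eq_square)
  then show ?thesis unfolding qf_Proj[OF assms] by (simp add: power_mono)
qed

lemma qf_smult: "norm c = 1 \<Longrightarrow> qf P (c *s y) = qf P y"
proof -
  assume c: "norm c = 1"
  have "cip (c *s y) (P *v (c *s y)) = cip y (P *v y)"
    using mult_rc_cnj[of c] c by (simp add: matrix_smult_vector cip_simps mult.assoc[symmetric] mult.commute)
  then show ?thesis unfolding qf_def rc_re_cip[symmetric] by simp
qed

lemma qf_scaleR: "qf P (r *\<^sub>R y) = r\<^sup>2 * qf P y"
  by (simp add: qf_def matrix_scaleR_vector power2_eq_square)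

text \<open>
  From here on a projection is treated as a real-linear map: the real dimension of its range is known,
  and real orthonormal bases of range and kernel suffice.
\<close>

lemma Proj_orthonormal_bases:
  fixes P :: "'a::real_or_complex^'d^'d"
  assumes P: "P \<in> Proj k"
  obtains C1 C2 where "finite C1" "finite C2" "C1 \<inter> C2 = {}" "card C1 = DIM('a) * k"
    "card (C1 \<union> C2) = DIM('a^'d)" "pairwise orthogonal (C1 \<union> C2)"
    "\<And>c. c \<in> C1 \<union> C2 \<Longrightarrow> norm c = 1" "\<And>c. c \<in> C1 \<Longrightarrow> P *v c = c" "\<And>c. c \<in> C2 \<Longrightarrow> P *v c = 0"
    "span C1 = range ((*v) P)"
proof -
  note PD = ProjD[OF P]
  have sub1: "subspace (range ((*v) P))"
    by (intro linear_subspace_image linear_matrix subspace_UNIV)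
  have sub2: "subspace {y. P *v y = 0}"
    by (rule subspaceI) (auto simp: matrix_vector_right_distrib matrix_scaleR_vector)
  obtain C1 where C1: "C1 \<subseteq> range ((*v) P)" "pairwise orthogonal C1" "\<And>x. x \<in> C1 \<Longrightarrow> norm x = 1"
    "independent C1" "card C1 = dim (range ((*v) P))" "span C1 = range ((*v) P)"
    using orthonormal_basis_subspace[OF sub1] by metis
  obtain C2 where C2: "C2 \<subseteq> {y. P *v y = 0}" "pairwise orthogonal C2" "\<And>x. x \<in> C2 \<Longrightarrow> norm x = 1"
    "independent C2" "card C2 = dim {y. P *v y = 0}" "span C2 = {y. P *v y = 0}"
    using orthonormal_basis_subspace[OF sub2] by metis
  have fin: "finite C1" "finite C2" using C1(4) C2(4) by (auto intro: finiteI_independent)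
  have P1: "P *v c = c" if "c \<in> C1" for c using C1(1) that PD(2) by auto
  have P2: "P *v c = 0" if "c \<in> C2" for c using C2(1) that by auto
  have disj: "C1 \<inter> C2 = {}" using P1 P2 C1(3) by force
  have orth12: "orthogonal c d" if "c \<in> C1" "d \<in> C2" for c d
  proof -
    have "c \<bullet> d = (P *v c) \<bullet> d" using P1 that by simp
    also have "\<dots> = c \<bullet> (P *v d)" by (simp add: inner_hermitian PD(1))
    finally show ?thesis using P2 that by (simp add: orthogonal_def)
  qed
  have orth: "pairwise orthogonal (C1 \<union> C2)"
    using C1(2) C2(2) orth12 unfolding pairwise_def by (metis Un_iff orthogonal_commute)
  have n1: "norm c = 1" if "c \<in> C1 \<union> C2" for c using that C1(3) C2(3) by auto
  have ind: "independent (C1 \<union> C2)"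
    using n1 by (intro pairwise_orthogonal_independent orth) force
  have "x \<in> span (C1 \<union> C2)" for x
  proof -
    have "P *v x \<in> span C1" unfolding C1(6) by blast
    moreover have "x - P *v x \<in> span C2" unfolding C2(6)
      by (simp add: matrix_vector_mult_diff_distrib PD(2))
    ultimately have "P *v x + (x - P *v x) \<in> span (C1 \<union> C2)"
      by (intro span_add) (meson span_mono Un_upper1 Un_upper2 subsetD)+
    then show ?thesis by simp
  qed
  then have "card (C1 \<union> C2) = dim (UNIV :: ('a^'d) set)"
    by (intro dim_unique[OF _ _ ind refl, symmetric]) auto
  then show ?thesis
    using that[of C1 C2] fin disj orth n1 P1 P2 C1(5,6) dim_range_hermitian[OF PD(1)] PD(3)
    by (simp add: dim_UNIV)
qed

lemma trace_qf_Proj: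
  fixes P :: "'a::real_or_complex^'d^'d"
  assumes P: "P \<in> Proj k"
  shows "(\<Sum>b\<in>Basis. qf P b) = real (DIM('a) * k)"
proof -
  obtain C1 C2 where C: "finite C1" "card C1 = DIM('a) * k" "pairwise orthogonal (C1 \<union> C2)"
    "\<And>c. c \<in> C1 \<union> C2 \<Longrightarrow> norm c = 1" "\<And>c. c \<in> C1 \<Longrightarrow> P *v c = c" "span C1 = range ((*v) P)"
    by (rule Proj_orthonormal_bases[OF P]) metis
  have qf: "qf P b = (\<Sum>c\<in>C1. (c \<bullet> b)\<^sup>2)" for b
  proof -
    have "P *v b = (\<Sum>c\<in>C1. ((P *v b) \<bullet> c) *\<^sub>R c)"
      by (rule orthonormal_basis_expand[symmetric])
         (use C in \<open>auto simp: pairwise_def\<close>)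
    also have "\<dots> = (\<Sum>c\<in>C1. (c \<bullet> b) *\<^sub>R c)"
      using C(5) by (simp add: inner_commute[of "P *v b"] inner_hermitian Proj_hermitian[OF P])
    finally show ?thesis
      by (simp add: qf_def inner_sum_right power2_eq_square inner_commute)
  qed
  have "(\<Sum>b\<in>Basis. qf P b) = (\<Sum>c\<in>C1. \<Sum>b\<in>Basis. (c \<bullet> b)\<^sup>2)"
    unfolding qf by (rule sum.swap)
  also have "\<dots> = (\<Sum>c\<in>C1. (norm c)\<^sup>2)"
    unfolding power2_norm_eq_inner euclidean_inner[of c c for c] by (simp add: power2_eq_square)
  finally show ?thesis using C by simp
qed

text \<open>
  Sending the standard basis to orthonormal bases of range and kernel turns every projection of the
  given rank into a coordinate projection.
\<close>

lemma Proj_isometry: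
  fixes P :: "'a::real_or_complex^'d^'d"
  assumes P: "P \<in> Proj k"
  obtains g :: "'a^'d \<Rightarrow> 'a^'d" and A where "linear g" "\<And>z. norm (g z) = norm z" "A \<subseteq> Basis" "card A = DIM('a) * k"
    "\<And>z. qf P (g z) = (\<Sum>b\<in>A. (z \<bullet> b)\<^sup>2)"
proof -
  obtain C1 C2 where C: "finite C1" "finite C2" "C1 \<inter> C2 = {}" "card C1 = DIM('a) * k"
    "card (C1 \<union> C2) = DIM('a^'d)" "pairwise orthogonal (C1 \<union> C2)"
    "\<And>c. c \<in> C1 \<union> C2 \<Longrightarrow> norm c = 1" "\<And>c. c \<in> C1 \<Longrightarrow> P *v c = c" "\<And>c. c \<in> C2 \<Longrightarrow> P *v c = 0"
    by (rule Proj_orthonormal_bases[OF P]) metis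
  obtain h where h: "bij_betw h (Basis :: ('a^'d) set) (C1 \<union> C2)"
    using finite_same_card_bij[of "Basis :: ('a^'d) set" "C1 \<union> C2"] C(1,2,5) by auto
  define A where "A = {b\<in>Basis. h b \<in> C1}"
  define g where "g z = (\<Sum>b\<in>Basis. (z \<bullet> b) *\<^sub>R h b)" for z
  have hin: "h b \<in> C1 \<union> C2" if "b \<in> Basis" for b using h that by (rule bij_betw_apply)
  have hh: "h b \<bullet> h b' = (if b = b' then 1 else 0)" if "b \<in> Basis" "b' \<in> Basis" for b b'
  proof (cases "b = b'")
    case True
    then show ?thesis using C(7)[OF hin[OF that(1)]] by (simp add: norm_eq_1)
  next
    case False
    then have "h b \<noteq> h b'" using h that by (auto simp: bij_betw_def inj_on_def)
    then show ?thesis using C(6) hin that False by (auto simp: pairwise_def orthogonal_def)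
  qed
  have sq: "(\<Sum>b\<in>S. f b *\<^sub>R h b) \<bullet> (\<Sum>b\<in>S. f b *\<^sub>R h b) = (\<Sum>b\<in>S. (f b)\<^sup>2)"
    if "S \<subseteq> Basis" for S f
  proof -
    have finS: "finite S" using that finite_subset finite_Basis by blast
    have "(\<Sum>b\<in>S. f b *\<^sub>R h b) \<bullet> (\<Sum>b\<in>S. f b *\<^sub>R h b)
        = (\<Sum>b\<in>S. \<Sum>b'\<in>S. f b * (f b' * (if b = b' then 1 else 0)))"
      unfolding inner_sum_left inner_sum_right using that
      by (intro sum.cong refl) (auto simp: hh subset_iff)
    also have "\<dots> = (\<Sum>b\<in>S. (f b)\<^sup>2)"
      using finS by (simp add: if_distrib sum.delta power2_eq_square cong: if_cong)
    finally show ?thesis .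
  qed
  have lin: "linear g"
    by (intro linearI) (simp_all add: g_def inner_add_left scaleR_add_left sum.distrib scaleR_sum_right)
  have nrm: "norm (g z) = norm z" for z
  proof -
    have "g z \<bullet> g z = z \<bullet> z"
      unfolding g_def sq[OF order_refl] euclidean_inner[of z z] by (simp add: power2_eq_square)
    then show ?thesis by (simp add: norm_eq_sqrt_inner)
  qed
  have "inj_on h A" using h by (auto simp: A_def bij_betw_def inj_on_def)
  moreover have "h ` A = C1"
  proof
    show "C1 \<subseteq> h ` A"
    proof
      fix c assume c: "c \<in> C1"
      then have "c \<in> h ` Basis" using h by (simp add: bij_betw_def)
      then show "c \<in> h ` A" using c by (auto simp: A_def)
    qed
  qed (auto simp: A_def)
  ultimately have "card A = card C1" by (metis card_image)
  moreover have "qf P (g z) = (\<Sum>b\<in>A. (z \<bullet> b)\<^sup>2)" for z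
  proof -
    have "P *v (g z) = (\<Sum>b\<in>Basis. (z \<bullet> b) *\<^sub>R (P *v h b))"
      unfolding g_def by (simp add: linear_sum[OF linear_matrix] matrix_scaleR_vector)
    also have "\<dots> = (\<Sum>b\<in>A. (z \<bullet> b) *\<^sub>R h b)"
    proof (rule sum.mono_neutral_cong_right)
      show "\<forall>b\<in>Basis - A. (z \<bullet> b) *\<^sub>R (P *v h b) = 0"
        using hin C(9) unfolding A_def by (metis (mono_tags, lifting) DiffE Un_iff mem_Collect_eq scaleR_zero_right)
    qed (auto simp: A_def C(8))
    finally show ?thesis
      unfolding qf_Proj[OF P] power2_norm_eq_inner by (simp add: sq A_def)
  qed
  ultimately show ?thesis
    using that[of g A] lin nrm C(4) by (auto simp: A_def)
qed

section \<open>The Beta law for a fixed projection\<close>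

text \<open>
  The image measure is translation invariant and agrees with Lebesgue measure on balls around the
  origin; a translation invariant measure is determined by one such value.
\<close>

lemma lborel_isometry:
  fixes g :: "'b::euclidean_space \<Rightarrow> 'b"
  assumes lin: "linear g" and iso: "\<And>z. norm (g z) = norm z"
  shows "distr lborel borel g = lborel"
proof -
  define N where "N = distr lborel borel g"
  have gm [measurable]: "g \<in> borel_measurable borel"
    using lin by (intro borel_measurable_continuous_onI linear_continuous_on)
      (simp add: linear_conv_bounded_linear)
  have setsN [measurable_cong]: "sets N = sets borel" by (simp add: N_def)
  have "inj g" using lin iso by (metis linear_injective_0 norm_eq_zero)
  then have surj: "surj g" using lin linear_injective_imp_surjective by blast
  have trans: "(\<integral>\<^sup>+x. f (x + c) \<partial>N) = (\<integral>\<^sup>+x. f x \<partial>N)"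
    if [measurable]: "f \<in> borel_measurable borel" for f c
  proof -
    obtain d where d: "c = g d" using surj by auto
    have "(\<integral>\<^sup>+x. f (x + c) \<partial>N) = (\<integral>\<^sup>+x. f (g (d + x)) \<partial>lborel)"
      unfolding N_def by (subst nn_integral_distr) (auto simp: d linear_add[OF lin] add.commute)
    also have "\<dots> = (\<integral>\<^sup>+x. f (g x) \<partial>distr lborel borel ((+) d))"
      by (subst nn_integral_distr) auto
    also have "\<dots> = (\<integral>\<^sup>+x. f x \<partial>N)"
      unfolding lborel_distr_plus N_def by (subst nn_integral_distr) auto
    finally show ?thesis .
  qed
  have transL: "(\<integral>\<^sup>+x. f (x + c) \<partial>lborel) = (\<integral>\<^sup>+x. f x \<partial>lborel)"
    if [measurable]: "f \<in> borel_measurable borel" for f and c :: 'b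
  proof -
    have "(\<integral>\<^sup>+x. f x \<partial>lborel) = (\<integral>\<^sup>+x. f x \<partial>distr lborel borel ((+) c))"
      unfolding lborel_distr_plus ..
    also have "\<dots> = (\<integral>\<^sup>+x. f (x + c) \<partial>lborel)"
      by (subst nn_integral_distr) (auto simp: add.commute)
    finally show ?thesis ..
  qed
  have vimage_ball: "g -` ball 0 r = ball 0 r" for r
    by (auto simp: iso)
  have ballN: "emeasure N (ball 0 r) = emeasure lborel (ball (0::'b) r)" for r
    unfolding N_def by (subst emeasure_distr) (auto simp: vimage_ball)
  have sfN: "sigma_finite_measure N"
  proof
    show "\<exists>A. countable A \<and> A \<subseteq> sets N \<and> \<Union> A = space N \<and> (\<forall>a\<in>A. emeasure N a \<noteq> \<infinity>)"
    proof (intro exI[of _ "range (\<lambda>n::nat. ball (0::'b) (real n))"] conjI ballI)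
      show "countable (range (\<lambda>n::nat. ball (0::'b) (real n)))" by simp
      show "\<Union> (range (\<lambda>n::nat. ball (0::'b) (real n))) = space N"
        by (auto simp: N_def reals_Archimedean2)
      show "emeasure N a \<noteq> \<infinity>" if "a \<in> range (\<lambda>n::nat. ball (0::'b) (real n))" for a
        using that emeasure_lborel_ball_finite[of "0::'b"] by (auto simp: ballN) (metis less_irrefl)
    qed (auto simp: setsN)
  qed
  interpret N: sigma_finite_measure N by (rule sfN)
  interpret LN: pair_sigma_finite lborel N by standard
  let ?B = "indicator (ball (0::'b) 1) :: 'b \<Rightarrow> ennreal"
  let ?b = "emeasure lborel (ball (0::'b) 1)"
  have [measurable]: "ball (0::'b) 1 \<in> sets borel" by simp
  have "N = lborel"
  proof (rule measure_eqI)
    fix A assume "A \<in> sets N"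
    then have [measurable]: "A \<in> sets borel" by (simp add: setsN)
    \<comment> \<open>Two translations, one in each measure and with Fubini in between, move the set \<open>A\<close> from \<open>N\<close> to
      Lebesgue measure and the ball from Lebesgue measure to \<open>N\<close>.\<close>
    have "emeasure N A * ?b = (\<integral>\<^sup>+y. \<integral>\<^sup>+x. indicator A x * ?B y \<partial>N \<partial>lborel)"
      by (simp add: nn_integral_multc nn_integral_cmult nn_integral_cmult_indicator setsN)
    also have "\<dots> = (\<integral>\<^sup>+y. \<integral>\<^sup>+x. indicator A (x + y) * ?B y \<partial>N \<partial>lborel)"
      by (intro nn_integral_cong trans[symmetric]) measurable
    also have "\<dots> = (\<integral>\<^sup>+x. \<integral>\<^sup>+y. indicator A (x + y) * ?B y \<partial>lborel \<partial>N)"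
      by (rule LN.Fubini'[symmetric]) measurable
    also have "\<dots> = (\<integral>\<^sup>+x. \<integral>\<^sup>+y. indicator A y * ?B (y - x) \<partial>lborel \<partial>N)"
    proof (rule nn_integral_cong)
      fix x
      show "(\<integral>\<^sup>+y. indicator A (x + y) * ?B y \<partial>lborel) = (\<integral>\<^sup>+y. indicator A y * ?B (y - x) \<partial>lborel)"
        using transL[of "\<lambda>y. indicator A y * ?B (y - x)" x] by (simp add: add.commute)
    qed
    also have "\<dots> = (\<integral>\<^sup>+y. \<integral>\<^sup>+x. indicator A y * ?B (y - x) \<partial>N \<partial>lborel)"
      by (rule LN.Fubini') measurable
    also have "\<dots> = (\<integral>\<^sup>+y. indicator A y * ?b \<partial>lborel)"
    proof (rule nn_integral_cong)
      fix y
      have "(\<integral>\<^sup>+x. indicator A y * ?B (y - x) \<partial>N) = indicator A y * (\<integral>\<^sup>+x. ?B (y - x) \<partial>N)"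
        by (rule nn_integral_cmult) measurable
      also have "(\<integral>\<^sup>+x. ?B (y - x) \<partial>N) = (\<integral>\<^sup>+x. ?B (y - (x + y)) \<partial>N)"
        by (rule trans[symmetric]) measurable
      also have "\<dots> = (\<integral>\<^sup>+x. ?B x \<partial>N)"
        by (intro nn_integral_cong) (auto simp: indicator_def)
      also have "\<dots> = ?b" using ballN by (simp add: setsN)
      finally show "(\<integral>\<^sup>+x. indicator A y * ?B (y - x) \<partial>N) = indicator A y * ?b" .
    qed
    also have "\<dots> = emeasure lborel A * ?b" by (simp add: nn_integral_multc)
    finally have eq: "emeasure N A * ?b = emeasure lborel A * ?b" .
    have "?b \<noteq> 0" "?b \<noteq> \<infinity>"
      by (auto simp: emeasure_ball unit_ball_vol_def ennreal_eq_0_iff Gamma_real_pos not_le intro!: divide_pos_pos)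
    then show "emeasure N A = emeasure lborel A"
      using eq by (metis infinity_ennreal_def mult_divide_eq_ennreal)
  qed (simp add: setsN)
  then show ?thesis by (simp add: N_def)
qed

lemma nn_integral_powr_Ioc:
  fixes p x :: real
  assumes p: "p > 0" and x: "x \<ge> 0"
  shows "(\<integral>\<^sup>+r. ennreal (r powr (p - 1)) * indicator {0<..x} r \<partial>lborel) = ennreal (x powr p / p)"
proof -
  have "((\<lambda>r. r powr (p - 1)) has_integral (x powr (p - 1 + 1) / (p - 1 + 1))) {0..x}"
    by (rule has_integral_powr_from_0) (use p x in auto)
  then have int: "((\<lambda>r. r powr (p - 1)) has_integral (x powr p / p)) {0..x}" by simp
  have "(\<integral>\<^sup>+r. ennreal (r powr (p - 1)) * indicator {0<..x} r \<partial>lborel)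
      = (\<integral>\<^sup>+r. ennreal (r powr (p - 1)) * indicator {0..x} r \<partial>lborel)"
    by (intro nn_integral_cong) (auto simp: indicator_def)
  also have "\<dots> = ennreal (x powr p / p)"
    using nn_integral_has_integral_lebesgue[OF _ int] by (simp add: ennreal_mult' ennreal_indicator mult.commute)
  finally show ?thesis .
qed

text \<open>
  The volume of a ball is proportional to the power \<open>card A / 2\<close> of its squared radius; the density
  is the derivative of that power.
\<close>

lemma nn_integral_sum_squares:
  fixes A :: "'i set" and f :: "real \<Rightarrow> ennreal"
  assumes fin: "finite A" and ne: "A \<noteq> {}" and [measurable]: "f \<in> borel_measurable borel"
  defines "p \<equiv> real (card A) / 2"
  shows "(\<integral>\<^sup>+u. f (\<Sum>i\<in>A. (u i)\<^sup>2) \<partial>Pi\<^sub>M A (\<lambda>_. lborel))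
    = (\<integral>\<^sup>+r. ennreal (unit_ball_vol (card A) * p * r powr (p - 1)) * indicator {0<..} r * f r \<partial>lborel)"
proof -
  define V where "V = unit_ball_vol (card A)"
  have V: "V \<ge> 0" by (simp add: V_def)
  have p: "p > 0" using fin ne by (simp add: p_def card_gt_0_iff)
  define N1 :: "real measure" where "N1 = distr (Pi\<^sub>M A (\<lambda>_. lborel)) borel (\<lambda>u. \<Sum>i\<in>A. (u i)\<^sup>2)"
  define N2 where "N2 = density lborel (\<lambda>r. ennreal (V * p * r powr (p - 1)) * indicator {0<..} r)"
  have comp: "(\<lambda>u. u i) \<in> borel_measurable (Pi\<^sub>M A (\<lambda>_. lborel :: real measure))" if "i \<in> A" for i
    using measurable_component_singleton[OF that, of "\<lambda>_. lborel :: real measure"] by simp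
  have meas [measurable]: "(\<lambda>u. \<Sum>i\<in>A. (u i)\<^sup>2) \<in> borel_measurable (Pi\<^sub>M A (\<lambda>_. lborel :: real measure))"
    by (intro borel_measurable_sum borel_measurable_power comp)
  have N1_pos: "emeasure N1 {..x} = ennreal (V * x powr p)" if "x > 0" for x
  proof -
    have "emeasure N1 {..x} = emeasure (Pi\<^sub>M A (\<lambda>_. lborel))
            ({f. sqrt (\<Sum>i\<in>A. (f i)\<^sup>2) \<le> sqrt x} \<inter> space (Pi\<^sub>M A (\<lambda>_. lborel)))"
      unfolding N1_def using that
      by (subst emeasure_distr) (auto intro!: arg_cong2[where f=emeasure])
    also have "\<dots> = ennreal (V * sqrt x ^ card A)"
      using emeasure_cball_aux[OF fin, of "sqrt x"] that by (simp add: V_def)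
    also have "sqrt x ^ card A = x powr p"
      using that by (simp add: p_def powr_half_sqrt[symmetric] powr_realpow[symmetric] powr_powr)
    finally show ?thesis .
  qed
  have N1_0: "emeasure N1 {..0} = 0"
  proof -
    have "((\<lambda>x. V * x powr p) \<longlongrightarrow> V * 0 powr p) (at_right 0)"
      by (rule tendsto_eq_intros tendsto_powr' | use p in \<open>simp add: eventually_at_filter\<close>)+
    then have "((\<lambda>x. ennreal (V * x powr p)) \<longlongrightarrow> 0) (at_right 0)"
      using tendsto_ennrealI by fastforce
    then have "emeasure N1 {..0} \<le> 0"
    proof (rule tendsto_lowerbound)
      show "\<forall>\<^sub>F x in at_right 0. emeasure N1 {..0} \<le> ennreal (V * x powr p)"
        unfolding eventually_at_right_field
      proof (intro exI[of _ 1] conjI allI impI)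
        fix x :: real assume x: "0 < x"
        have "emeasure N1 {..0} \<le> emeasure N1 {..x}"
          by (rule emeasure_mono) (use x in \<open>auto simp: N1_def\<close>)
        then show "emeasure N1 {..0} \<le> ennreal (V * x powr p)" using N1_pos[OF x] by simp
      qed simp
    qed simp
    then show ?thesis by simp
  qed
  have N2: "emeasure N2 {..x} = ennreal (V * (max x 0) powr p)" for x
  proof -
    have "emeasure N2 {..x}
        = (\<integral>\<^sup>+r. ennreal (V * p) * (ennreal (r powr (p - 1)) * indicator {0<..max x 0} r) \<partial>lborel)"
      unfolding N2_def using p V
      by (subst emeasure_density) (auto intro!: nn_integral_cong simp: indicator_def ennreal_mult max_def)
    also have "\<dots> = ennreal (V * p) * ennreal ((max x 0) powr p / p)"
      using p by (subst nn_integral_cmult) (auto simp: nn_integral_powr_Ioc)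
    also have "\<dots> = ennreal (V * (max x 0) powr p)"
      using p V by (subst ennreal_mult[symmetric]) auto
    finally show ?thesis .
  qed
  have "N1 = N2"
  proof (rule measure_eqI_generator_eq[where E="range atMost" and \<Omega>=UNIV and A="\<lambda>n::nat. {..real n}"])
    show "Int_stable (range atMost :: real set set)"
      by (auto simp: Int_stable_def)
    show "sets N1 = sigma_sets UNIV (range atMost)" "sets N2 = sigma_sets UNIV (range atMost)"
      by (simp_all add: N1_def N2_def borel_eq_atMost)
    show "(\<Union>n::nat. {..real n}) = UNIV" by (auto simp: real_arch_simple)
    show "emeasure N1 X = emeasure N2 X" if "X \<in> range atMost" for X
    proof -
      obtain x where X: "X = {..x}" using \<open>X \<in> range atMost\<close> by auto
      show ?thesis
      proof (cases "x > 0")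
        case True
        then show ?thesis using N1_pos N2 by (simp add: X max_def)
      next
        case False
        have "emeasure N1 {..x} \<le> emeasure N1 {..0}"
          by (rule emeasure_mono) (use False in \<open>auto simp: N1_def\<close>)
        then show ?thesis using False N1_0 N2 by (simp add: X max_def)
      qed
    qed
    show "emeasure N1 {..real n} \<noteq> \<infinity>" for n
    proof (cases "n = 0")
      case False
      then show ?thesis using N1_pos[of "real n"] by simp
    qed (use N1_0 in simp)
  qed auto
  have "(\<integral>\<^sup>+u. f (\<Sum>i\<in>A. (u i)\<^sup>2) \<partial>Pi\<^sub>M A (\<lambda>_. lborel)) = (\<integral>\<^sup>+r. f r \<partial>N1)"
    unfolding N1_def by (subst nn_integral_distr) auto
  also have "\<dots> = (\<integral>\<^sup>+r. ennreal (V * p * r powr (p - 1)) * indicator {0<..} r * f r \<partial>lborel)"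
    unfolding \<open>N1 = N2\<close> N2_def by (subst nn_integral_density) auto
  finally show ?thesis by (simp add: V_def)
qed

definition beta_weight :: "real \<Rightarrow> real \<Rightarrow> real"
  where "beta_weight a y = (y * (1 - y)) powr (a - 1)"

lemma beta_weight_nonneg [simp]: "0 \<le> beta_weight a y"
  by (simp add: beta_weight_def)

lemma measurable_beta_weight [measurable]: "beta_weight a \<in> borel_measurable borel"
  unfolding beta_weight_def[abs_def] by measurable

text \<open>
  The affine substitutions \<open>s = r + t\<close> and \<open>r = s * y\<close> factor the double integral into one in \<open>s\<close>
  and one in the ratio \<open>y\<close>. The restriction to \<open>r + t \<le> 1\<close> makes the first factor finite.
\<close>

lemma nn_integral_ratio:
  fixes \<phi> :: "real \<Rightarrow> ennreal" and c a :: real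
  assumes a: "a > 0" and c: "c \<ge> 0" and [measurable]: "\<phi> \<in> borel_measurable borel"
  shows "(\<integral>\<^sup>+r. ennreal (c * r powr (a - 1)) * indicator {0<..} r *
           (\<integral>\<^sup>+t. ennreal (c * t powr (a - 1)) * indicator {0<..} t *
              (indicator {..1} (r + t) * \<phi> (r / (r + t))) \<partial>lborel) \<partial>lborel)
       = ennreal (c\<^sup>2 / (2 * a)) *
           (\<integral>\<^sup>+y. ennreal (beta_weight a y) * indicator {0<..<1} y * \<phi> y \<partial>lborel)"
    (is "?L = _ * ?J")
proof -
  define w where "w r = ennreal (c * r powr (a - 1)) * indicator {0<..} r" for r
  have [measurable]: "w \<in> borel_measurable borel" unfolding w_def[abs_def] by measurable
  have "?L = (\<integral>\<^sup>+r. (\<integral>\<^sup>+t. w r * (w t * (indicator {..1} (r + t) * \<phi> (r / (r + t)))) \<partial>lborel) \<partial>lborel)"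
    unfolding w_def[symmetric] by (simp add: nn_integral_cmult)
  also have "\<dots> = (\<integral>\<^sup>+r. (\<integral>\<^sup>+s. w r * (w (s - r) * (indicator {..1} s * \<phi> (r / s))) \<partial>lborel) \<partial>lborel)"
  proof (rule nn_integral_cong)
    fix r
    show "(\<integral>\<^sup>+t. w r * (w t * (indicator {..1} (r + t) * \<phi> (r / (r + t)))) \<partial>lborel)
        = (\<integral>\<^sup>+s. w r * (w (s - r) * (indicator {..1} s * \<phi> (r / s))) \<partial>lborel)"
      by (subst nn_integral_real_affine[where c=1 and t="-r"]) auto
  qed
  also have "\<dots> = (\<integral>\<^sup>+s. (\<integral>\<^sup>+r. w r * (w (s - r) * (indicator {..1} s * \<phi> (r / s))) \<partial>lborel) \<partial>lborel)"
    by (rule lborel_pair.Fubini') measurable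
  also have "\<dots> = (\<integral>\<^sup>+s. ennreal (c\<^sup>2) * (ennreal (s powr (2 * a - 1)) * indicator {0<..1} s) * ?J \<partial>lborel)"
  proof (rule nn_integral_cong)
    fix s :: real
    show "(\<integral>\<^sup>+r. w r * (w (s - r) * (indicator {..1} s * \<phi> (r / s))) \<partial>lborel)
        = ennreal (c\<^sup>2) * (ennreal (s powr (2 * a - 1)) * indicator {0<..1} s) * ?J"
    proof (cases "s > 0 \<and> s \<le> 1")
      case False
      have "(\<integral>\<^sup>+r. w r * (w (s - r) * (indicator {..1} s * \<phi> (r / s))) \<partial>lborel) = integral\<^sup>N lborel (\<lambda>r::real. 0)"
        by (rule nn_integral_cong) (use False in \<open>auto simp: w_def indicator_def\<close>)
      then show ?thesis using False by auto
    next
      case True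
      have "(\<integral>\<^sup>+r. w r * (w (s - r) * (indicator {..1} s * \<phi> (r / s))) \<partial>lborel)
          = ennreal s * (\<integral>\<^sup>+y. w (s * y) * (w (s - s * y) * (indicator {..1} s * \<phi> (s * y / s))) \<partial>lborel)"
        using True by (subst nn_integral_real_affine[where c=s and t=0]) auto
      also have "(\<integral>\<^sup>+y. w (s * y) * (w (s - s * y) * (indicator {..1} s * \<phi> (s * y / s))) \<partial>lborel)
          = (\<integral>\<^sup>+y. ennreal (c\<^sup>2 * s powr (2 * a - 2)) *
              (ennreal (beta_weight a y) * indicator {0<..<1} y * \<phi> y) \<partial>lborel)"
      proof (rule nn_integral_cong)
        fix y :: real
        show "w (s * y) * (w (s - s * y) * (indicator {..1} s * \<phi> (s * y / s)))
          = ennreal (c\<^sup>2 * s powr (2 * a - 2)) * (ennreal (beta_weight a y) * indicator {0<..<1} y * \<phi> y)"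
        proof (cases "0 < y \<and> y < 1")
          case False
          then have "w (s * y) = 0 \<or> w (s - s * y) = 0"
            using True by (auto simp: w_def indicator_def zero_less_mult_iff)
          then show ?thesis using False by auto
        next
          case y: True
          have sy: "s - s * y = s * (1 - y)" by (simp add: algebra_simps)
          have "w (s * y) * w (s - s * y) = ennreal ((c * (s * y) powr (a - 1)) * (c * (s * (1 - y)) powr (a - 1)))"
            unfolding sy using True y c by (simp add: w_def ennreal_mult)
          also have "(c * (s * y) powr (a - 1)) * (c * (s * (1 - y)) powr (a - 1))
              = c\<^sup>2 * s powr (2 * a - 2) * beta_weight a y"
          proof -
            have S: "s powr (2 * a - 2) = s powr (a - 1) * s powr (a - 1)"
              by (simp add: powr_add[symmetric])
            have "(s * y) powr (a - 1) = s powr (a - 1) * y powr (a - 1)"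
              "(s * (1 - y)) powr (a - 1) = s powr (a - 1) * (1 - y) powr (a - 1)"
              "beta_weight a y = y powr (a - 1) * (1 - y) powr (a - 1)"
              using True y by (auto simp: beta_weight_def powr_mult)
            then show ?thesis
              unfolding S by (simp only: power2_eq_square mult_ac)
          qed
          finally have "w (s * y) * w (s - s * y) = ennreal (c\<^sup>2 * s powr (2 * a - 2)) * ennreal (beta_weight a y)"
            using c by (simp add: ennreal_mult)
          then show ?thesis using True y by (simp add: mult.assoc[symmetric])
        qed
      qed
      also have "\<dots> = ennreal (c\<^sup>2 * s powr (2 * a - 2)) * ?J"
        by (rule nn_integral_cmult) measurable
      also have "ennreal s * (ennreal (c\<^sup>2 * s powr (2 * a - 2)) * ?J)
          = ennreal (s * (c\<^sup>2 * s powr (2 * a - 2))) * ?J"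
        using True by (simp add: ennreal_mult mult.assoc)
      also have "s * (c\<^sup>2 * s powr (2 * a - 2)) = c\<^sup>2 * s powr (2 * a - 1)"
        using True powr_mult_base[of s "2 * a - 2"] by simp
      finally show ?thesis using True by (simp add: ennreal_mult)
    qed
  qed
  also have "\<dots> = (\<integral>\<^sup>+s. ennreal (c\<^sup>2) * (ennreal (s powr (2 * a - 1)) * indicator {0<..1} s) \<partial>lborel) * ?J"
    by (rule nn_integral_multc) measurable
  also have "(\<integral>\<^sup>+s. ennreal (c\<^sup>2) * (ennreal (s powr (2 * a - 1)) * indicator {0<..1} s) \<partial>lborel)
      = ennreal (c\<^sup>2) * (\<integral>\<^sup>+s. ennreal (s powr (2 * a - 1)) * indicator {0<..1} s \<partial>lborel)"
    by (rule nn_integral_cmult) measurable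
  also have "\<dots> = ennreal (c\<^sup>2 / (2 * a))"
    using a by (subst nn_integral_powr_Ioc) (auto simp: ennreal_mult[symmetric])
  finally show ?thesis .
qed

text \<open>
  In the coordinates of \<open>Proj_isometry\<close> the ratio is \<open>r / (r + t)\<close> for the squared radii \<open>r\<close> and
  \<open>t\<close> of two orthogonal coordinate subspaces of dimension \<open>2 * a\<close>. What matters is that the right-hand
  side does not mention \<open>P\<close>.
\<close>

lemma nn_integral_ball_ratio:
  fixes P :: "'a::real_or_complex^'d^'d" and \<phi> :: "real \<Rightarrow> ennreal"
  assumes P: "P \<in> Proj n" and n: "n \<ge> 1" and d: "CARD('d) = 2 * n"
    and [measurable]: "\<phi> \<in> borel_measurable borel"
  defines "a \<equiv> rc_beta TYPE('a) * n"
  shows "(\<integral>\<^sup>+z. indicator (cball 0 1) z * \<phi> (qf P z / (norm z)\<^sup>2) \<partial>lborel)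
    = ennreal ((unit_ball_vol (2 * a) * a)\<^sup>2 / (2 * a)) *
        (\<integral>\<^sup>+y. ennreal (beta_weight a y) * indicator {0<..<1} y * \<phi> y \<partial>lborel)"
proof -
  obtain g :: "'a^'d \<Rightarrow> 'a^'d" and A where lin: "linear g" and iso: "\<And>z. norm (g z) = norm z"
    and A: "A \<subseteq> Basis" "card A = DIM('a) * n" and qfg: "\<And>z. qf P (g z) = (\<Sum>b\<in>A. (z \<bullet> b)\<^sup>2)"
    by (rule Proj_isometry[OF P]) metis
  define A' where "A' = Basis - A"
  have finA: "finite A" "finite A'" using finite_subset[OF A(1) finite_Basis] by (auto simp: A'_def)
  have a2: "2 * a = real (DIM('a) * n)" by (simp add: a_def rc_beta_def)
  have cardA': "card A' = DIM('a) * n"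
    using A finA by (simp add: A'_def card_Diff_subset d)
  have dn: "DIM('a) * n > 0" using n by simp
  have neA: "A \<noteq> {}" "A' \<noteq> {}" using A(2) cardA' dn by auto
  have a0: "a > 0" using a2 dn by (metis mult_pos_pos of_nat_0_less_iff zero_less_mult_pos zero_less_numeral)
  have un: "A \<union> A' = Basis" and dj: "A \<inter> A' = {}" using A(1) by (auto simp: A'_def)
  define G where "G r t = (indicator {..1} (r + t) * \<phi> (r / (r + t)) :: ennreal)" for r t
  have [measurable]: "(\<lambda>(r, t). G r t) \<in> borel_measurable (borel \<Otimes>\<^sub>M borel)"
    unfolding G_def[abs_def] by measurable
  have gm [measurable]: "g \<in> borel_measurable borel"
    using lin by (intro borel_measurable_continuous_onI linear_continuous_on)
      (simp add: linear_conv_bounded_linear)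
  have qm [measurable]: "qf P \<in> borel_measurable borel"
    unfolding qf_def[abs_def]
    by (intro borel_measurable_continuous_onI continuous_intros linear_continuous_on)
       (simp add: linear_conv_bounded_linear[symmetric])
  define F where "F z = indicator (cball 0 1) z * \<phi> (qf P z / (norm z)\<^sup>2)" for z
  have ratio: "(\<lambda>z. qf P z / (norm z)\<^sup>2) \<in> borel_measurable borel"
    by (intro borel_measurable_divide qm borel_measurable_power borel_measurable_norm measurable_ident_sets refl)
  have Fm [measurable]: "F \<in> borel_measurable borel"
    unfolding F_def[abs_def]
    by (intro borel_measurable_times_ennreal borel_measurable_indicator
        measurable_compose[OF ratio] assms) simp
  have nz: "(norm z)\<^sup>2 = (\<Sum>b\<in>A. (z \<bullet> b)\<^sup>2) + (\<Sum>b\<in>A'. (z \<bullet> b)\<^sup>2)" for z :: "'a^'d"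
  proof -
    have "(norm z)\<^sup>2 = (\<Sum>b\<in>Basis. (z \<bullet> b)\<^sup>2)"
      unfolding power2_norm_eq_inner euclidean_inner[of z z] by (simp add: power2_eq_square)
    then show ?thesis unfolding un[symmetric] using finA dj by (simp add: sum.union_disjoint)
  qed
  have FG: "F (g z) = G (\<Sum>b\<in>A. (z \<bullet> b)\<^sup>2) (\<Sum>b\<in>A'. (z \<bullet> b)\<^sup>2)" for z
  proof -
    have "norm z \<le> 1 \<longleftrightarrow> (norm z)\<^sup>2 \<le> 1" by (simp add: abs_square_le_1)
    then show ?thesis
      unfolding F_def G_def qfg iso nz[symmetric] by (simp add: indicator_def iso)
  qed
  interpret product_sigma_finite "\<lambda>_::'a^'d. lborel :: real measure" by standard
  have "(\<integral>\<^sup>+z. F z \<partial>lborel) = (\<integral>\<^sup>+z. F z \<partial>distr lborel borel g)"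
    unfolding lborel_isometry[OF lin iso] ..
  also have "\<dots> = (\<integral>\<^sup>+z. F (g z) \<partial>lborel)"
    by (subst nn_integral_distr) auto
  also have "\<dots> = (\<integral>\<^sup>+f. F (g (\<Sum>b\<in>Basis. f b *\<^sub>R b)) \<partial>Pi\<^sub>M Basis (\<lambda>_. lborel))"
    by (subst lborel_eq) (subst nn_integral_distr, auto)
  also have "\<dots> = (\<integral>\<^sup>+f. G (\<Sum>b\<in>A. (f b)\<^sup>2) (\<Sum>b\<in>A'. (f b)\<^sup>2) \<partial>Pi\<^sub>M (A \<union> A') (\<lambda>_. lborel))"
  proof -
    have "(\<Sum>b\<in>S. ((\<Sum>b\<in>Basis. f b *\<^sub>R b) \<bullet> b)\<^sup>2) = (\<Sum>b\<in>S. (f b)\<^sup>2)" if "S \<subseteq> (Basis :: ('a^'d) set)" for S f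
      using that by (intro sum.cong refl) (auto simp: subset_iff)
    then show ?thesis using A(1) unfolding FG un by (simp add: A'_def)
  qed
  also have "\<dots> = (\<integral>\<^sup>+u. \<integral>\<^sup>+v. G (\<Sum>b\<in>A. (u b)\<^sup>2) (\<Sum>b\<in>A'. (v b)\<^sup>2)
      \<partial>Pi\<^sub>M A' (\<lambda>_. lborel) \<partial>Pi\<^sub>M A (\<lambda>_. lborel))"
  proof -
    have "(\<Sum>b\<in>A. (merge A A' (u, v) b)\<^sup>2) = (\<Sum>b\<in>A. (u b)\<^sup>2)"
      "(\<Sum>b\<in>A'. (merge A A' (u, v) b)\<^sup>2) = (\<Sum>b\<in>A'. (v b)\<^sup>2)" for u v :: "'a^'d \<Rightarrow> real"
      using dj by (auto intro!: sum.cong simp: merge_def)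
    then show ?thesis
      using product_nn_integral_fold[OF dj finA,
          of "\<lambda>f. G (\<Sum>b\<in>A. (f b)\<^sup>2) (\<Sum>b\<in>A'. (f b)\<^sup>2)"] by simp
  qed
  also have "\<dots> = (\<integral>\<^sup>+r. ennreal (unit_ball_vol (2 * a) * a * r powr (a - 1)) * indicator {0<..} r *
      (\<integral>\<^sup>+t. ennreal (unit_ball_vol (2 * a) * a * t powr (a - 1)) * indicator {0<..} t * G r t \<partial>lborel) \<partial>lborel)"
  proof -
    have ca: "real (card A) / 2 = a" "real (card A') / 2 = a" using A(2) cardA' a2 by auto
    have cb: "real (card A) = 2 * a" "real (card A') = 2 * a" using A(2) cardA' a2 by auto
    have "(\<integral>\<^sup>+v. G r (\<Sum>b\<in>A'. (v b)\<^sup>2) \<partial>Pi\<^sub>M A' (\<lambda>_. lborel))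
      = (\<integral>\<^sup>+t. ennreal (unit_ball_vol (2 * a) * a * t powr (a - 1)) * indicator {0<..} t * G r t \<partial>lborel)" for r
      using nn_integral_sum_squares[OF finA(2) neA(2), of "G r"] unfolding ca cb by simp
    then show ?thesis
      using nn_integral_sum_squares[OF finA(1) neA(1),
          of "\<lambda>r. (\<integral>\<^sup>+t. ennreal (unit_ball_vol (2 * a) * a * t powr (a - 1)) * indicator {0<..} t * G r t \<partial>lborel)"]
      unfolding ca cb by simp
  qed
  also have "\<dots> = ennreal ((unit_ball_vol (2 * a) * a)\<^sup>2 / (2 * a)) *
        (\<integral>\<^sup>+y. ennreal (beta_weight a y) * indicator {0<..<1} y * \<phi> y \<partial>lborel)"
    unfolding G_def using a0 by (intro nn_integral_ratio) auto
  finally show ?thesis by (simp add: F_def)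
qed

section \<open>Beta integrals\<close>

lemma Beta_pos_real: "0 < a \<Longrightarrow> 0 < b \<Longrightarrow> 0 < Beta a (b::real)"
  by (simp add: Beta_def)

lemma beta_weight_eq: "0 < y \<Longrightarrow> y < 1 \<Longrightarrow> beta_weight a y = y powr (a - 1) * (1 - y) powr (a - 1)"
  by (simp add: beta_weight_def powr_mult)

lemma nn_integral_beta_weight:
  assumes a: "a > 0"
  shows "(\<integral>\<^sup>+y. ennreal (beta_weight a y) * indicator {0<..<1} y \<partial>lborel) = ennreal (Beta a a)"
proof -
  have int: "((\<lambda>t. t powr (a - 1) * (1 - t) powr (a - 1)) has_integral Beta a a) {0<..<1}"
    using has_integral_Beta_real[OF a a] by (simp add: has_integral_Icc_iff_Ioo)
  have "(\<integral>\<^sup>+y. ennreal (beta_weight a y) * indicator {0<..<1} y \<partial>lborel)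
      = (\<integral>\<^sup>+y. ennreal (y powr (a - 1) * (1 - y) powr (a - 1)) * indicator {0<..<1} y \<partial>lborel)"
    by (intro nn_integral_cong) (auto simp: indicator_def beta_weight_eq)
  also have "\<dots> = ennreal (Beta a a)"
    using nn_integral_has_integral_lebesgue[OF _ int]
    by (simp add: ennreal_mult' ennreal_indicator mult_ac)
  finally show ?thesis .
qed

text \<open>\<open>- (y * (1 - y)) powr a / (2 * a)\<close> is an antiderivative of \<open>(y - 1 / 2) * beta_weight a y\<close>.\<close>

lemma nn_integral_beta_weight_abs:
  assumes a: "a > 0"
  shows "(\<integral>\<^sup>+y. ennreal (beta_weight a y) * indicator {0<..<1} y * ennreal \<bar>y - 1/2\<bar> \<partial>lborel)
    = ennreal (1 / (a * 4 powr a))"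
proof -
  define H where "H y = - ((y * (1 - y)) powr a) / (2 * a)" for y :: real
  define f where "f y = (y - 1/2) * beta_weight a y" for y
  have der: "(H has_vector_derivative f y) (at y)" if "y \<in> {0<..<1}" for y
  proof -
    have pos: "y * (1 - y) > 0" using that by simp
    have "(H has_real_derivative (- (a * (y * (1 - y)) powr (a - 1) * (1 - 2 * y)) / (2 * a))) (at y)"
      unfolding H_def using pos a
      by (auto intro!: derivative_eq_intros simp: field_simps)
    also have "- (a * (y * (1 - y)) powr (a - 1) * (1 - 2 * y)) / (2 * a) = f y"
      using a by (simp add: f_def beta_weight_def field_simps)
    finally show ?thesis by (simp add: has_real_derivative_iff_has_vector_derivative)
  qed
  have cont: "continuous_on {0..1} H"
    unfolding H_def using a by (intro continuous_intros continuous_on_powr') auto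
  have ends: "H 0 = 0" "H 1 = 0" "H (1/2) = - (1 / (2 * a * 4 powr a))"
    using a by (auto simp: H_def powr_divide field_simps)
  have r: "(f has_integral (1 / (2 * a * 4 powr a))) {1/2..1}"
    using fundamental_theorem_of_calculus_interior[of "1/2" 1 H f] der continuous_on_subset[OF cont]
    by (auto simp: ends)
  have l: "((\<lambda>y. - f y) has_integral (1 / (2 * a * 4 powr a))) {0..1/2}"
    using fundamental_theorem_of_calculus_interior[of 0 "1/2" H f] der continuous_on_subset[OF cont]
    by (auto simp: ends dest: has_integral_neg)
  have "((\<lambda>y. beta_weight a y * \<bar>y - 1/2\<bar>) has_integral (1 / (2 * a * 4 powr a))) {1/2..1}"
    by (rule has_integral_eq[OF _ r]) (simp add: f_def)
  moreover have "((\<lambda>y. beta_weight a y * \<bar>y - 1/2\<bar>) has_integral (1 / (2 * a * 4 powr a))) {0..1/2}"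
    by (rule has_integral_eq[OF _ l]) (simp add: f_def algebra_simps)
  ultimately have "((\<lambda>y. beta_weight a y * \<bar>y - 1/2\<bar>) has_integral
      (1 / (2 * a * 4 powr a) + 1 / (2 * a * 4 powr a))) {0..1}"
    by (intro has_integral_combine[of 0 "1/2" 1]) auto
  also have "1 / (2 * a * 4 powr a) + 1 / (2 * a * 4 powr a) = 1 / (a * 4 powr a)"
    using a by (simp add: field_simps)
  finally have int: "((\<lambda>y. beta_weight a y * \<bar>y - 1/2\<bar>) has_integral (1 / (a * 4 powr a))) {0<..<1}"
    by (simp add: has_integral_Icc_iff_Ioo)
  have "(\<integral>\<^sup>+y. ennreal (beta_weight a y) * indicator {0<..<1} y * ennreal \<bar>y - 1/2\<bar> \<partial>lborel)
      = (\<integral>\<^sup>+y. ennreal (indicator {0<..<1} y * (beta_weight a y * \<bar>y - 1/2\<bar>)) \<partial>lborel)"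
    by (intro nn_integral_cong) (auto simp: indicator_def ennreal_mult)
  also have "\<dots> = ennreal (1 / (a * 4 powr a))"
    using nn_integral_has_integral_lebesgue[OF _ int] by simp
  finally show ?thesis .
qed

text \<open>
  For \<open>a \<ge> 1\<close> the weight is largest at \<open>1 / 2\<close>.
\<close>

lemma nn_integral_beta_weight_small_ball:
  assumes a: "a \<ge> 1" and s: "s \<ge> 0"
  shows "(\<integral>\<^sup>+y. ennreal (beta_weight a y) * indicator {0<..<1} y * indicator {1/2 - s..1/2 + s} y \<partial>lborel)
    \<le> ennreal (2 * s * 4 powr (1 - a))"
proof -
  have bw: "beta_weight a y \<le> 4 powr (1 - a)" if "0 < y" "y < 1" for y :: real
  proof -
    have "y * (1 - y) \<le> 1 / 4" using zero_le_power2[of "y - 1/2"] by (simp add: power2_eq_square algebra_simps)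
    then have "beta_weight a y \<le> (1 / 4) powr (a - 1)"
      unfolding beta_weight_def using that a by (intro powr_mono2) auto
    also have "\<dots> = 4 powr (1 - a)"
      using powr_minus_divide[of 4 "a - 1"] by (simp add: powr_divide)
    finally show ?thesis .
  qed
  have "(\<integral>\<^sup>+y. ennreal (beta_weight a y) * indicator {0<..<1} y * indicator {1/2 - s..1/2 + s} y \<partial>lborel)
    \<le> (\<integral>\<^sup>+y. ennreal (4 powr (1 - a)) * indicator {1/2 - s..1/2 + s} y \<partial>lborel)"
    by (intro nn_integral_mono) (auto simp: indicator_def bw)
  also have "\<dots> = ennreal (4 powr (1 - a)) * ennreal (2 * s)"
    using s by (simp add: nn_integral_cmult)
  also have "\<dots> = ennreal (2 * s * 4 powr (1 - a))"
    using s by (simp add: ennreal_mult[symmetric] mult.commute)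
  finally show ?thesis .
qed

section \<open>Uniformly distributed projections\<close>

lemma continuous_qf: "continuous_on UNIV (\<lambda>(P :: 'a::real_or_complex^'d^'d, z). qf P z)"
  unfolding qf_def matrix_vector_mult_def inner_vec_def case_prod_beta
  by (simp only: vec_lambda_beta) (intro continuous_intros)

lemma continuous_qf' [continuous_intros]:
  fixes f :: "'t::topological_space \<Rightarrow> 'a::real_or_complex^'d^'d"
  assumes "continuous_on S f" "continuous_on S g"
  shows "continuous_on S (\<lambda>t. qf (f t) (g t))"
  using continuous_on_compose2[OF continuous_qf, of S "\<lambda>t. (f t, g t)"] assms
  by (auto intro: continuous_on_Pair)

lemma borel_measurable_qf [measurable (raw)]:
  fixes f :: "'m \<Rightarrow> 'a::real_or_complex^'d^'d"
  assumes "f \<in> borel_measurable M" "g \<in> borel_measurable M"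
  shows "(\<lambda>x. qf (f x) (g x)) \<in> borel_measurable M"
proof -
  have "(\<lambda>(P :: 'a^'d^'d, z). qf P z) \<in> borel_measurable (borel \<Otimes>\<^sub>M borel)"
    unfolding borel_prod by (rule borel_measurable_continuous_onI[OF continuous_qf])
  moreover have "(\<lambda>x. (f x, g x)) \<in> M \<rightarrow>\<^sub>M borel \<Otimes>\<^sub>M borel"
    using assms by (rule measurable_Pair)
  ultimately show ?thesis by (auto dest: measurable_compose)
qed

lemma householder_conj_Proj:
  assumes v: "v \<noteq> 0" and P: "P \<in> Proj k"
  shows "householder v ** P ** householder v \<in> Proj k"
proof -
  let ?U = "householder v" and ?R = "householder v ** P ** householder v"
  have R: "?R *v z = ?U *v (P *v (?U *v z))" for z
    by (simp only: matrix_vector_mul_assoc[symmetric])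
  have "cip x (?R *v y) = cip (?R *v x) y" for x y
    by (simp only: R cip_matrix ctranspose_householder Proj_hermitian[OF P])
  then have "cip (ctranspose ?R *v x - ?R *v x) y = 0" for x y
    by (simp add: cip_simps cip_matrix[symmetric])
  then have "ctranspose ?R *v x - ?R *v x = 0" for x
    using rc_re_cip[of "ctranspose ?R *v x - ?R *v x" "ctranspose ?R *v x - ?R *v x"] by simp
  then have herm: "ctranspose ?R = ?R" by (simp add: matrix_eq)
  have idem: "?R ** ?R = ?R"
    unfolding matrix_eq
    by (simp only: matrix_vector_mul_assoc[symmetric] householder_involution[OF v] Proj_idem[OF P] simp_thms)
  have inj: "inj ((*v) ?U)" by (metis injI householder_involution[OF v])
  have "range ((*v) ?R) = (*v) ?U ` range ((*v) P)"
  proof (intro equalityI subsetI)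
    fix y assume "y \<in> (*v) ?U ` range ((*v) P)"
    then obtain z where "y = ?U *v (P *v z)" by auto
    then have "y = ?R *v (?U *v z)" unfolding R householder_involution[OF v] .
    then show "y \<in> range ((*v) ?R)" by blast
  qed (auto simp: R)
  then have "dim (range ((*v) ?R)) = dim (range ((*v) P))"
    using dim_image_eq[of "(*v) ?U" "range ((*v) P)"] inj by (simp add: inj_on_subset)
  then have "rank ?R = k"
    using dim_range_hermitian[OF herm] dim_range_hermitian[OF Proj_hermitian[OF P]] Proj_rank[OF P] by simp
  then show ?thesis using herm idem by (simp add: Proj_def)
qed

lemma qf_householder_conj: "qf (householder v ** P ** householder v) z = qf P (householder v *v z)"
  unfolding qf_def matrix_vector_mul_assoc[symmetric]
  by (rule inner_hermitian[OF ctranspose_householder])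

text \<open>
  The dimension is twice the rank, so a projection and its complement have the same rank. This is the
  source of the symmetry of all distributions below about \<open>1 / 2\<close>.
\<close>

locale uniform_projection =
  fixes n :: nat and \<mu> :: "('a::real_or_complex^'d^'d) measure"
  assumes unif: "uniform_on_Proj n \<mu>" and n: "n \<ge> 1" and d: "CARD('d) = 2 * n"
begin

sublocale prob_space \<mu> using unif by (simp add: uniform_on_Proj_def)

lemma sets_\<mu>: "sets \<mu> = sets (Proj_borel n)"
  using unif by (simp add: uniform_on_Proj_def)

lemma space_\<mu>: "space \<mu> = Proj n"
  using sets_eq_imp_space_eq[OF sets_\<mu>] by (simp add: space_restrict_space)

lemma measurable_into_borel [measurable]: "(\<lambda>P. P) \<in> borel_measurable \<mu>"
proof -
  have "(\<lambda>P. P) \<in> borel_measurable (Proj_borel n)" by (rule measurable_restrict_space1) simp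
  then show ?thesis by (subst measurable_cong_sets[OF sets_\<mu> refl])
qed

lemma conj_measurable:
  assumes v: "v \<noteq> 0"
  shows "(\<lambda>P. householder v ** P ** householder v) \<in> \<mu> \<rightarrow>\<^sub>M \<mu>"
proof -
  have "continuous_on UNIV (\<lambda>P :: 'a^'d^'d. householder v ** P ** householder v)"
    unfolding matrix_matrix_mult_def
    by (simp only: vec_lambda_beta) (intro continuous_intros continuous_on_vec_lambda)
  then have "(\<lambda>P :: 'a^'d^'d. householder v ** P ** householder v) \<in> borel_measurable borel"
    by (rule borel_measurable_continuous_onI)
  then have "(\<lambda>P. householder v ** P ** householder v) \<in> borel_measurable \<mu>"
    by (rule measurable_compose[OF measurable_into_borel])
  then have "(\<lambda>P. householder v ** P ** householder v) \<in> \<mu> \<rightarrow>\<^sub>M Proj_borel n"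
    by (intro measurable_restrict_space2) (auto simp: space_\<mu> householder_conj_Proj[OF v])
  then show ?thesis by (subst measurable_cong_sets[OF refl sets_\<mu>])
qed

lemma distr_conj:
  assumes v: "v \<noteq> 0"
  shows "distr \<mu> \<mu> (\<lambda>P. householder v ** P ** householder v) = \<mu>"
  using unif unitary_householder[OF v]
  unfolding uniform_on_Proj_def by (metis ctranspose_householder)

lemma nn_integral_conj:
  assumes v: "v \<noteq> 0" and [measurable]: "f \<in> borel_measurable \<mu>"
  shows "(\<integral>\<^sup>+P. f (householder v ** P ** householder v) \<partial>\<mu>) = (\<integral>\<^sup>+P. f P \<partial>\<mu>)"
  using nn_integral_distr[OF conj_measurable[OF v], of f] unfolding distr_conj[OF v] by simp

lemma integral_conj:
  fixes f :: "_ \<Rightarrow> real"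
  assumes v: "v \<noteq> 0" and [measurable]: "f \<in> borel_measurable \<mu>"
  shows "(\<integral>P. f (householder v ** P ** householder v) \<partial>\<mu>) = (\<integral>P. f P \<partial>\<mu>)"
  using integral_distr[OF conj_measurable[OF v], of f] unfolding distr_conj[OF v] by simp

text \<open>
  A reflection carries the line of \<open>x\<close> to the line of \<open>y\<close>, and the law of \<open>P\<close> is invariant.
\<close>

lemma nn_integral_qf_const:
  assumes x: "norm x = 1" and y: "norm y = 1" and [measurable]: "\<phi> \<in> borel_measurable borel"
  shows "(\<integral>\<^sup>+P. \<phi> (qf P x) \<partial>\<mu>) = (\<integral>\<^sup>+P. \<phi> (qf P y) \<partial>\<mu>)"
proof -
  obtain u where u: "norm u = 1" "cip x (u *s y) = of_real (norm (cip x y))" by (rule phase_exists)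
  define z where "z = u *s y"
  have z: "norm z = 1" "qf P z = qf P y" for P using u(1) y by (auto simp: z_def norm_smult qf_smult)
  show ?thesis
  proof (cases "x = z")
    case False
    then have v: "x - z \<noteq> 0" by simp
    have "householder (x - z) *v x = z"
      by (rule householder_swap[OF x z(1) _ False]) (simp add: z_def u(2))
    then have hz: "householder (x - z) *v z = x" using householder_involution[OF v, of x] by simp
    have "(\<integral>\<^sup>+P. \<phi> (qf (householder (x - z) ** P ** householder (x - z)) z) \<partial>\<mu>) = (\<integral>\<^sup>+P. \<phi> (qf P z) \<partial>\<mu>)"
      by (rule nn_integral_conj[OF v]) measurable
    from this[unfolded qf_householder_conj hz] show ?thesis unfolding z(2) .
  qed (simp add: z(2))
qed

text \<open>
  Averaging the constant of the previous lemma over the unit ball and exchanging the order of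
  integration replaces the random projection by a fixed one.
\<close>

lemma nn_integral_qf:
  fixes x :: "'a^'d"
  assumes x: "norm x = 1" and [measurable]: "\<phi> \<in> borel_measurable borel"
  defines "a \<equiv> rc_beta TYPE('a) * n"
  shows "(\<integral>\<^sup>+P. \<phi> (qf P x) \<partial>\<mu>) * ennreal (Beta a a)
    = (\<integral>\<^sup>+y. ennreal (beta_weight a y) * indicator {0<..<1} y * \<phi> y \<partial>lborel)"
proof -
  have a: "a > 0" using n DIM_positive[where 'a='a] by (simp add: a_def rc_beta_def)
  define K where "K = ennreal ((unit_ball_vol (2 * a) * a)\<^sup>2 / (2 * a))"
  have "(unit_ball_vol (2 * a) * a)\<^sup>2 / (2 * a) > 0"
    using a Gamma_real_pos[of "a + 1"] by (intro divide_pos_pos zero_less_power mult_pos_pos) (auto simp: unit_ball_vol_def)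
  then have K: "K \<noteq> 0" "K \<noteq> \<infinity>" by (auto simp: K_def ennreal_eq_0_iff)
  let ?J = "\<lambda>\<psi>. \<integral>\<^sup>+y. ennreal (beta_weight a y) * indicator {0<..<1} y * \<psi> y \<partial>lborel"
  let ?V = "emeasure lborel (cball (0::'a^'d) 1)"
  have main: "?V * (\<integral>\<^sup>+P. \<psi> (qf P x) \<partial>\<mu>) = K * ?J \<psi>"
    if [measurable]: "\<psi> \<in> borel_measurable borel" for \<psi>
  proof -
    interpret pair_sigma_finite \<mu> "lborel :: ('a^'d) measure" by standard
    have cb [measurable]: "cball (0::'a^'d) 1 \<in> sets borel" by simp
    have "?V * (\<integral>\<^sup>+P. \<psi> (qf P x) \<partial>\<mu>)
        = (\<integral>\<^sup>+z. indicator (cball 0 1) z * (\<integral>\<^sup>+P. \<psi> (qf P x) \<partial>\<mu>) \<partial>(lborel :: ('a^'d) measure))"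
      by (simp add: nn_integral_multc)
    also have "\<dots> = (\<integral>\<^sup>+z. \<integral>\<^sup>+P. indicator (cball 0 1) z * \<psi> (qf P z / (norm z)\<^sup>2) \<partial>\<mu> \<partial>lborel)"
    proof (rule nn_integral_cong_AE)
      have "AE z in lborel. z \<noteq> (0 :: 'a^'d)" by (rule AE_lborel_singleton)
      then show "AE z in lborel. indicator (cball 0 1) z * (\<integral>\<^sup>+P. \<psi> (qf P x) \<partial>\<mu>)
          = (\<integral>\<^sup>+P. indicator (cball 0 1) z * \<psi> (qf P z / (norm z)\<^sup>2) \<partial>\<mu>)"
      proof (rule eventually_mono)
        fix z :: "'a^'d" assume z: "z \<noteq> 0"
        have "qf P ((1 / norm z) *\<^sub>R z) = qf P z / (norm z)\<^sup>2" for P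
          unfolding qf_scaleR by (simp add: power_divide)
        then have "(\<integral>\<^sup>+P. \<psi> (qf P x) \<partial>\<mu>) = (\<integral>\<^sup>+P. \<psi> (qf P z / (norm z)\<^sup>2) \<partial>\<mu>)"
          using nn_integral_qf_const[OF x, of "(1 / norm z) *\<^sub>R z" \<psi>] z by simp
        then show "indicator (cball 0 1) z * (\<integral>\<^sup>+P. \<psi> (qf P x) \<partial>\<mu>)
          = (\<integral>\<^sup>+P. indicator (cball 0 1) z * \<psi> (qf P z / (norm z)\<^sup>2) \<partial>\<mu>)"
          by (simp add: nn_integral_cmult)
      qed
    qed
    also have "\<dots> = (\<integral>\<^sup>+P. \<integral>\<^sup>+z. indicator (cball 0 1) z * \<psi> (qf P z / (norm z)\<^sup>2) \<partial>lborel \<partial>\<mu>)"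
      by (rule Fubini') measurable
    also have "\<dots> = (\<integral>\<^sup>+P. K * ?J \<psi> \<partial>\<mu>)"
      by (rule nn_integral_cong)
         (simp add: space_\<mu> K_def a_def nn_integral_ball_ratio[OF _ n d])
    also have "\<dots> = K * ?J \<psi>" by (simp add: emeasure_space_1)
    finally show ?thesis .
  qed
  have V: "?V = K * ennreal (Beta a a)"
    using main[of "\<lambda>_. 1"] nn_integral_beta_weight[OF a] by (simp add: emeasure_space_1)
  have "((\<integral>\<^sup>+P. \<phi> (qf P x) \<partial>\<mu>) * ennreal (Beta a a)) * K = ?J \<phi> * K"
    using main[of \<phi>] unfolding V by (simp add: mult_ac)
  then have "((\<integral>\<^sup>+P. \<phi> (qf P x) \<partial>\<mu>) * ennreal (Beta a a)) * K / K = ?J \<phi> * K / K" by (rule arg_cong)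
  then show ?thesis using K by (simp add: mult_divide_eq_ennreal)
qed


text \<open>
  This is \<open>mu1 - 1 / 2\<close>, as \<open>mean_form_self\<close> shows.
\<close>

lemma expectation_abs:
  fixes x :: "'a^'d"
  assumes x: "norm x = 1"
  defines "a \<equiv> rc_beta TYPE('a) * n"
  shows "(\<integral>P. \<bar>qf P x - 1/2\<bar> \<partial>\<mu>) = 1 / (a * 4 powr a * Beta a a)"
proof -
  have a: "a > 0" using n DIM_positive[where 'a='a] by (simp add: a_def rc_beta_def)
  have B: "Beta a a > 0" using a by (simp add: Beta_pos_real)
  have "(\<integral>\<^sup>+P. ennreal \<bar>qf P x - 1/2\<bar> \<partial>\<mu>) * ennreal (Beta a a) = ennreal (1 / (a * 4 powr a))"
    using nn_integral_qf[OF x, of "\<lambda>y. ennreal \<bar>y - 1/2\<bar>"] nn_integral_beta_weight_abs[OF a]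
    by (simp add: a_def)
  also have "\<dots> = ennreal (1 / (a * 4 powr a * Beta a a)) * ennreal (Beta a a)"
    using a B by (simp add: ennreal_mult[symmetric])
  finally have "(\<integral>\<^sup>+P. ennreal \<bar>qf P x - 1/2\<bar> \<partial>\<mu>) = ennreal (1 / (a * 4 powr a * Beta a a))"
    using mult_divide_eq_ennreal[of "ennreal (Beta a a)"] B
    by (metis ennreal_eq_0_iff ennreal_neq_top not_le)
  then show ?thesis
    using a B by (intro integral_eq_nn_integral[THEN trans]) auto
qed

lemma prob_near_half:
  fixes x :: "'a^'d"
  assumes x: "norm x = 1" and s: "s \<ge> 0"
  defines "a \<equiv> rc_beta TYPE('a) * n"
  assumes a: "a \<ge> 1"
  shows "measure \<mu> {P \<in> space \<mu>. \<bar>qf P x - 1/2\<bar> \<le> s} \<le> 2 * s * 4 powr (1 - a) / Beta a a"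
proof -
  have B: "Beta a a > 0" using a by (simp add: Beta_pos_real)
  define E where "E = {P \<in> space \<mu>. \<bar>qf P x - 1/2\<bar> \<le> s}"
  have [measurable]: "E \<in> sets \<mu>" unfolding E_def by measurable
  have "ennreal (measure \<mu> E * Beta a a) = (\<integral>\<^sup>+P. indicator E P \<partial>\<mu>) * ennreal (Beta a a)"
    using B by (simp add: emeasure_eq_measure ennreal_mult)
  also have "(\<integral>\<^sup>+P. indicator E P \<partial>\<mu>) = (\<integral>\<^sup>+P. indicator {1/2 - s..1/2 + s} (qf P x) \<partial>\<mu>)"
    by (rule nn_integral_cong) (auto simp: E_def indicator_def abs_le_iff)
  also have "\<dots> * ennreal (Beta a a)
      = (\<integral>\<^sup>+y. ennreal (beta_weight a y) * indicator {0<..<1} y * indicator {1/2 - s..1/2 + s} y \<partial>lborel)"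
    unfolding a_def by (rule nn_integral_qf[OF x]) measurable
  also have "\<dots> \<le> ennreal (2 * s * 4 powr (1 - a))"
    by (rule nn_integral_beta_weight_small_ball[OF a s])
  finally have "measure \<mu> E * Beta a a \<le> 2 * s * 4 powr (1 - a)"
    using s by (subst (asm) ennreal_le_iff) auto
  then show ?thesis using B by (simp add: E_def field_simps)
qed

end

section \<open>The mean of the reflected quadratic form\<close>

text \<open>
  For a unit vector \<open>y\<close> this is the value at \<open>y\<close> of the quadratic form of \<open>P\<close> or of \<open>mat 1 - P\<close>,
  whichever (PEP) uses when the measured line is that of \<open>x\<close>; \<open>(norm y)\<^sup>2\<close> keeps it homogeneous.
\<close>

definition rform :: "'a::real_or_complex^'d^'d \<Rightarrow> 'a^'d \<Rightarrow> 'a^'d \<Rightarrow> real"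
  where "rform P x y = (if qf P x \<ge> 1/2 then qf P y else (norm y)\<^sup>2 - qf P y)"

lemma rform_bounds: "P \<in> Proj k \<Longrightarrow> 0 \<le> rform P x y" "P \<in> Proj k \<Longrightarrow> rform P x y \<le> (norm y)\<^sup>2"
  using qf_nonneg[of P k y] qf_le[of P k y] by (auto simp: rform_def)

lemma rform_0 [simp]: "rform P x 0 = 0"
  by (simp add: rform_def qf_def)

lemma rform_smult: "norm u = 1 \<Longrightarrow> rform P x (u *s y) = rform P x y"
  by (simp add: rform_def qf_smult norm_smult)

lemma rform_scaleR: "rform P x (r *\<^sub>R y) = r\<^sup>2 * rform P x y"
  by (simp add: rform_def qf_scaleR power_mult_distrib algebra_simps)

lemma rform_parallelogram:
  "rform P x (y + z) + rform P x (y - z) = 2 * rform P x y + 2 * rform P x z"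
proof -
  have "qf P (y + z) + qf P (y - z) = 2 * qf P y + 2 * qf P z"
    by (simp add: qf_def matrix_vector_right_distrib matrix_vector_mult_diff_distrib
        inner_simps)
  moreover have "(norm (y + z))\<^sup>2 + (norm (y - z))\<^sup>2 = 2 * (norm y)\<^sup>2 + 2 * (norm z)\<^sup>2"
    by (simp add: power2_norm_eq_inner inner_simps inner_commute)
  ultimately show ?thesis by (auto simp: rform_def)
qed

lemma norm_householder: "v \<noteq> 0 \<Longrightarrow> norm (householder v *v z) = norm z"
  using inner_hermitian[OF ctranspose_householder, of "householder v *v z" v z] householder_involution[of v z]
  by (simp add: norm_eq_sqrt_inner)

lemma rform_householder_conj:
  "v \<noteq> 0 \<Longrightarrow> rform (householder v ** P ** householder v) x y = rform P (householder v *v x) (householder v *v y)"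
  by (simp add: rform_def qf_householder_conj norm_householder)

lemma borel_measurable_rform [measurable (raw)]:
  fixes f :: "'m \<Rightarrow> 'a::real_or_complex^'d^'d"
  assumes [measurable]: "f \<in> borel_measurable M"
  shows "(\<lambda>w. rform (f w) x y) \<in> borel_measurable M"
  unfolding rform_def by measurable

context uniform_projection
begin

lemma integrable_rform: "integrable \<mu> (\<lambda>P. rform P x y)"
proof (rule integrable_const_bound[where B="(norm y)\<^sup>2"])
  show "AE P in \<mu>. norm (rform P x y) \<le> (norm y)\<^sup>2"
  proof (rule AE_I2)
    fix P assume "P \<in> space \<mu>"
    then show "norm (rform P x y) \<le> (norm y)\<^sup>2"
      using rform_bounds[of P n x y] by (simp add: space_\<mu>)
  qed
qed measurable

definition mean_form :: "'a^'d \<Rightarrow> 'a^'d \<Rightarrow> real"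
  where "mean_form x y = (\<integral>P. rform P x y \<partial>\<mu>)"

lemma mean_form_householder:
  assumes v: "v \<noteq> 0"
  shows "mean_form (householder v *v x) (householder v *v y) = mean_form x y"
  using integral_conj[OF v, of "\<lambda>P. rform P x y"]
  by (simp add: mean_form_def rform_householder_conj[OF v])

lemma mean_form_self:
  assumes x: "norm x = 1"
  shows "mean_form x x = mu1 (rc_beta TYPE('a)) n"
proof -
  have int: "integrable \<mu> (\<lambda>P. \<bar>qf P x - 1/2\<bar>)"
  proof (rule integrable_const_bound[where B=1])
    show "AE P in \<mu>. norm \<bar>qf P x - 1/2\<bar> \<le> 1"
      using qf_nonneg[of _ n x] qf_le[of _ n x] x by (intro AE_I2) (fastforce simp: space_\<mu>)
  qed measurable
  have "mean_form x x = (\<integral>P. 1/2 + \<bar>qf P x - 1/2\<bar> \<partial>\<mu>)"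
    unfolding mean_form_def using x by (intro Bochner_Integration.integral_cong) (auto simp: rform_def)
  also have "\<dots> = 1/2 + (\<integral>P. \<bar>qf P x - 1/2\<bar> \<partial>\<mu>)"
    using int by (simp add: prob_space)
  finally show ?thesis unfolding expectation_abs[OF x] mu1_def by simp
qed

text \<open>
  The mean is invariant under the reflections that fix \<open>x\<close>; hence it is constant on the unit
  vectors orthogonal to \<open>x\<close> and has no cross terms between \<open>x\<close> and its complement.
\<close>

lemma mean_form_orthogonal_const:
  assumes x: "norm x = 1" and w: "norm w = 1" "cip x w = 0" and w': "norm w' = 1" "cip x w' = 0"
  shows "mean_form x w = mean_form x w'"
proof -
  obtain u where u: "norm u = 1" "cip w (u *s w') = of_real (norm (cip w w'))" by (rule phase_exists)
  define z where "z = u *s w'"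
  have z: "norm z = 1" "mean_form x z = mean_form x w'" "cip x z = 0"
    using u(1) w' by (auto simp: z_def norm_smult rform_smult mean_form_def cip_simps)
  show ?thesis
  proof (cases "w = z")
    case False
    then have v: "w - z \<noteq> 0" by simp
    have "cip (w - z) x = 0"
      using w(2) z(3) rc_cnj_cip[of x w] rc_cnj_cip[of x z] by (simp add: cip_simps)
    then have "householder (w - z) *v x = x" by (rule householder_fix)
    moreover have "householder (w - z) *v w = z"
      by (rule householder_swap[OF w(1) z(1) _ False]) (simp add: z_def u(2))
    ultimately show ?thesis using mean_form_householder[OF v, of x w] z(2) by simp
  qed (simp add: z(2))
qed

text \<open>
  Write \<open>y = c x + w\<close> with \<open>w\<close> orthogonal to \<open>x\<close>. The reflection along \<open>w\<close> fixes \<open>x\<close>, so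
  \<open>c x + w\<close> and \<open>c x - w\<close> have the same mean, and the parallelogram law then eliminates the cross
  term.
\<close>

lemma mean_form_split:
  assumes x: "norm x = 1"
  obtains \<gamma> where "\<And>y. norm y = 1 \<Longrightarrow>
    mean_form x y = (norm (cip x y))\<^sup>2 * mean_form x x + (1 - (norm (cip x y))\<^sup>2) * \<gamma>"
proof -
  obtain \<gamma> where \<gamma>: "\<And>w. norm w = 1 \<Longrightarrow> cip x w = 0 \<Longrightarrow> mean_form x w = \<gamma>"
    using mean_form_orthogonal_const[OF x] by metis
  have "mean_form x y = (norm (cip x y))\<^sup>2 * mean_form x x + (1 - (norm (cip x y))\<^sup>2) * \<gamma>"
    if y: "norm y = 1" for y
  proof -
    define c where "c = norm (cip x y)"
    obtain u w where u: "norm u = 1" and y': "u *s y = c *\<^sub>R x + w" and xw: "cip x w = 0"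
      and nw: "(norm w)\<^sup>2 = 1 - c\<^sup>2"
      unfolding c_def by (rule orthogonal_split[OF x y])
    have my: "mean_form x y = mean_form x (c *\<^sub>R x + w)"
      unfolding y'[symmetric] by (simp add: mean_form_def rform_smult[OF u])
    have refl: "mean_form x (c *\<^sub>R x + w) = mean_form x (c *\<^sub>R x - w)"
    proof (cases "w = 0")
      case False
      have wx: "cip w x = 0" using xw rc_cnj_cip[of x w] by simp
      then have hx: "householder w *v x = x" by (rule householder_fix)
      have "householder w *v w = w - (2 / (norm w)\<^sup>2 * (norm w)\<^sup>2) *\<^sub>R w"
        unfolding householder_mult cip_self scaleR_eq_smult by simp
      also have "\<dots> = - w" using False by (simp add: scaleR_2)
      finally have "householder w *v (c *\<^sub>R x + w) = c *\<^sub>R x - w"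
        by (simp add: matrix_vector_right_distrib matrix_scaleR_vector hx)
      then show ?thesis using mean_form_householder[OF False, of x "c *\<^sub>R x + w"] hx by simp
    qed simp
    have "mean_form x (c *\<^sub>R x + w) + mean_form x (c *\<^sub>R x - w)
        = (\<integral>P. 2 * rform P x (c *\<^sub>R x) + 2 * rform P x w \<partial>\<mu>)"
      unfolding mean_form_def rform_parallelogram[symmetric]
      by (rule Bochner_Integration.integral_add[symmetric]) (rule integrable_rform)+
    also have "\<dots> = 2 * c\<^sup>2 * mean_form x x + 2 * mean_form x w"
      unfolding rform_scaleR mean_form_def
      using integrable_rform[of x x] integrable_rform[of x w] by simp
    finally have "mean_form x y = c\<^sup>2 * mean_form x x + mean_form x w"
      using my refl by simp
    moreover have "mean_form x w = (1 - c\<^sup>2) * \<gamma>"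
    proof (cases "w = 0")
      case True
      then show ?thesis using nw by (simp add: mean_form_def)
    next
      case False
      have "mean_form x ((1 / norm w) *\<^sub>R w) = \<gamma>"
        using False xw by (intro \<gamma>) (auto simp: cip_simps)
      moreover have "mean_form x ((1 / norm w) *\<^sub>R w) = (1 / norm w)\<^sup>2 * mean_form x w"
        unfolding rform_scaleR mean_form_def by simp
      ultimately show ?thesis using False unfolding nw[symmetric] by (simp add: power_divide field_simps)
    qed
    ultimately show ?thesis by (simp add: c_def)
  qed
  then show ?thesis by (rule that)
qed

text \<open>
  The trace of \<open>P\<close> and of its complement is \<open>n\<close>, which determines the coefficient on the complement of
  \<open>x\<close> from the one at \<open>x\<close>.
\<close>

lemma mean_form_eq:
  assumes x: "norm x = 1" and y: "norm y = 1"
  defines "\<beta> \<equiv> rc_beta TYPE('a)"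
  shows "mean_form x y = mu2 \<beta> n + (mu1 \<beta> n - mu2 \<beta> n) * (norm (cip x y))\<^sup>2"
proof -
  obtain \<gamma> where \<gamma>: "\<And>y. norm y = 1 \<Longrightarrow>
    mean_form x y = (norm (cip x y))\<^sup>2 * mean_form x x + (1 - (norm (cip x y))\<^sup>2) * \<gamma>"
    using mean_form_split[OF x] by blast
  have tr: "(\<Sum>b\<in>Basis. rform P x b) = real (DIM('a) * n)" if P: "P \<in> Proj n" for P
  proof (cases "qf P x \<ge> 1/2")
    case True
    then show ?thesis using trace_qf_Proj[OF P] by (simp add: rform_def)
  next
    case False
    then have "(\<Sum>b\<in>Basis. rform P x b) = (\<Sum>b\<in>(Basis :: ('a^'d) set). 1 - qf P b)"
      by (intro sum.cong) (auto simp: rform_def)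
    then show ?thesis using trace_qf_Proj[OF P] d by (simp add: sum_subtractf algebra_simps)
  qed
  have trx: "(\<Sum>b\<in>Basis. (norm (cip x b))\<^sup>2) = real DIM('a)"
  proof -
    have "outer x \<in> Proj 1" using x unfolding Proj_1_eq by blast
    then show ?thesis using trace_qf_Proj[of "outer x" 1] by (simp add: qf_def inner_outer)
  qed
  have "real (DIM('a) * n) = (\<integral>P. (\<Sum>b\<in>Basis. rform P x b) \<partial>\<mu>)"
  proof -
    have "(\<integral>P. (\<Sum>b\<in>Basis. rform P x b) \<partial>\<mu>) = (\<integral>P. real (DIM('a) * n) \<partial>\<mu>)"
      by (rule Bochner_Integration.integral_cong) (auto simp: space_\<mu> tr)
    then show ?thesis by (simp add: prob_space)
  qed
  also have "\<dots> = (\<Sum>b\<in>Basis. mean_form x b)"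
    unfolding mean_form_def by (rule Bochner_Integration.integral_sum) (rule integrable_rform)
  also have "\<dots> = (\<Sum>b\<in>Basis. (norm (cip x b))\<^sup>2 * mean_form x x + (1 - (norm (cip x b))\<^sup>2) * \<gamma>)"
    by (intro sum.cong refl \<gamma>) simp
  also have "\<dots> = (\<Sum>b\<in>Basis. (norm (cip x b))\<^sup>2) * mean_form x x
      + (real DIM('a^'d) - (\<Sum>b\<in>Basis. (norm (cip x b))\<^sup>2)) * \<gamma>"
    by (simp add: sum.distrib sum_distrib_right[symmetric] sum_subtractf)
  also have "\<dots> = real DIM('a) * (mean_form x x + (2 * real n - 1) * \<gamma>)"
    unfolding trx using d by (simp add: algebra_simps)
  finally have "mean_form x x + (2 * real n - 1) * \<gamma> = n"
    using DIM_positive[where 'a='a] by simp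
  then have g: "(2 * real n - 1) * \<gamma> = n - mu1 \<beta> n"
    unfolding mean_form_self[OF x] \<beta>_def by simp
  have n1: "2 * real n - 1 > 0" using n by simp
  have "(2 * real n - 1) * mu2 \<beta> n = n - mu1 \<beta> n"
  proof -
    define t where "t = 1 / (\<beta> * n * 4 powr (\<beta> * n) * Beta (\<beta> * n) (\<beta> * n))"
    have m1: "mu1 \<beta> n = 1/2 + t" by (simp add: mu1_def t_def)
    have m2: "mu2 \<beta> n = 1/2 - t / (2 * real n - 1)" by (simp add: mu2_def t_def mult_ac)
    show ?thesis unfolding m1 m2 using n1 by (simp add: field_simps)
  qed
  then have "\<gamma> = mu2 \<beta> n" using g n1 by (metis less_irrefl mult_left_cancel)
  then show ?thesis
    using \<gamma>[OF y] unfolding mean_form_self[OF x] \<beta>_def by (simp add: algebra_simps)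
qed

end

section \<open>Stability of the principal eigenspace\<close>

text \<open>
  The difference is the bilinear form at \<open>y - z\<close> and \<open>y + z\<close>; polarization of the normalized vectors
  bounds it by \<open>K\<close> times the product of their norms.
\<close>

lemma symmetric_form_diff:
  fixes B :: "'a::real_or_complex^'d^'d"
  assumes herm: "ctranspose B = B" and K: "\<And>y. norm y = 1 \<Longrightarrow> \<bar>qf B y\<bar> \<le> K"
  shows "\<bar>qf B y - qf B z\<bar> \<le> K * (norm (y - z) * norm (y + z))"
proof (cases "y - z = 0 \<or> y + z = 0")
  case True
  then have "y = z \<or> y = (- 1) *\<^sub>R z" by (metis add_eq_0_iff2 eq_iff_diff_eq_0 scaleR_minus1_left)
  then have "qf B y = qf B z"
    using qf_scaleR[of B "-1" z] by auto
  then show ?thesis using True by auto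
next
  case False
  define u where "u = (1 / norm (y - z)) *\<^sub>R (y - z)"
  define v where "v = (1 / norm (y + z)) *\<^sub>R (y + z)"
  have nu: "norm u = 1" "norm v = 1" using False by (simp_all add: u_def v_def)
  have Kq: "\<bar>qf B w\<bar> \<le> K * (norm w)\<^sup>2" for w
  proof (cases "w = 0")
    case False
    have "\<bar>qf B ((1 / norm w) *\<^sub>R w)\<bar> \<le> K" using False by (intro K) simp
    then show ?thesis using False by (simp add: qf_scaleR power_divide abs_mult field_simps)
  qed (simp add: qf_def)
  have sym: "p \<bullet> (B *v q) = q \<bullet> (B *v p)" for p q
    using inner_hermitian[OF herm, of p q] by (simp add: inner_commute)
  have "4 * (u \<bullet> (B *v v)) = qf B (u + v) - qf B (u - v)"
    using sym[of u v] by (simp add: qf_def matrix_vector_right_distrib matrix_vector_mult_diff_distrib inner_simps)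
  also have "\<bar>\<dots>\<bar> \<le> K * (norm (u + v))\<^sup>2 + K * (norm (u - v))\<^sup>2"
    using Kq[of "u + v"] Kq[of "u - v"] by linarith
  also have "\<dots> = K * ((norm (u + v))\<^sup>2 + (norm (u - v))\<^sup>2)" by (simp add: algebra_simps)
  also have "(norm (u + v))\<^sup>2 + (norm (u - v))\<^sup>2 = 4"
    using nu by (simp add: power2_norm_eq_inner inner_simps inner_commute norm_eq_1)
  finally have uv: "\<bar>u \<bullet> (B *v v)\<bar> \<le> K" by simp
  have "qf B y - qf B z = (y - z) \<bullet> (B *v (y + z))"
    using sym[of y z] by (simp add: qf_def matrix_vector_right_distrib inner_simps)
  also have "\<dots> = (norm (y - z) * norm (y + z)) * (u \<bullet> (B *v v))"
    using False by (simp add: u_def v_def matrix_scaleR_vector)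
  finally have "\<bar>qf B y - qf B z\<bar> = (norm (y - z) * norm (y + z)) * \<bar>u \<bullet> (B *v v)\<bar>"
    by (simp add: abs_mult)
  also have "\<dots> \<le> (norm (y - z) * norm (y + z)) * K"
    using uv by (intro mult_left_mono) auto
  finally show ?thesis by (simp add: mult.commute)
qed

lemma outer_smult: "norm u = 1 \<Longrightarrow> outer (u *s x) = outer x"
proof -
  assume u: "norm u = 1"
  have "outer (u *s x) *v y = outer x *v y" for y
    using mult_rc_cnj[of u] u by (simp add: outer_mult cip_simps vec_eq_iff mult_ac)
  then show ?thesis by (simp add: matrix_eq)
qed

text \<open>
  The difference of the two projections acts on the span of \<open>x\<close> and \<open>x'\<close> as a multiple of an isometry.
  The proof computes its norm in the coordinates of \<open>orthogonal_split\<close>.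
\<close>

lemma onorm_outer_diff:
  fixes x x' :: "'a::real_or_complex^'d"
  assumes x: "norm x = 1" and x': "norm x' = 1"
  shows "onorm ((*v) (outer x' - outer x)) = sqrt (1 - (norm (cip x x'))\<^sup>2)"
proof -
  define c where "c = norm (cip x x')"
  obtain u w where u: "norm u = 1" and y': "u *s x' = c *\<^sub>R x + w" and xw: "cip x w = 0"
    and nw: "(norm w)\<^sup>2 = 1 - c\<^sup>2"
    unfolding c_def by (rule orthogonal_split[OF x x'])
  have wx: "cip w x = 0" using xw rc_cnj_cip[of x w] by simp
  define s2 where "s2 = 1 - c\<^sup>2"
  have s2: "s2 \<ge> 0" "(norm w)\<^sup>2 = s2" "c\<^sup>2 + s2 = 1" using nw zero_le_power2[of "norm w"] by (auto simp: s2_def)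
  have comb: "(norm (\<alpha> *s x + \<beta> *s w))\<^sup>2 = (norm \<alpha>)\<^sup>2 + (norm \<beta>)\<^sup>2 * s2" for \<alpha> \<beta>
  proof -
    have "(\<alpha> *s x) \<bullet> (\<beta> *s w) = 0" unfolding rc_re_cip[symmetric] by (simp add: cip_simps xw)
    then show ?thesis
      by (simp add: norm_add_Pythagorean orthogonal_def norm_smult x power_mult_distrib s2(2))
  qed
  have main: "(norm ((outer x' - outer x) *v v))\<^sup>2 = s2 * (norm (cip x v))\<^sup>2 + (norm (cip w v))\<^sup>2" for v
  proof -
    define p where "p = cip x v"
    define r where "r = cip w v"
    have "outer x' *v v = (c *\<^sub>R p + r) *s (c *\<^sub>R x + w)"
      unfolding outer_smult[OF u, symmetric, of x'] y' by (simp add: outer_mult cip_add_left cip_scaleR_left p_def r_def)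
    then have "(outer x' - outer x) *v v = (c *\<^sub>R r - s2 *\<^sub>R p) *s x + (c *\<^sub>R p + r) *s w"
      unfolding matrix_vector_mult_diff_rdistrib outer_mult p_def[symmetric] s2_def
      by (simp add: vec_eq_iff algebra_simps power2_eq_square)
    then have "(norm ((outer x' - outer x) *v v))\<^sup>2
        = (norm (c *\<^sub>R r - s2 *\<^sub>R p))\<^sup>2 + (norm (c *\<^sub>R p + r))\<^sup>2 * s2"
      by (simp only: comb)
    also have "\<dots> = s2 * (c\<^sup>2 + s2) * (p \<bullet> p) + (c\<^sup>2 + s2) * (r \<bullet> r)"
      unfolding power2_norm_eq_inner
      by (simp add: inner_simps inner_commute[of r p] algebra_simps power2_eq_square)
    finally show ?thesis by (simp add: s2(3) power2_norm_eq_inner p_def r_def)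
  qed
  have bessel: "s2 * (norm (cip x v))\<^sup>2 + (norm (cip w v))\<^sup>2 \<le> s2 * (norm v)\<^sup>2" for v
  proof (cases "s2 = 0")
    case True
    then have "w = 0" using s2(2) by simp
    then show ?thesis using True by simp
  next
    case False
    define t where "t = (1 / s2) *\<^sub>R cip w v"
    define e where "e = cip x v *s x + t *s w"
    have ne: "(norm e)\<^sup>2 = (norm (cip x v))\<^sup>2 + (norm (cip w v))\<^sup>2 / s2"
      unfolding e_def comb using False by (simp add: t_def power_divide power2_eq_square)
    have "e \<bullet> v = (norm (cip x v))\<^sup>2 + (norm (cip w v))\<^sup>2 / s2"
    proof -
      have "cip e v = rc_cnj (cip x v) * cip x v + (1 / s2) *\<^sub>R (rc_cnj (cip w v) * cip w v)"
        by (simp add: e_def t_def cip_add_left cip_smult_left rc_cnj_scaleR)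
      then have "e \<bullet> v = (cip x v) \<bullet> (cip x v) + (1 / s2) * (cip w v \<bullet> cip w v)"
        unfolding rc_re_cip[symmetric] by (simp add: rc_re_add rc_re_scaleR rc_re_cnj_mult)
      then show ?thesis by (simp add: power2_norm_eq_inner)
    qed
    then have "(norm (v - e))\<^sup>2 = (norm v)\<^sup>2 - (norm e)\<^sup>2"
      using ne by (simp add: power2_norm_eq_inner inner_simps inner_commute)
    then have "(norm e)\<^sup>2 \<le> (norm v)\<^sup>2" using zero_le_power2[of "norm (v - e)"] by linarith
    then have "s2 * (norm e)\<^sup>2 \<le> s2 * (norm v)\<^sup>2" using s2(1) by (rule mult_left_mono)
    then show ?thesis unfolding ne using False by (simp add: distrib_left)
  qed
  have "onorm ((*v) (outer x' - outer x)) = sqrt s2"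
  proof (rule antisym)
    show "onorm ((*v) (outer x' - outer x)) \<le> sqrt s2"
    proof (rule onorm_bound)
      fix v
      have "(norm ((outer x' - outer x) *v v))\<^sup>2 \<le> (sqrt s2 * norm v)\<^sup>2"
        using main[of v] bessel[of v] s2(1) by (simp add: power_mult_distrib)
      then show "norm ((outer x' - outer x) *v v) \<le> sqrt s2 * norm v"
        by (rule power2_le_imp_le) (use s2 in simp)
    qed (use s2 in simp)
    have "(norm ((outer x' - outer x) *v x))\<^sup>2 = s2"
      unfolding main by (simp add: cip_self x wx)
    then have "sqrt s2 = norm ((outer x' - outer x) *v x)" by (metis norm_ge_zero real_sqrt_unique)
    also have "\<dots> \<le> onorm ((*v) (outer x' - outer x)) * norm x"
      by (rule onorm) simp
    finally show "sqrt s2 \<le> onorm ((*v) (outer x' - outer x))" using x by simp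
  qed
  then show ?thesis by (simp add: s2_def c_def)
qed

lemma phi_outer: "phi P (outer x) \<longleftrightarrow> qf P x \<ge> 1/2"
  by (simp add: phi_def trace_mult_outer qf_def)

lemma qf_Q_mat:
  assumes y: "norm y = 1"
  shows "qf (Q_mat m P (Phi P (outer x))) y = (\<Sum>j<m. rform (P j) x y) / m"
proof -
  have "qf (Q_mat m P (Phi P (outer x))) y
      = (1 / m) * (\<Sum>j<m. qf (if Phi P (outer x) j then P j else mat 1 - P j) y)"
  proof -
    have "sum f A *v z = (\<Sum>j\<in>A. f j *v z)" for f :: "nat \<Rightarrow> 'a^'b^'b" and A and z :: "'a^'b"
      by (induction A rule: infinite_finite_induct) (auto simp: matrix_vector_mult_add_rdistrib)
    then show ?thesis
      by (simp add: Q_mat_def qf_def scaleR_matrix_vector inner_sum_right)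
  qed
  also have "(\<Sum>j<m. qf (if Phi P (outer x) j then P j else mat 1 - P j) y) = (\<Sum>j<m. rform (P j) x y)"
  proof (intro sum.cong refl)
    have yy: "y \<bullet> y = 1" using y by (simp add: norm_eq_1)
    show "qf (if Phi P (outer x) j then P j else mat 1 - P j) y = rform (P j) x y" for j
      by (auto simp: Phi_def phi_outer rform_def qf_def matrix_vector_mult_diff_rdistrib
          inner_diff_right y yy)
  qed
  finally show ?thesis by simp
qed

lemma rc_cnj_minus: "rc_cnj (- x) = - rc_cnj x"
  using rc_cnj_diff[of 0 x] by simp

lemma ctranspose_Q_mat:
  assumes "\<And>j. j < m \<Longrightarrow> ctranspose (P j) = P j"
  shows "ctranspose (Q_mat m P b) = Q_mat m P b"
proof -
  have ct: "ctranspose A = A \<longleftrightarrow> (\<forall>i j. rc_cnj (A $ j $ i) = A $ i $ j)" for A :: "'a^'b^'b"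
    by (auto simp: ctranspose_def vec_eq_iff)
  show ?thesis
    using assms unfolding ct Q_mat_def
    by (auto simp: rc_cnj_scaleR rc_cnj_sum if_distrib mat_def rc_cnj_diff rc_cnj_minus intro!: sum.cong)
qed

lemma psd_outer: "psd (outer x)"
  by (simp add: psd_def ctranspose_outer inner_outer)

lemma pep_optimal_outer:
  assumes "pep_optimal Q (outer x')" "norm x = 1"
  shows "qf Q x \<le> qf Q x'"
  using assms psd_outer[of x] trace_outer[of x]
  by (auto simp: pep_optimal_def is_arg_max_linorder trace_mult_outer qf_def)

text \<open>
  For \<open>\<nu> = mu2 \<beta> n\<close> and \<open>\<kappa> = mu1 \<beta> n - mu2 \<beta> n\<close> the subtracted term is the mean of each summand
  at unit vectors, by \<open>mean_form_eq\<close>.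
\<close>

definition dev :: "nat \<Rightarrow> real \<Rightarrow> real \<Rightarrow> (nat \<Rightarrow> 'a::real_or_complex^'d^'d) \<Rightarrow> 'a^'d \<Rightarrow> 'a^'d \<Rightarrow> real"
  where "dev m \<nu> \<kappa> P x y = (\<Sum>j<m. rform (P j) x y) / m - (\<nu> + \<kappa> * (norm (cip x y))\<^sup>2)"

text \<open>
  Let \<open>s\<close> be the distance of the two projections. The mean form is smaller at \<open>x'\<close> than at \<open>x\<close> by
  \<open>\<kappa> * s\<^sup>2\<close>, whereas optimality makes the empirical form at least as large there. So the deviation
  changes by at least \<open>\<kappa> * s\<^sup>2\<close>; by \<open>symmetric_form_diff\<close> it changes by at most \<open>2 * s * K\<close>, after
  \<open>x'\<close> is multiplied by a phase that makes its product with \<open>x\<close> real.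
\<close>

lemma pep_stability:
  fixes P :: "nat \<Rightarrow> 'a::real_or_complex^'d^'d"
  assumes P: "\<And>j. j < m \<Longrightarrow> ctranspose (P j) = P j" and x: "norm x = 1" and x': "norm x' = 1"
    and dev: "\<And>y. norm y = 1 \<Longrightarrow> \<bar>dev m \<nu> \<kappa> P x y\<bar> \<le> K"
    and opt: "pep_optimal (Q_mat m P (Phi P (outer x))) (outer x')"
    and \<kappa>: "\<kappa> > 0" and K: "2 * K < \<kappa> * \<delta>" and \<delta>: "\<delta> > 0"
  shows "sqrt (1 - (norm (cip x x'))\<^sup>2) < \<delta>"
proof -
  define Q where "Q = Q_mat m P (Phi P (outer x))"
  define B where "B = Q - \<nu> *\<^sub>R mat 1 - \<kappa> *\<^sub>R outer x"
  have qB: "qf B y = dev m \<nu> \<kappa> P x y" if "norm y = 1" for y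
  proof -
    have "qf B y = qf Q y - \<nu> * (y \<bullet> y) - \<kappa> * (norm (cip x y))\<^sup>2"
      by (simp add: qf_def B_def matrix_vector_mult_diff_rdistrib scaleR_matrix_vector inner_diff_right inner_outer)
    then show ?thesis using qf_Q_mat[OF that, of m P x] that by (simp add: dev_def Q_def norm_eq_1)
  qed
  have hermB: "ctranspose B = B"
  proof -
    have "ctranspose Q = Q" unfolding Q_def using P by (rule ctranspose_Q_mat)
    then show ?thesis
      by (auto simp: B_def ctranspose_def vec_eq_iff mat_def outer_def rc_cnj_diff rc_cnj_scaleR rc_cnj_mult)
  qed
  obtain u where u: "norm u = 1" "cip x (u *s x') = of_real (norm (cip x x'))" by (rule phase_exists)
  define z where "z = u *s x'"
  define c where "c = norm (cip x x')"
  have z: "norm z = 1" "outer z = outer x'" "cip x z = of_real c"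
    using u x' by (auto simp: z_def c_def norm_smult outer_smult)
  have c0: "c \<ge> 0" by (simp add: c_def)
  have xz: "x \<bullet> z = c" using rc_re_cip[of x z] z(3) by simp
  have c1: "c \<le> 1" using norm_cauchy_schwarz[of x z] x z(1) xz by simp
  have diff: "\<bar>qf B x - qf B z\<bar> \<le> K * (norm (x - z) * norm (x + z))"
    by (rule symmetric_form_diff[OF hermB]) (simp add: qB dev)
  define s where "s = sqrt (1 - c\<^sup>2)"
  have s: "s \<ge> 0" "s\<^sup>2 = 1 - c\<^sup>2" using c0 c1 by (auto simp: s_def power_le_one)
  have "(norm (x - z) * norm (x + z))\<^sup>2 = (2 * s)\<^sup>2"
    unfolding power_mult_distrib s(2) power2_norm_eq_inner
    using x z(1) xz by (simp add: inner_simps inner_commute[of z x] norm_eq_1 power2_eq_square algebra_simps)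
  then have prod: "norm (x - z) * norm (x + z) = 2 * s"
    using s(1) by (subst (asm) power2_eq_iff_nonneg) auto
  have "qf Q x \<le> qf Q z"
    using opt unfolding Q_def z(2)[symmetric] by (rule pep_optimal_outer) (rule x)
  then have "\<kappa> * (1 - c\<^sup>2) \<le> qf B z - qf B x"
    using qf_Q_mat[OF x, of m P x] qf_Q_mat[OF z(1), of m P x] c0
    unfolding qB[OF x] qB[OF z(1)] dev_def
    by (simp add: Q_def cip_self x z(3) algebra_simps)
  also have "\<dots> \<le> K * (2 * s)" using diff unfolding prod by linarith
  finally have "\<kappa> * s\<^sup>2 \<le> K * (2 * s)" unfolding s(2) .
  then have "\<kappa> * s * s \<le> 2 * K * s" by (simp add: power2_eq_square mult_ac)
  then have "s = 0 \<or> \<kappa> * s \<le> 2 * K" using s(1) by (auto simp: mult_le_cancel_right)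
  then have "s < \<delta>"
  proof
    assume "\<kappa> * s \<le> 2 * K"
    then have "\<kappa> * s < \<kappa> * \<delta>" using K by linarith
    then show ?thesis using \<kappa> by simp
  qed (use \<delta> in simp)
  then show ?thesis by (simp add: s_def c_def)
qed

section \<open>Nets\<close>

text \<open>
  Balls of radius \<open>\<eta> / 2\<close> around the points are disjoint and lie in a ball of radius \<open>1 + \<eta> / 2\<close>.
\<close>

lemma separated_card_le:
  fixes T :: "'b::euclidean_space set"
  assumes fin: "finite T" and sub: "T \<subseteq> sphere 0 1" and \<eta>: "\<eta> > 0"
    and sep: "\<And>s t. s \<in> T \<Longrightarrow> t \<in> T \<Longrightarrow> s \<noteq> t \<Longrightarrow> dist s t > \<eta>"
  shows "real (card T) \<le> (1 + 2 / \<eta>) ^ DIM('b)"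
proof -
  define V where "V = unit_ball_vol (real DIM('b))"
  have V: "V > 0" using Gamma_real_pos[of "real DIM('b) / 2 + 1"] by (simp add: V_def unit_ball_vol_def)
  have "real (card T) * (V * (\<eta> / 2) ^ DIM('b)) = (\<Sum>t\<in>T. measure lborel (ball t (\<eta> / 2)))"
    using \<eta> by (simp add: content_ball V_def)
  also have "\<dots> = measure lborel (\<Union>t\<in>T. ball t (\<eta> / 2))"
  proof (rule measure_finite_Union[symmetric])
    show "disjoint_family_on (\<lambda>t. ball t (\<eta> / 2)) T"
      unfolding disjoint_family_on_def
    proof (intro ballI impI)
      fix s t assume st: "s \<in> T" "t \<in> T" "s \<noteq> t"
      show "ball s (\<eta> / 2) \<inter> ball t (\<eta> / 2) = {}"
      proof (intro equals0I)
        fix z assume "z \<in> ball s (\<eta> / 2) \<inter> ball t (\<eta> / 2)"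
        then have "dist s z < \<eta> / 2" "dist z t < \<eta> / 2" by (auto simp: dist_commute)
        then have "dist s t < \<eta>" using dist_triangle[of s t z] by linarith
        then show False using sep[OF st] by simp
      qed
    qed
  qed (use fin emeasure_lborel_ball_finite in \<open>auto simp: less_top[symmetric] simp del: less_top emeasure_ball\<close>)
  also have "\<dots> \<le> measure lborel (ball (0::'b) (1 + \<eta> / 2))"
  proof (rule measure_mono_fmeasurable)
    show "(\<Union>t\<in>T. ball t (\<eta> / 2)) \<subseteq> ball 0 (1 + \<eta> / 2)"
    proof (rule UN_least, rule subsetI)
      fix t z assume "t \<in> T" "z \<in> ball t (\<eta> / 2)"
      then have "norm t = 1" "dist t z < \<eta> / 2" using sub by auto
      then show "z \<in> ball 0 (1 + \<eta> / 2)" using dist_triangle[of 0 z t] by simp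
    qed
  qed (use fin emeasure_lborel_ball_finite[of "0::'b"] in \<open>auto intro!: fmeasurableI simp del: emeasure_ball\<close>)
  also have "\<dots> = V * (1 + \<eta> / 2) ^ DIM('b)"
    using \<eta> by (simp add: content_ball V_def)
  finally have "real (card T) * (\<eta> / 2) ^ DIM('b) \<le> (1 + \<eta> / 2) ^ DIM('b)"
    using V by (simp add: mult.left_commute)
  then have "real (card T) \<le> (1 + \<eta> / 2) ^ DIM('b) / (\<eta> / 2) ^ DIM('b)"
    using \<eta> by (simp add: pos_le_divide_eq)
  also have "\<dots> = ((1 + \<eta> / 2) / (\<eta> / 2)) ^ DIM('b)" by (simp only: power_divide)
  also have "(1 + \<eta> / 2) / (\<eta> / 2) = 1 + 2 / \<eta>" using \<eta> by (simp add: field_simps)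
  finally show ?thesis .
qed

text \<open>
  A separated set of maximal cardinality is a net.
\<close>

lemma sphere_net:
  fixes \<eta> :: real
  assumes \<eta>: "\<eta> > 0"
  obtains S :: "'b::euclidean_space set" where "finite S" "S \<subseteq> sphere 0 1"
    "real (card S) \<le> (1 + 2 / \<eta>) ^ DIM('b)" "\<And>x. norm x = 1 \<Longrightarrow> \<exists>s\<in>S. norm (x - s) \<le> \<eta>"
proof -
  define good where "good T \<longleftrightarrow> finite T \<and> T \<subseteq> sphere (0::'b) 1 \<and>
    (\<forall>s\<in>T. \<forall>t\<in>T. s \<noteq> t \<longrightarrow> dist s t > \<eta>)" for T
  have bound: "real (card T) \<le> (1 + 2 / \<eta>) ^ DIM('b)" if "good T" for T
    using that by (intro separated_card_le \<eta>) (auto simp: good_def)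
  have "card T \<le> nat \<lfloor>(1 + 2 / \<eta>) ^ DIM('b)\<rfloor>" if "good T" for T
    using bound[OF that] by (simp add: le_nat_floor)
  moreover have "good {}" by (simp add: good_def)
  ultimately obtain S where S: "good S" and mx: "\<And>T. good T \<Longrightarrow> card T \<le> card S"
    using ex_has_greatest_nat[of good "{}" card "Suc (nat \<lfloor>(1 + 2 / \<eta>) ^ DIM('b)\<rfloor>)"]
    by (metis less_Suc_eq_le)
  show ?thesis
  proof (rule that[of S])
    fix x :: 'b assume x: "norm x = 1"
    show "\<exists>s\<in>S. norm (x - s) \<le> \<eta>"
    proof (rule ccontr)
      assume "\<not> (\<exists>s\<in>S. norm (x - s) \<le> \<eta>)"
      then have far: "\<And>s. s \<in> S \<Longrightarrow> dist x s > \<eta>" by (auto simp: dist_norm not_le)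
      then have "good (insert x S)" using S x by (auto simp: good_def dist_commute)
      moreover have "x \<notin> S" using far[of x] \<eta> by auto
      ultimately show False using mx[of "insert x S"] S by (simp add: good_def)
    qed
  qed (use S bound in \<open>auto simp: good_def\<close>)
qed

section \<open>The constants\<close>

text \<open>
  For the \<open>\<beta>\<close> of the scalar field, both sides are the trace of the mean of \<open>R\<^sub>j\<close>, a matrix that has
  the eigenvalue \<open>mu1\<close> once and the eigenvalue \<open>mu2\<close> with multiplicity \<open>2 * n - 1\<close>.
\<close>

lemma mu_relation:
  assumes n: "n \<ge> 1"
  shows "(2 * real n - 1) * mu2 \<beta> n + mu1 \<beta> n = n"
proof -
  define t where "t = 1 / (\<beta> * n * 4 powr (\<beta> * n) * Beta (\<beta> * n) (\<beta> * n))"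
  have m1: "mu1 \<beta> n = 1/2 + t" by (simp add: mu1_def t_def)
  have m2: "mu2 \<beta> n = 1/2 - t / (2 * real n - 1)" by (simp add: mu2_def t_def mult_ac)
  show ?thesis unfolding m1 m2 using n by (simp add: field_simps)
qed

lemma mu_gap_pos:
  assumes n: "n \<ge> 1" and \<beta>: "\<beta> > 0"
  shows "mu1 \<beta> n - mu2 \<beta> n > 0"
proof -
  have "Beta (\<beta> * n) (\<beta> * n) > 0" using n \<beta> by (simp add: Beta_pos_real)
  then show ?thesis using n \<beta> unfolding mu1_def mu2_def by (simp add: add_pos_pos)
qed

text \<open>
  Passing from \<open>b\<close> to \<open>b + 1\<close> multiplies the left-hand side by \<open>(2 b + 1) / (2 b)\<close>, whose square is
  less than \<open>(2 b + 1) / (2 b - 1)\<close>. So the bound propagates from \<open>a = 1\<close>, where it is an equality, and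
  \<open>a = 3 / 2\<close>, where it says that \<open>8 \<le> pi\<^sup>2\<close>.
\<close>

lemma beta_density_bound:
  assumes "k \<ge> 2" and "a = real k / 2"
  shows "4 powr (1 - a) / Beta a a \<le> sqrt (2 * a - 1)"
proof -
  define g where "g b = 4 powr (1 - b) / Beta b b" for b :: real
  have "g (real k / 2) \<ge> 0 \<and> (g (real k / 2))\<^sup>2 \<le> real k - 1"
    using assms(1)
  proof (induction k rule: less_induct)
    case (less k)
    consider "k = 2" | "k = 3" | "k \<ge> 4" using less.prems by linarith
    then show ?case
    proof cases
      case 1
      have "Gamma (2 :: real) = 1" using Gamma_fact[of 1, where 'a=real] by simp
      then have "Beta 1 1 = (1::real)" by (simp add: Beta_def)
      then show ?thesis using 1 by (simp add: g_def)
    next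
      case 2
      have "Gamma (3/2 :: real) = sqrt pi / 2"
      proof -
        have "(1/2 :: real) \<notin> \<int>\<^sub>\<le>\<^sub>0" by (auto elim!: nonpos_Ints_cases)
        then show ?thesis using Gamma_plus1[of "1/2 :: real"] by (simp add: Gamma_one_half_real)
      qed
      moreover have "Gamma (3 :: real) = 2" using Gamma_fact[of 2, where 'a=real] by (simp add: fact_2)
      ultimately have "Beta (3/2) (3/2 :: real) = (sqrt pi / 2) * (sqrt pi / 2) / 2" by (simp only: Beta_def) simp
      then have B: "Beta (3/2) (3/2 :: real) = pi / 8" by simp
      have p: "(4::real) powr - (1/2) = 1 / 2"
        by (simp add: powr_minus_divide[of 4 "1/2"] powr_half_sqrt)
      have g: "g (real k / 2) = 4 / pi" unfolding 2 g_def by (simp add: p B del: eq_divide_eq_numeral1)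
      have "pi * pi > 3 * 3" using pi_gt3 by (intro mult_strict_mono) auto
      then have "(4 / pi)\<^sup>2 \<le> 2" by (simp add: power_divide power2_eq_square field_simps)
      then show ?thesis using 2 g by simp
    next
      case 3
      define b where "b = real (k - 2) / 2"
      have b: "b \<ge> 1" "real k / 2 = b + 1" "real k - 1 = 2 * b + 1"
        using 3 by (auto simp: b_def of_nat_diff field_simps)
      have "2 \<le> k - 2" "k - 2 < k" using 3 by auto
      then have IH: "g b \<ge> 0" "(g b)\<^sup>2 \<le> 2 * b - 1"
        using less.IH[of "k - 2"] 3 by (auto simp: b_def of_nat_diff field_simps)
      have B: "Beta b b > 0" using b by (simp add: Beta_pos_real)
      have B1: "2 * b * Beta (b + 1) b = b * Beta b b"
        using Beta_plus1_left[of b b] b by (simp add: nonpos_Ints_def)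
      have B2: "(2 * b + 1) * Beta (b + 1) (b + 1) = b * Beta (b + 1) b"
        using Beta_plus1_right[of b "b + 1"] b by (simp add: nonpos_Ints_def algebra_simps)
      have "Beta (b + 1) (b + 1) = b / (2 * b + 1) * Beta (b + 1) b"
        using B2 b by (simp add: field_simps)
      also have "Beta (b + 1) b = Beta b b / 2" using B1 b by simp
      finally have BB: "Beta (b + 1) (b + 1) = b / (2 * (2 * b + 1)) * Beta b b" using b by (simp add: field_simps)
      have PP: "(4::real) powr (1 - (b + 1)) = 4 powr (1 - b) / 4"
        using powr_add[of 4 "1 - b" "-1"] by (simp add: powr_minus_divide)
      have g1: "g (b + 1) = g b * ((2 * b + 1) / (2 * b))"
        unfolding g_def BB PP using b B by (simp add: divide_simps)
      have "(g (b + 1))\<^sup>2 = (g b)\<^sup>2 * ((2 * b + 1) / (2 * b))\<^sup>2" by (simp only: g1 power_mult_distrib)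
      also have "\<dots> \<le> (2 * b - 1) * ((2 * b + 1) / (2 * b))\<^sup>2" by (intro mult_right_mono IH) simp
      also have "\<dots> = (2 * b + 1) * ((4 * b\<^sup>2 - 1) / (4 * b\<^sup>2))"
        using b by (simp add: power2_eq_square field_simps)
      also have "\<dots> \<le> (2 * b + 1) * 1"
        using b by (intro mult_left_mono) (auto simp: divide_le_eq)
      finally have "(g (b + 1))\<^sup>2 \<le> real k - 1" using b by simp
      moreover have "g (b + 1) \<ge> 0" unfolding g1 using b IH by simp
      ultimately show ?thesis unfolding b(2) by simp
    qed
  qed
  then have "g a \<ge> 0" "(g a)\<^sup>2 \<le> 2 * a - 1" unfolding assms(2) by auto
  then show ?thesis unfolding g_def by (intro real_le_rsqrt) 
qed

context uniform_projection
begin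

lemma mu_bounds: "mu2 (rc_beta TYPE('a)) n \<ge> 0" "mu1 (rc_beta TYPE('a)) n \<le> 1"
proof -
  obtain x :: "'a^'d" where x: "x \<in> Basis" using nonempty_Basis by blast
  have "mean_form x x \<le> (\<integral>P. 1 \<partial>\<mu>)"
    unfolding mean_form_def
  proof (rule integral_mono)
    fix P assume "P \<in> space \<mu>"
    then show "rform P x x \<le> 1" using rform_bounds(2)[of P n x x] x by (simp add: space_\<mu>)
  qed (use integrable_rform in auto)
  then show m1: "mu1 (rc_beta TYPE('a)) n \<le> 1" using mean_form_self[of x] x by (simp add: prob_space)
  have "(2 * real n - 1) * mu2 (rc_beta TYPE('a)) n \<ge> 0"
    using mu_relation[OF n, of "rc_beta TYPE('a)"] m1 n by simp
  then show "mu2 (rc_beta TYPE('a)) n \<ge> 0" using n by (simp add: zero_le_mult_iff)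
qed

end

section \<open>Independent uniformly distributed projections\<close>

locale random_projections = prob_space M
  for M :: "'w measure" +
  fixes P :: "nat \<Rightarrow> 'w \<Rightarrow> 'a::real_or_complex^'d^'d" and n m :: nat
  assumes n: "n \<ge> 1" and d: "CARD('d) = 2 * n" and m: "m > 0"
    and indep: "indep_vars (\<lambda>_. Proj_borel n) P {..<m}"
    and unif: "\<And>j. j < m \<Longrightarrow> uniform_on_Proj n (distr M (Proj_borel n) (P j))"
begin

abbreviation law :: "nat \<Rightarrow> ('a^'d^'d) measure" where "law j \<equiv> distr M (Proj_borel n) (P j)"

lemma uniform_projection_law: "j < m \<Longrightarrow> uniform_projection n (law j)"
  using unif n d by unfold_locales auto

lemma P_measurable [measurable]: "j < m \<Longrightarrow> P j \<in> M \<rightarrow>\<^sub>M Proj_borel n"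
  using indep unfolding indep_vars_def2 by auto

lemma P_borel: "j < m \<Longrightarrow> P j \<in> borel_measurable M"
  using P_measurable[of j] by (simp add: measurable_restrict_space2_iff)

lemma P_Proj: "j < m \<Longrightarrow> \<omega> \<in> space M \<Longrightarrow> P j \<omega> \<in> Proj n"
  using measurable_space[OF P_measurable[of j]] by (simp add: space_restrict_space)

lemma
  fixes f :: "'a^'d^'d \<Rightarrow> real" and t e :: real
  assumes f: "f \<in> borel_measurable (Proj_borel n)" and bd: "\<And>A. A \<in> Proj n \<Longrightarrow> 0 \<le> f A \<and> f A \<le> 1"
    and t: "t \<ge> 0"
  shows hoeffding_upper: "(\<And>j. j < m \<Longrightarrow> (\<integral>A. f A \<partial>law j) \<le> e) \<Longrightarrow>
      prob {\<omega>\<in>space M. (\<Sum>j<m. f (P j \<omega>)) / m \<ge> e + t} \<le> exp (- 2 * real m * t\<^sup>2)"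
    and hoeffding_abs: "(\<And>j. j < m \<Longrightarrow> (\<integral>A. f A \<partial>law j) = e) \<Longrightarrow>
      prob {\<omega>\<in>space M. \<bar>(\<Sum>j<m. f (P j \<omega>)) / m - e\<bar> \<ge> t} \<le> 2 * exp (- 2 * real m * t\<^sup>2)"
proof -
  define \<mu> where "\<mu> = (\<Sum>j<m. expectation (\<lambda>\<omega>. f (P j \<omega>)))"
  interpret H: Hoeffding_ineq M "{..<m}" "\<lambda>j \<omega>. f (P j \<omega>)" "\<lambda>_. 0" "\<lambda>_. 1" \<mu>
  proof unfold_locales
    show "indep_vars (\<lambda>_. borel) (\<lambda>j \<omega>. f (P j \<omega>)) {..<m}"
      using indep by (rule indep_vars_compose2) (use f in auto)
    show "AE \<omega> in M. f (P j \<omega>) \<in> {0..1}" if "j \<in> {..<m}" for j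
      using that bd P_Proj by (intro AE_I2) auto
  qed (auto simp: \<mu>_def)
  have ex: "expectation (\<lambda>\<omega>. f (P j \<omega>)) = (\<integral>A. f A \<partial>law j)" if "j < m" for j
    by (rule integral_distr[symmetric]) (use that f in auto)
  have pos: "(\<Sum>i\<in>{..<m}. (1 - 0 :: real)\<^sup>2) > 0" using m by simp
  have mt: "real m * t \<ge> 0" using t by simp
  have expo: "exp (- 2 * (real m * t)\<^sup>2 / (\<Sum>i\<in>{..<m}. (1 - 0)\<^sup>2)) = exp (- 2 * real m * t\<^sup>2)"
    using m by (simp add: power2_eq_square)
  have meas: "(\<lambda>\<omega>. \<Sum>j<m. f (P j \<omega>)) \<in> borel_measurable M"
    by (intro borel_measurable_sum measurable_compose[OF P_measurable f]) auto
  {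
    assume e: "\<And>j. j < m \<Longrightarrow> (\<integral>A. f A \<partial>law j) \<le> e"
    have "\<mu> \<le> (\<Sum>j<m. e)" unfolding \<mu>_def by (intro sum_mono) (auto simp: ex e)
    then have "\<mu> \<le> m * e" by simp
    then have "{\<omega>\<in>space M. (\<Sum>j<m. f (P j \<omega>)) / m \<ge> e + t} \<subseteq> {\<omega>\<in>space M. (\<Sum>j<m. f (P j \<omega>)) \<ge> \<mu> + m * t}"
      using m by (auto simp: le_divide_eq algebra_simps)
    then have "prob {\<omega>\<in>space M. (\<Sum>j<m. f (P j \<omega>)) / m \<ge> e + t}
        \<le> prob {\<omega>\<in>space M. (\<Sum>j<m. f (P j \<omega>)) \<ge> \<mu> + m * t}"
      using meas by (intro finite_measure_mono) auto
    also have "\<dots> \<le> exp (- 2 * real m * t\<^sup>2)"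
      using H.Hoeffding_ineq_ge[OF mt pos] unfolding expo .
    finally show "prob {\<omega>\<in>space M. (\<Sum>j<m. f (P j \<omega>)) / m \<ge> e + t} \<le> exp (- 2 * real m * t\<^sup>2)" .
  }
  {
    assume e: "\<And>j. j < m \<Longrightarrow> (\<integral>A. f A \<partial>law j) = e"
    have "\<mu> = (\<Sum>j<m. e)" unfolding \<mu>_def by (intro sum.cong) (auto simp: ex e)
    then have \<mu>: "\<mu> = m * e" by simp
    have "{\<omega>\<in>space M. \<bar>(\<Sum>j<m. f (P j \<omega>)) / m - e\<bar> \<ge> t} = {\<omega>\<in>space M. \<bar>(\<Sum>j<m. f (P j \<omega>)) - \<mu>\<bar> \<ge> m * t}"
    proof -
      have "\<bar>s / m - e\<bar> = \<bar>s - \<mu>\<bar> / m" for s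
      proof -
        have "s / m - e = (s - \<mu>) / m" using m by (simp add: \<mu> diff_divide_distrib)
        then show ?thesis by (simp add: abs_divide)
      qed
      then show ?thesis using m by (simp add: le_divide_eq mult.commute)
    qed
    then show "prob {\<omega>\<in>space M. \<bar>(\<Sum>j<m. f (P j \<omega>)) / m - e\<bar> \<ge> t} \<le> 2 * exp (- 2 * real m * t\<^sup>2)"
      using H.Hoeffding_ineq_abs_ge[OF mt pos] unfolding expo by simp
  }
qed

end

section \<open>Uniform deviation through nets\<close>

lemma average_diff_le:
  fixes f g h :: "nat \<Rightarrow> real"
  assumes "\<And>j. j < m \<Longrightarrow> \<bar>f j - g j\<bar> \<le> h j"
  shows "\<bar>(\<Sum>j<m. f j) / m - (\<Sum>j<m. g j) / m\<bar> \<le> (\<Sum>j<m. h j) / m"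
proof -
  have "\<bar>\<Sum>j<m. f j - g j\<bar> \<le> (\<Sum>j<m. h j)"
    using assms by (intro order_trans[OF sum_abs] sum_mono) auto
  then have "\<bar>\<Sum>j<m. f j - g j\<bar> / m \<le> (\<Sum>j<m. h j) / m" by (rule divide_right_mono) simp
  then show ?thesis by (simp add: sum_subtractf diff_divide_distrib[symmetric] abs_divide)
qed

lemma qf_lipschitz:
  assumes P: "P \<in> Proj k" and y: "norm y = 1" and z: "norm z = 1"
  shows "\<bar>qf P y - qf P z\<bar> \<le> 2 * norm (y - z)"
proof -
  have le: "norm (P *v w) \<le> norm w" for w
    using qf_le[OF P, of w] unfolding qf_Proj[OF P] by (rule power2_le_imp_le) simp
  have "qf P y - qf P z = (norm (P *v y) - norm (P *v z)) * (norm (P *v y) + norm (P *v z))"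
    unfolding qf_Proj[OF P] by (simp add: power2_eq_square algebra_simps)
  then have "\<bar>qf P y - qf P z\<bar> = \<bar>norm (P *v y) - norm (P *v z)\<bar> * (norm (P *v y) + norm (P *v z))"
    by (simp add: abs_mult)
  also have "\<bar>norm (P *v y) - norm (P *v z)\<bar> \<le> norm (P *v y - P *v z)" by (rule norm_triangle_ineq3)
  also have "P *v y - P *v z = P *v (y - z)" by (simp add: matrix_vector_mult_diff_distrib)
  also have "norm (P *v (y - z)) * (norm (P *v y) + norm (P *v z)) \<le> norm (y - z) * 2"
    using le[of y] le[of z] y z by (intro mult_mono le) auto
  finally show ?thesis by (simp add: mult_right_mono mult.commute)
qed

lemma rform_lipschitz:
  assumes "P \<in> Proj k" "norm y = 1" "norm z = 1"
  shows "\<bar>rform P x y - rform P x z\<bar> \<le> 2 * norm (y - z)"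
  using qf_lipschitz[OF assms] assms(2,3) by (auto simp: rform_def abs_minus_commute)

text \<open>
  The quadratic form is Lipschitz with constant \<open>2\<close> on the sphere, so the sign of a measurement can
  change along a step of length \<open>\<eta>\<close> only if it was within \<open>2 * \<eta>\<close> of the threshold.
\<close>

lemma rform_flip:
  assumes P: "P \<in> Proj k" and x: "norm x = 1" "norm x' = 1" and y: "norm y = 1" and \<eta>: "norm (x - x') \<le> \<eta>"
  shows "\<bar>rform P x y - rform P x' y\<bar> \<le> indicator {A. \<bar>qf A x' - 1/2\<bar> \<le> 2 * \<eta>} P"
proof (cases "(qf P x \<ge> 1/2) = (qf P x' \<ge> 1/2)")
  case False
  then have "\<bar>qf P x' - 1/2\<bar> \<le> 2 * \<eta>"
    using qf_lipschitz[OF P x] \<eta> by linarith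
  then show ?thesis
    using rform_bounds[OF P, of x y] rform_bounds[OF P, of x' y] y by (simp add: indicator_def)
qed (auto simp: rform_def)

lemma cip_lipschitz:
  assumes "norm x = 1" "norm y = 1" "norm z = 1"
  shows "\<bar>(norm (cip x y))\<^sup>2 - (norm (cip x z))\<^sup>2\<bar> \<le> 2 * norm (y - z)"
proof -
  have "outer x \<in> Proj 1" using assms(1) unfolding Proj_1_eq by blast
  from qf_lipschitz[OF this assms(2,3)] show ?thesis by (simp add: qf_def inner_outer)
qed

context random_projections
begin

text \<open>
  Passing from \<open>(x, y)\<close> to a pair of net points costs the fraction of sign changes in \<open>x\<close>, and a
  multiple of \<open>\<eta>\<close> in \<open>y\<close> and in the mean form. The exceptional event consists of the two-sided
  deviations at pairs of net points and, at each net point, the upper deviation of the fraction of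
  measurements near the threshold; for a net of \<open>N\<close> points this costs \<open>2 N\<^sup>2 + N \<le> 4 N\<^sup>2\<close> exponentials.
\<close>

lemma uniform_deviation_net:
  fixes \<epsilon> \<beta> a \<nu> \<kappa> c :: real
  defines "\<beta> \<equiv> rc_beta TYPE('a)"
  defines "a \<equiv> \<beta> * n" and "\<nu> \<equiv> mu2 \<beta> n" and "\<kappa> \<equiv> mu1 \<beta> n - mu2 \<beta> n"
  assumes a: "a \<ge> 1" and \<epsilon>: "\<epsilon> > 0"
  defines "c \<equiv> sqrt (2 * a - 1) / (2 * sqrt (2 * pi))"
  obtains E where "E \<in> events"
    "prob E \<le> 4 * ((1 + 128 * c * (1 / \<epsilon>)) ^ DIM('a^'d))\<^sup>2 * exp (- (m * \<epsilon>\<^sup>2 / 2))"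
    "\<And>\<omega> x y. \<omega> \<in> space M - E \<Longrightarrow> norm x = 1 \<Longrightarrow> norm y = 1 \<Longrightarrow>
        \<bar>dev m \<nu> \<kappa> (\<lambda>j. P j \<omega>) x y\<bar> \<le> 2 * \<epsilon>"
proof -
  define \<rho> where "\<rho> = sqrt (2 * a - 1)"
  \<comment> \<open>This radius makes the covering bound \<open>1 + 2 / \<eta>\<close> equal to the base of the power in the claim.\<close>
  define \<eta> where "\<eta> = \<epsilon> / (64 * c)"
  have \<rho>: "\<rho> \<ge> 1" using a by (simp add: \<rho>_def)
  have c: "c > 0" using \<rho> by (simp add: c_def \<rho>_def[symmetric])
  have \<eta>: "\<eta> > 0" using c \<epsilon> by (simp add: \<eta>_def)
  have net_size: "1 + 2 / \<eta> = 1 + 128 * c * (1 / \<epsilon>)" using c \<epsilon> by (simp add: \<eta>_def field_simps)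
  obtain S :: "('a^'d) set" where S: "finite S" "S \<subseteq> sphere 0 1"
    "real (card S) \<le> (1 + 2 / \<eta>) ^ DIM('a^'d)" "\<And>x. norm x = 1 \<Longrightarrow> \<exists>s\<in>S. norm (x - s) \<le> \<eta>"
    using sphere_net[OF \<eta>] by metis
  have nS: "norm s = 1" if "s \<in> S" for s using S(2) that by auto
  interpret U0: uniform_projection n "law 0" using uniform_projection_law m by simp
  have \<kappa>1: "\<kappa> \<le> 1" using U0.mu_bounds by (simp add: \<kappa>_def \<beta>_def)
  have \<kappa>0: "\<kappa> > 0" unfolding \<kappa>_def using n by (intro mu_gap_pos) (simp_all add: \<beta>_def rc_beta_def)
  \<comment> \<open>A bound for the probability that a measurement is within \<open>2 * \<eta>\<close> of the threshold.\<close>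
  define p where "p = 4 * \<eta> * \<rho>"
  define F where "F s = {A::'a^'d^'d. \<bar>qf A s - 1/2\<bar> \<le> 2 * \<eta>}" for s
  have Fm: "(\<lambda>A. indicator (F s) A :: real) \<in> borel_measurable (Proj_borel n)" for s
  proof -
    have [measurable]: "(\<lambda>A. A) \<in> borel_measurable (Proj_borel n :: ('a^'d^'d) measure)"
      by (rule measurable_restrict_space1) simp
    show ?thesis unfolding F_def by measurable
  qed
  have rm: "(\<lambda>A. rform A s t) \<in> borel_measurable (Proj_borel n)" for s t :: "'a^'d"
  proof -
    have [measurable]: "(\<lambda>A. A) \<in> borel_measurable (Proj_borel n :: ('a^'d^'d) measure)"
      by (rule measurable_restrict_space1) simp
    show ?thesis by measurable
  qed
  define E1 where "E1 s t = {\<omega>\<in>space M. \<bar>(\<Sum>j<m. rform (P j \<omega>) s t) / m - (\<nu> + \<kappa> * (norm (cip s t))\<^sup>2)\<bar> \<ge> \<epsilon> / 2}" for s t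
  define E2 where "E2 s = {\<omega>\<in>space M. (\<Sum>j<m. indicator (F s) (P j \<omega>)) / m \<ge> p + \<epsilon> / 2}" for s
  have E1m: "E1 s t \<in> events" for s t
  proof -
    have [measurable]: "(\<lambda>\<omega>. \<Sum>j<m. rform (P j \<omega>) s t) \<in> borel_measurable M"
      by (intro borel_measurable_sum measurable_compose[OF P_measurable rm]) auto
    show ?thesis unfolding E1_def by measurable
  qed
  have E2m: "E2 s \<in> events" for s
  proof -
    have [measurable]: "(\<lambda>\<omega>. \<Sum>j<m. indicator (F s) (P j \<omega>) :: real) \<in> borel_measurable M"
      by (intro borel_measurable_sum measurable_compose[OF P_measurable Fm]) auto
    show ?thesis unfolding E2_def by measurable
  qed
  let ?e = "exp (- (m * \<epsilon>\<^sup>2 / 2))"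
  have expo: "exp (- 2 * real m * (\<epsilon> / 2)\<^sup>2) = ?e" by (simp add: power_divide)
  have prob1: "prob (E1 s t) \<le> 2 * ?e" if st: "s \<in> S" "t \<in> S" for s t
    unfolding E1_def expo[symmetric]
  proof (rule hoeffding_abs[OF rm[of s t]])
    show "0 \<le> rform A s t \<and> rform A s t \<le> 1" if "A \<in> Proj n" for A
      using rform_bounds[OF that, of s t] nS[OF st(2)] by simp
    fix j assume "j < m"
    then interpret U: uniform_projection n "law j" by (rule uniform_projection_law)
    show "(\<integral>A. rform A s t \<partial>law j) = \<nu> + \<kappa> * (norm (cip s t))\<^sup>2"
      using U.mean_form_eq[of s t] nS st unfolding U.mean_form_def \<nu>_def \<kappa>_def \<beta>_def by simp
  qed (use \<epsilon> in simp)
  have prob2: "prob (E2 s) \<le> ?e" if s: "s \<in> S" for s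
    unfolding E2_def expo[symmetric]
  proof (rule hoeffding_upper[OF Fm])
    fix j assume "j < m"
    then interpret U: uniform_projection n "law j" by (rule uniform_projection_law)
    have Fs: "{A \<in> space (law j). \<bar>qf A s - 1/2\<bar> \<le> 2 * \<eta>} = F s \<inter> space (law j)" by (auto simp: F_def)
    have "(\<integral>A. indicator (F s) A \<partial>law j) = measure (law j) (F s \<inter> space (law j))" by simp
    also have "\<dots> \<le> 2 * (2 * \<eta>) * 4 powr (1 - a) / Beta a a"
      using U.prob_near_half[of s "2 * \<eta>"] \<eta> nS[OF s] a unfolding Fs a_def \<beta>_def by simp
    also have "\<dots> = 4 * \<eta> * (4 powr (1 - a) / Beta a a)" by simp
    also have "\<dots> \<le> 4 * \<eta> * \<rho>"
      unfolding \<rho>_def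
    proof (intro mult_left_mono beta_density_bound)
      show "a = real (DIM('a) * n) / 2" by (simp add: a_def \<beta>_def rc_beta_def)
      then show "2 \<le> DIM('a) * n" using a by linarith
    qed (use \<eta> in simp)
    finally show "(\<integral>A. indicator (F s) A \<partial>law j) \<le> p" unfolding p_def .
  qed (use \<epsilon> in \<open>auto simp: indicator_def\<close>)
  define E where "E = (\<Union>s\<in>S. \<Union>t\<in>S. E1 s t) \<union> (\<Union>s\<in>S. E2 s)"
  define N where "N = (1 + 128 * c * (1 / \<epsilon>)) ^ DIM('a^'d)"
  have cardN: "real (card S) \<le> N" using S(3) unfolding N_def net_size .
  have N1: "N \<ge> 1" unfolding N_def using c \<epsilon> by (intro one_le_power) simp
  show ?thesis
  proof (rule that[of E])
    show "E \<in> events"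
      unfolding E_def using S(1) E1m E2m by (intro sets.Un sets.finite_UN) auto
    have "prob E \<le> prob (\<Union>s\<in>S. \<Union>t\<in>S. E1 s t) + prob (\<Union>s\<in>S. E2 s)"
      unfolding E_def using S(1) E1m E2m by (intro measure_Un_le) auto
    also have "prob (\<Union>s\<in>S. E2 s) \<le> (\<Sum>s\<in>S. prob (E2 s))"
      using S(1) E2m by (intro finite_measure_subadditive_finite) auto
    also have "\<dots> \<le> (\<Sum>s\<in>S. ?e)" by (intro sum_mono prob2)
    also have "prob (\<Union>s\<in>S. \<Union>t\<in>S. E1 s t) \<le> (\<Sum>s\<in>S. prob (\<Union>t\<in>S. E1 s t))"
      using S(1) E1m by (intro finite_measure_subadditive_finite) auto
    also have "\<dots> \<le> (\<Sum>s\<in>S. \<Sum>t\<in>S. 2 * ?e)"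
    proof (rule sum_mono)
      fix s assume s: "s \<in> S"
      have "prob (\<Union>t\<in>S. E1 s t) \<le> (\<Sum>t\<in>S. prob (E1 s t))"
        using S(1) E1m by (intro finite_measure_subadditive_finite) auto
      also have "\<dots> \<le> (\<Sum>t\<in>S. 2 * ?e)" by (intro sum_mono prob1 s)
      finally show "prob (\<Union>t\<in>S. E1 s t) \<le> (\<Sum>t\<in>S. 2 * ?e)" .
    qed
    also have "(\<Sum>s\<in>S. \<Sum>t\<in>S. 2 * ?e) + (\<Sum>s\<in>S. ?e) = (2 * (real (card S))\<^sup>2 + card S) * ?e"
      by (simp add: power2_eq_square algebra_simps)
    also have "\<dots> \<le> 4 * N\<^sup>2 * ?e"
    proof (rule mult_right_mono)
      have "(real (card S))\<^sup>2 \<le> N\<^sup>2" using cardN by (intro power_mono) auto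
      moreover have "real (card S) \<le> N\<^sup>2"
      proof -
        have "N * 1 \<le> N * N" using N1 by (intro mult_left_mono) auto
        then show ?thesis using cardN by (simp add: power2_eq_square)
      qed
      moreover have "0 \<le> N\<^sup>2" by simp
      ultimately show "2 * (real (card S))\<^sup>2 + card S \<le> 4 * N\<^sup>2" by linarith
    qed simp
    finally show "prob E \<le> 4 * ((1 + 128 * c * (1 / \<epsilon>)) ^ DIM('a^'d))\<^sup>2 * ?e" by (simp add: N_def)
  next
    fix \<omega> and x y :: "'a^'d" assume \<omega>: "\<omega> \<in> space M - E" and x: "norm x = 1" and y: "norm y = 1"
    obtain s where s: "s \<in> S" "norm (x - s) \<le> \<eta>" using S(4)[OF x] by blast
    obtain t where t: "t \<in> S" "norm (y - t) \<le> \<eta>" using S(4)[OF y] by blast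
    have PP: "P j \<omega> \<in> Proj n" if "j \<in> {..<m}" for j using P_Proj \<omega> that by auto
    let ?r = "\<lambda>x y. (\<Sum>j<m. rform (P j \<omega>) x y) / m"
    have r1: "\<bar>?r x y - ?r s y\<bar> \<le> p + \<epsilon> / 2"
    proof -
      have "\<bar>?r x y - ?r s y\<bar> \<le> (\<Sum>j<m. indicator (F s) (P j \<omega>)) / m"
        unfolding F_def by (intro average_diff_le rform_flip[OF PP x nS[OF s(1)] y s(2)]) simp
      also have "\<dots> \<le> p + \<epsilon> / 2" using \<omega> s(1) by (auto simp: E_def E2_def)
      finally show ?thesis .
    qed
    have r2: "\<bar>?r s y - ?r s t\<bar> \<le> 2 * \<eta>"
    proof -
      have "\<bar>?r s y - ?r s t\<bar> \<le> (\<Sum>j<m. 2 * \<eta>) / m"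
      proof (rule average_diff_le)
        fix j assume "j < m"
        then have "P j \<omega> \<in> Proj n" using PP by simp
        from rform_lipschitz[OF this y nS[OF t(1)], of s] show "\<bar>rform (P j \<omega>) s y - rform (P j \<omega>) s t\<bar> \<le> 2 * \<eta>"
          using t(2) by linarith
      qed
      also have "\<dots> = 2 * \<eta>" using m by simp
      finally show ?thesis .
    qed
    have r3: "\<bar>?r s t - (\<nu> + \<kappa> * (norm (cip s t))\<^sup>2)\<bar> \<le> \<epsilon> / 2"
    proof -
      have "\<omega> \<notin> E1 s t" using \<omega> s(1) t(1) by (auto simp: E_def)
      then show ?thesis using \<omega> by (simp add: E1_def not_le less_imp_le)
    qed
    have "\<bar>(norm (cip s t))\<^sup>2 - (norm (cip x y))\<^sup>2\<bar> \<le> 4 * \<eta>"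
      using cip_lipschitz[OF nS[OF s(1)] y nS[OF t(1)]] cip_lipschitz[OF y x nS[OF s(1)]] s(2) t(2)
      unfolding norm_cip_commute[of y] by linarith
    then have "\<kappa> * \<bar>(norm (cip s t))\<^sup>2 - (norm (cip x y))\<^sup>2\<bar> \<le> 1 * (4 * \<eta>)"
      using \<kappa>0 \<kappa>1 by (intro mult_mono) auto
    then have r4: "\<bar>\<kappa> * (norm (cip s t))\<^sup>2 - \<kappa> * (norm (cip x y))\<^sup>2\<bar> \<le> 4 * \<eta>"
      using \<kappa>0 by (simp add: abs_mult flip: right_diff_distrib)
    have "\<bar>dev m \<nu> \<kappa> (\<lambda>j. P j \<omega>) x y\<bar> \<le> \<epsilon> + (p + 6 * \<eta>)"
      using r1 r2 r3 r4 unfolding dev_def by linarith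
    moreover have "p + 6 * \<eta> \<le> \<epsilon>"
    proof -
      have "p + 6 * \<eta> \<le> 10 * (\<eta> * \<rho>)" using \<rho> \<eta> by (simp add: p_def)
      also have "\<eta> * \<rho> = \<epsilon> * (sqrt (2 * pi) / 32)"
        using \<rho> by (simp add: \<eta>_def c_def \<rho>_def[symmetric])
      also have "10 * (\<epsilon> * (sqrt (2 * pi) / 32)) \<le> 10 * (\<epsilon> * (3 / 32))"
      proof -
        have "sqrt (2 * pi) \<le> sqrt 9" using pi_less_4 by (intro real_sqrt_le_mono) simp
        then show ?thesis using \<epsilon> by simp
      qed
      finally show ?thesis using \<epsilon> by simp
    qed
    ultimately show "\<bar>dev m \<nu> \<kappa> (\<lambda>j. P j \<omega>) x y\<bar> \<le> 2 * \<epsilon>" by simp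
  qed
qed

end

section \<open>A maximal inequality for empirical distributions\<close>

text \<open>
  \<open>t\<^sup>2 / 2 - ln (cosh t)\<close> has the derivative \<open>t - tanh t\<close>, which is nonnegative for \<open>t \<ge> 0\<close>.
\<close>

lemma cosh_le_exp: "cosh x \<le> exp (x\<^sup>2 / 2)" for x :: real
proof -
  have nonneg: "cosh y \<le> exp (y\<^sup>2 / 2)" if y: "y \<ge> 0" for y :: real
  proof -
    have tanh: "tanh t \<le> t" if t: "t \<ge> 0" for t :: real
    proof -
      have "(\<lambda>t. t - tanh t) 0 \<le> (\<lambda>t. t - tanh t) t"
      proof (rule DERIV_nonneg_imp_nondecreasing[OF t])
        fix r :: real
        have "((\<lambda>t. t - tanh t) has_real_derivative (1 - (1 - (tanh r)\<^sup>2))) (at r)"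
          by (auto intro!: derivative_eq_intros)
        then show "\<exists>D. ((\<lambda>t. t - tanh t) has_real_derivative D) (at r) \<and> 0 \<le> D" by fastforce
      qed
      then show ?thesis by simp
    qed
    have "(\<lambda>t. t\<^sup>2 / 2 - ln (cosh t)) 0 \<le> (\<lambda>t. t\<^sup>2 / 2 - ln (cosh t)) y"
    proof (rule DERIV_nonneg_imp_nondecreasing[OF y])
      fix r :: real assume r: "0 \<le> r"
      have "((\<lambda>t. t\<^sup>2 / 2 - ln (cosh t)) has_real_derivative (r - tanh r)) (at r)"
        by (auto intro!: derivative_eq_intros simp: tanh_def)
      then show "\<exists>D. ((\<lambda>t. t\<^sup>2 / 2 - ln (cosh t)) has_real_derivative D) (at r) \<and> 0 \<le> D"
        using tanh[OF r] by (intro exI[of _ "r - tanh r"]) auto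
    qed
    then have "ln (cosh y) \<le> y\<^sup>2 / 2" by simp
    then show ?thesis by (metis cosh_real_pos exp_ln exp_le_cancel_iff)
  qed
  show ?thesis using nonneg[of x] nonneg[of "- x"] by (cases "x \<ge> 0") auto
qed

text \<open>
  For labels in \<open>2 * N\<close> equally likely cells and \<open>t = i / (2 * N)\<close>, this is \<open>m\<close> times
  \<open>(F(t) - t) / (1 - t)\<close>, where \<open>F(t)\<close> is the fraction of labels below \<open>i\<close>: the classical martingale
  for the empirical distribution function.
\<close>

definition excess :: "nat \<Rightarrow> nat \<Rightarrow> (nat \<Rightarrow> nat) \<Rightarrow> nat \<Rightarrow> real"
  where "excess N m f i = (\<Sum>j<m. 1 - of_bool (i \<le> f j) / (1 - real i / real (2 * N)))"

abbreviation labellings :: "nat \<Rightarrow> nat \<Rightarrow> (nat \<Rightarrow> nat) set"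
  where "labellings N m \<equiv> {..<m} \<rightarrow>\<^sub>E {..<2 * N}"

lemma sum_labellings_split:
  assumes j: "j < m"
  shows "(\<Sum>f\<in>labellings N m. H f)
    = (\<Sum>g\<in>({..<m} - {j}) \<rightarrow>\<^sub>E {..<2 * N}. \<Sum>l<2 * N. H (g(j := l)))"
proof -
  have ins: "{..<m} = insert j ({..<m} - {j})" using j by auto
  have "labellings N m = (\<lambda>(l, g). g(j := l)) ` ({..<2 * N} \<times> (({..<m} - {j}) \<rightarrow>\<^sub>E {..<2 * N}))"
    by (subst ins, subst PiE_insert_eq) simp
  moreover have "inj_on (\<lambda>(l, g). g(j := l)) ({..<2 * N} \<times> (({..<m} - {j}) \<rightarrow>\<^sub>E {..<2 * N}))"
    using inj_combinator[of j "{..<m} - {j}" "\<lambda>_. {..<2 * N}"] by simp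
  ultimately have "(\<Sum>f\<in>labellings N m. H f)
      = (\<Sum>(l, g)\<in>{..<2 * N} \<times> (({..<m} - {j}) \<rightarrow>\<^sub>E {..<2 * N}). H (g(j := l)))"
    by (simp only: sum.reindex) (simp add: case_prod_beta)
  also have "\<dots> = (\<Sum>l<2 * N. \<Sum>g\<in>({..<m} - {j}) \<rightarrow>\<^sub>E {..<2 * N}. H (g(j := l)))"
    by (subst sum.cartesian_product) simp
  also have "\<dots> = (\<Sum>g\<in>({..<m} - {j}) \<rightarrow>\<^sub>E {..<2 * N}. \<Sum>l<2 * N. H (g(j := l)))"
    by (rule sum.swap)
  finally show ?thesis .
qed

text \<open>
  Given the labels truncated at \<open>i\<close>, a label below \<open>i\<close> contributes nothing to the increment, and a
  label that is at least \<open>i\<close> is uniform on the remaining cells, over which its contribution sums to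
  \<open>0\<close>.
\<close>

lemma excess_martingale:
  fixes F :: "(nat \<Rightarrow> nat) \<Rightarrow> real"
  assumes N: "N > 0" and i: "i \<le> N"
    and F: "\<And>f g. (\<And>j. j < m \<Longrightarrow> min (f j) i = min (g j) i) \<Longrightarrow> F f = F g"
  shows "(\<Sum>f\<in>labellings N m. F f * (excess N m f N - excess N m f i)) = 0"
proof -
  define q where "q = 1 - real i / real (2 * N)"
  define \<xi> where "\<xi> l = of_bool (i \<le> l) / q - 2 * of_bool (N \<le> l)" for l :: nat
  have q: "q * real (2 * N) = real (2 * N) - real i" using N by (simp add: q_def field_simps)
  have q0: "q > 0" using i N by (simp add: q_def field_simps)
  have diff: "excess N m f N - excess N m f i = (\<Sum>j<m. \<xi> (f j))" for f
  proof -
    have qN: "1 - real N / real (2 * N) = 1 / 2" using N by simp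
    show ?thesis
      unfolding excess_def \<xi>_def qN q_def[symmetric] sum_subtractf[symmetric]
      by (intro sum.cong refl) simp
  qed
  have cnt: "(\<Sum>l<2 * N. of_bool (k \<le> l) :: real) = real (2 * N) - real k" if "k \<le> 2 * N" for k
  proof -
    have "(\<Sum>l<2 * N. of_bool (k \<le> l) :: real) = real (card ({..<2 * N} \<inter> {l. k \<le> l}))"
      by (simp add: of_bool_def sum.If_cases)
    also have "{..<2 * N} \<inter> {l. k \<le> l} = {k..<2 * N}" by auto
    finally show ?thesis using that by (simp add: of_nat_diff)
  qed
  have "(\<Sum>l<2 * N. \<xi> l) = (real (2 * N) - real i) / q - 2 * (real (2 * N) - real N)"
    unfolding \<xi>_def sum_subtractf sum_divide_distrib[symmetric] sum_distrib_left[symmetric]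
  proof -
    have iN: "i \<le> 2 * N" "N \<le> 2 * N" using i by auto
    show "(\<Sum>l<2 * N. of_bool (i \<le> l)) / q - 2 * (\<Sum>l<2 * N. of_bool (N \<le> l))
        = (real (2 * N) - real i) / q - 2 * (real (2 * N) - real N)"
      unfolding cnt[OF iN(1)] cnt[OF iN(2)] ..
  qed
  also have "\<dots> = 0" unfolding q[symmetric] using q0 by simp
  finally have sum\<xi>: "(\<Sum>l<2 * N. \<xi> l) = 0" .
  have each: "(\<Sum>f\<in>labellings N m. F f * \<xi> (f j)) = 0" if j: "j < m" for j
  proof -
    have "(\<Sum>l<2 * N. F (g(j := l)) * \<xi> ((g(j := l)) j)) = 0" for g
    proof -
      have "(\<Sum>l<2 * N. F (g(j := l)) * \<xi> ((g(j := l)) j)) = (\<Sum>l<2 * N. F (g(j := i)) * \<xi> l)"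
      proof (rule sum.cong[OF refl])
        fix l
        show "F (g(j := l)) * \<xi> ((g(j := l)) j) = F (g(j := i)) * \<xi> l"
        proof (cases "i \<le> l")
          case True
          then have "F (g(j := l)) = F (g(j := i))" by (intro F) auto
          then show ?thesis by simp
        next
          case False
          then show ?thesis using i by (simp add: \<xi>_def)
        qed
      qed
      then show ?thesis using sum\<xi> by (simp flip: sum_distrib_left)
    qed
    then show ?thesis unfolding sum_labellings_split[OF j] by simp
  qed
  have "(\<Sum>f\<in>labellings N m. F f * (excess N m f N - excess N m f i))
      = (\<Sum>j<m. \<Sum>f\<in>labellings N m. F f * \<xi> (f j))"
    unfolding diff sum_distrib_left by (rule sum.swap)
  then show ?thesis using each by simp
qed

text \<open>
  Doob's inequality. The labellings that cross the level are grouped by the first index of crossing;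
  convexity of the exponential and the martingale property bound the exponential there by its final
  value. At \<open>i = N\<close> every label contributes \<open>1\<close> or \<open>-1\<close> with equal probability, so the final
  exponential moment is a power of \<open>cosh\<close>.
\<close>

lemma excess_maximal:
  fixes s \<sigma> :: real
  assumes N: "N > 0" and s: "s \<ge> 0" and \<sigma>: "\<bar>\<sigma>\<bar> = 1"
  shows "real (card {f\<in>labellings N m. \<exists>i\<le>N. \<sigma> * excess N m f i \<ge> m * s})
    \<le> real (2 * N) ^ m * exp (- (m * s\<^sup>2 / 2))"
proof -
  let ?\<Omega> = "labellings N m"
  define H where "H f i = \<sigma> * excess N m f i" for f i
  define A where "A i = {f\<in>?\<Omega>. H f i \<ge> m * s \<and> (\<forall>k<i. H f k < m * s)}" for i
  have fin: "finite ?\<Omega>" by (intro finite_PiE) auto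
  have finA: "finite (A i)" for i using fin by (simp add: A_def)
  have UN: "{f\<in>?\<Omega>. \<exists>i\<le>N. \<sigma> * excess N m f i \<ge> m * s} = (\<Union>i\<le>N. A i)"
  proof (intro equalityI subsetI)
    fix f assume "f \<in> {f\<in>?\<Omega>. \<exists>i\<le>N. \<sigma> * excess N m f i \<ge> m * s}"
    then obtain i where f: "f \<in> ?\<Omega>" and i: "i \<le> N" "H f i \<ge> m * s" by (auto simp: H_def)
    define k where "k = (LEAST k. H f k \<ge> m * s)"
    have "H f k \<ge> m * s" unfolding k_def using i(2) by (rule LeastI)
    moreover have "k \<le> N" using Least_le[of "\<lambda>k. H f k \<ge> m * s" i] i by (simp add: k_def)
    moreover have "\<forall>l<k. H f l < m * s" using not_less_Least[of _ "\<lambda>k. H f k \<ge> m * s"] by (auto simp: k_def not_le)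
    ultimately show "f \<in> (\<Union>i\<le>N. A i)" using f by (auto simp: A_def)
  qed (auto simp: A_def H_def)
  have disj: "disjoint_family_on A {..N}"
    unfolding disjoint_family_on_def
  proof (intro ballI impI)
    fix i k :: nat assume "i \<noteq> k"
    then consider "i < k" | "k < i" by linarith
    then show "A i \<inter> A k = {}" by cases (force simp: A_def)+
  qed
  have Hcong: "H f k = H g k" if "k \<le> i" "\<And>j. j < m \<Longrightarrow> min (f j) i = min (g j) i" for f g k i
  proof -
    have "(k \<le> f j) = (k \<le> g j)" if "j < m" for j
      using \<open>k \<le> i\<close> \<open>\<And>j. j < m \<Longrightarrow> min (f j) i = min (g j) i\<close>[OF that] by (auto simp: min_def split: if_splits)
    then show ?thesis by (simp add: H_def excess_def)
  qed
  have step: "exp (s * (m * s)) * real (card (A i)) \<le> (\<Sum>f\<in>A i. exp (s * H f N))" if i: "i \<le> N" for i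
  proof -
    define F where "F f = of_bool (H f i \<ge> m * s \<and> (\<forall>k<i. H f k < m * s)) * exp (s * H f i)" for f
    have Fcong: "F f = F g" if "\<And>j. j < m \<Longrightarrow> min (f j) i = min (g j) i" for f g
      using Hcong[of _ i f g] that by (auto simp: F_def)
    have ind: "(\<Sum>f\<in>A i. h f) = (\<Sum>f\<in>?\<Omega>. of_bool (H f i \<ge> m * s \<and> (\<forall>k<i. H f k < m * s)) * h f)" for h :: "_ \<Rightarrow> real"
      unfolding A_def sum.inter_filter[OF fin] by (intro sum.cong refl) simp
    have "exp (s * (m * s)) * real (card (A i)) = (\<Sum>f\<in>A i. exp (s * (m * s)))" by simp
    also have "\<dots> \<le> (\<Sum>f\<in>A i. exp (s * H f i))"
    proof (rule sum_mono)
      fix f assume "f \<in> A i"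
      then have "m * s \<le> H f i" by (simp add: A_def)
      from mult_left_mono[OF this s] show "exp (s * (m * s)) \<le> exp (s * H f i)"
        by (simp only: exp_le_cancel_iff)
    qed
    also have "\<dots> = (\<Sum>f\<in>A i. exp (s * H f i)) + s * \<sigma> * (\<Sum>f\<in>?\<Omega>. F f * (excess N m f N - excess N m f i))"
    proof -
      have "(\<Sum>f\<in>?\<Omega>. F f * (excess N m f N - excess N m f i)) = 0"
        by (rule excess_martingale[OF N i]) (rule Fcong)
      then show ?thesis by (simp only: mult_zero_right add_0_right)
    qed
    also have "\<dots> = (\<Sum>f\<in>A i. exp (s * H f i) * (1 + (s * H f N - s * H f i)))"
      unfolding ind F_def sum_distrib_left sum.distrib[symmetric]
      by (intro sum.cong refl) (simp add: H_def algebra_simps)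
    also have "\<dots> \<le> (\<Sum>f\<in>A i. exp (s * H f N))"
    proof (rule sum_mono)
      fix f
      have "exp (s * H f i) * (1 + (s * H f N - s * H f i)) \<le> exp (s * H f i) * exp (s * H f N - s * H f i)"
        by (intro mult_left_mono exp_ge_add_one_self) simp
      then show "exp (s * H f i) * (1 + (s * H f N - s * H f i)) \<le> exp (s * H f N)"
        by (simp flip: exp_add)
    qed
    finally show ?thesis .
  qed
  have "exp (s * (m * s)) * real (card (\<Union>i\<le>N. A i)) = (\<Sum>i\<le>N. exp (s * (m * s)) * real (card (A i)))"
    using disj finA by (subst card_UN_disjoint) (auto simp: disjoint_family_on_def sum_distrib_left)
  also have "\<dots> \<le> (\<Sum>i\<le>N. \<Sum>f\<in>A i. exp (s * H f N))" by (intro sum_mono step) simp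
  also have "\<dots> = (\<Sum>f\<in>(\<Union>i\<le>N. A i). exp (s * H f N))"
    using disj finA by (subst sum.UNION_disjoint) (auto simp: disjoint_family_on_def)
  also have "\<dots> \<le> (\<Sum>f\<in>?\<Omega>. exp (s * H f N))"
    using fin by (intro sum_mono2) (auto simp: A_def)
  also have "\<dots> = (\<Sum>f\<in>?\<Omega>. \<Prod>j<m. exp (s * \<sigma> * (1 - 2 * of_bool (N \<le> f j))))"
  proof (intro sum.cong refl)
    fix f
    have "s * H f N = (\<Sum>j<m. s * \<sigma> * (1 - 2 * of_bool (N \<le> f j)))"
      using N by (simp add: H_def excess_def sum_distrib_left algebra_simps)
    then show "exp (s * H f N) = (\<Prod>j<m. exp (s * \<sigma> * (1 - 2 * of_bool (N \<le> f j))))"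
      by (simp add: exp_sum)
  qed
  also have "\<dots> = (\<Prod>j<m. \<Sum>l<2 * N. exp (s * \<sigma> * (1 - 2 * of_bool (N \<le> l))))"
    by (rule prod_sum_PiE[symmetric]) auto
  also have "(\<Sum>l<2 * N. exp (s * \<sigma> * (1 - 2 * of_bool (N \<le> l)))) = real (2 * N) * cosh s"
  proof -
    have split: "{..<2 * N} = {..<N} \<union> {N..<2 * N}" by auto
    have "(\<Sum>l<2 * N. exp (s * \<sigma> * (1 - 2 * of_bool (N \<le> l))))
        = (\<Sum>l<N. exp (s * \<sigma>)) + (\<Sum>l=N..<2 * N. exp (- (s * \<sigma>)))"
      unfolding split by (subst sum.union_disjoint) (auto intro!: arg_cong2[where f="(+)"] sum.cong)
    also have "\<dots> = real N * (exp (s * \<sigma>) + exp (- (s * \<sigma>)))" by (simp add: algebra_simps)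
    also have "exp (s * \<sigma>) + exp (- (s * \<sigma>)) = 2 * cosh s"
      using \<sigma> by (auto simp: abs_if cosh_def split: if_splits)
    finally show ?thesis by simp
  qed
  also have "(\<Prod>j<m. real (2 * N) * cosh s) \<le> (real (2 * N) * exp (s\<^sup>2 / 2)) ^ m"
    unfolding prod_constant card_lessThan by (intro power_mono mult_left_mono cosh_le_exp) auto
  also have "\<dots> = real (2 * N) ^ m * exp (m * (s\<^sup>2 / 2))"
    by (simp only: power_mult_distrib exp_of_nat_mult)
  finally have "exp (s * (m * s)) * real (card (\<Union>i\<le>N. A i)) \<le> real (2 * N) ^ m * exp (m * (s\<^sup>2 / 2))" .
  then have "exp (- (s * (m * s))) * (exp (s * (m * s)) * real (card (\<Union>i\<le>N. A i)))
      \<le> exp (- (s * (m * s))) * (real (2 * N) ^ m * exp (m * (s\<^sup>2 / 2)))"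
    by (intro mult_left_mono) auto
  also have "exp (- (s * (m * s))) * (exp (s * (m * s)) * real (card (\<Union>i\<le>N. A i))) = real (card (\<Union>i\<le>N. A i))"
    by (simp add: mult.assoc[symmetric] flip: exp_add)
  also have "exp (- (s * (m * s))) * (real (2 * N) ^ m * exp (m * (s\<^sup>2 / 2)))
      = real (2 * N) ^ m * exp (- (m * s\<^sup>2 / 2))"
    by (simp add: mult.left_commute[of "exp _"] power2_eq_square algebra_simps flip: exp_add)
  finally show ?thesis unfolding UN .
qed

definition discrepancy :: "nat \<Rightarrow> nat \<Rightarrow> (nat \<Rightarrow> nat) \<Rightarrow> nat \<Rightarrow> real"
  where "discrepancy N m f i = real (card {j. j < m \<and> f j < i}) / m - real i / real (2 * N)"

lemma discrepancy_le_excess: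
  assumes m: "m > 0" and N: "N > 0" and i: "i \<le> N"
  shows "\<bar>discrepancy N m f i\<bar> \<le> \<bar>excess N m f i\<bar> / m"
proof -
  define q where "q = 1 - real i / real (2 * N)"
  have q: "0 < q" "q \<le> 1" using i N by (auto simp: q_def field_simps)
  have "(\<Sum>j<m. of_bool (i \<le> f j) :: real) = real m - real (card {j. j < m \<and> f j < i})"
  proof -
    have "(\<Sum>j<m. of_bool (i \<le> f j) :: real) = (\<Sum>j<m. 1 - of_bool (f j < i))"
      by (intro sum.cong) auto
    also have "\<dots> = real m - real (card ({..<m} \<inter> {j. f j < i}))"
      by (simp add: sum_subtractf of_bool_def sum.If_cases)
    also have "{..<m} \<inter> {j. f j < i} = {j. j < m \<and> f j < i}" by auto
    finally show ?thesis .
  qed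
  moreover have "excess N m f i = (\<Sum>j<m. 1) - (\<Sum>j<m. of_bool (i \<le> f j)) / q"
    unfolding excess_def q_def[symmetric] sum_subtractf sum_divide_distrib ..
  ultimately have "excess N m f i = real m - (real m - real (card {j. j < m \<and> f j < i})) / q"
    by simp
  then have "q * (excess N m f i / m) = q - 1 + real (card {j. j < m \<and> f j < i}) / m"
    using m q by (simp add: field_simps)
  also have "\<dots> = discrepancy N m f i" by (simp add: discrepancy_def q_def)
  finally have "\<bar>discrepancy N m f i\<bar> = \<bar>q * (excess N m f i / m)\<bar>" by (simp only:)
  also have "\<dots> = q * (\<bar>excess N m f i\<bar> / m)"
    using q by (simp add: abs_mult abs_divide)
  also have "\<dots> \<le> 1 * (\<bar>excess N m f i\<bar> / m)" using q by (intro mult_right_mono) auto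
  finally show ?thesis by simp
qed

lemma discrepancy_reverse:
  assumes m: "m > 0" and N: "N > 0" and i: "i \<le> 2 * N" and f: "\<And>j. j < m \<Longrightarrow> f j < 2 * N"
  shows "discrepancy N m (\<lambda>j. 2 * N - 1 - f j) (2 * N - i) = - discrepancy N m f i"
proof -
  have eq: "{j. j < m \<and> 2 * N - 1 - f j < 2 * N - i} = {..<m} - {j. j < m \<and> f j < i}"
    using f i by force
  have "card {j. j < m \<and> 2 * N - 1 - f j < 2 * N - i} = m - card {j. j < m \<and> f j < i}"
    unfolding eq by (subst card_Diff_subset) auto
  moreover have "card {j. j < m \<and> f j < i} \<le> m"
    using card_mono[of "{..<m}" "{j. j < m \<and> f j < i}"] by auto
  ultimately show ?thesis
    using m N i by (simp add: discrepancy_def of_nat_diff field_simps)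
qed

context prob_space
begin

lemma uniform_labels_prob_le:
  assumes L: "indep_vars (\<lambda>_. count_space UNIV) L {..<m}" and N: "N > 0"
    and range: "\<And>j \<omega>. j < m \<Longrightarrow> \<omega> \<in> space M \<Longrightarrow> L j \<omega> < 2 * N"
    and unif: "\<And>j l. j < m \<Longrightarrow> l < 2 * N \<Longrightarrow> prob {\<omega>\<in>space M. L j \<omega> = l} = 1 / real (2 * N)"
    and A: "A \<subseteq> labellings N m" and m: "m > 0"
  shows "{\<omega>\<in>space M. (\<lambda>j\<in>{..<m}. L j \<omega>) \<in> A} \<in> events"
    and "prob {\<omega>\<in>space M. (\<lambda>j\<in>{..<m}. L j \<omega>) \<in> A} \<le> real (card A) / real (2 * N) ^ m"
proof -
  have finA: "finite A" by (rule finite_subset[OF A]) (intro finite_PiE, auto)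
  have Lm: "L j \<in> M \<rightarrow>\<^sub>M count_space UNIV" if "j < m" for j
    using L that unfolding indep_vars_def2 by auto
  define B where "B f = (\<Inter>j\<in>{..<m}. L j -` {f j} \<inter> space M)" for f
  have Bm: "B f \<in> events" for f
    unfolding B_def using m Lm by (intro sets.finite_INT) (auto intro: measurable_sets)
  have eq: "{\<omega>\<in>space M. (\<lambda>j\<in>{..<m}. L j \<omega>) \<in> A} = (\<Union>f\<in>A. B f)"
  proof (intro equalityI subsetI)
    fix \<omega> assume "\<omega> \<in> (\<Union>f\<in>A. B f)"
    then obtain f where f: "f \<in> A" "\<omega> \<in> B f" by auto
    have "(\<lambda>j\<in>{..<m}. L j \<omega>) = f"
    proof (rule ext)
      fix j show "(\<lambda>j\<in>{..<m}. L j \<omega>) j = f j"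
      proof (cases "j < m")
        case True
        then have "\<omega> \<in> L j -` {f j} \<inter> space M" using f(2) unfolding B_def by blast
        then show ?thesis using True by simp
      next
        case False
        then show ?thesis using subsetD[OF A f(1)] by (auto simp: PiE_def extensional_def)
      qed
    qed
    moreover have "\<omega> \<in> space M" using f(2) m unfolding B_def by blast
    ultimately show "\<omega> \<in> {\<omega>\<in>space M. (\<lambda>j\<in>{..<m}. L j \<omega>) \<in> A}" using f(1) by simp
  next
    fix \<omega> assume "\<omega> \<in> {\<omega>\<in>space M. (\<lambda>j\<in>{..<m}. L j \<omega>) \<in> A}"
    then have "(\<lambda>j\<in>{..<m}. L j \<omega>) \<in> A" "\<omega> \<in> B (\<lambda>j\<in>{..<m}. L j \<omega>)" by (auto simp: B_def)
    then show "\<omega> \<in> (\<Union>f\<in>A. B f)" by blast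
  qed
  show "{\<omega>\<in>space M. (\<lambda>j\<in>{..<m}. L j \<omega>) \<in> A} \<in> events"
    unfolding eq using finA Bm by auto
  have "prob (B f) = 1 / real (2 * N) ^ m" if f: "f \<in> A" for f
  proof -
    have "prob (B f) = (\<Prod>j\<in>{..<m}. prob (L j -` {f j} \<inter> space M))"
      unfolding B_def using m by (intro indep_varsD[OF L]) auto
    also have "\<dots> = (\<Prod>j\<in>{..<m}. 1 / real (2 * N))"
    proof (rule prod.cong[OF refl])
      fix j assume j: "j \<in> {..<m}"
      have "L j -` {f j} \<inter> space M = {\<omega>\<in>space M. L j \<omega> = f j}" by auto
      moreover have "f j < 2 * N" using f A j by auto
      ultimately show "prob (L j -` {f j} \<inter> space M) = 1 / real (2 * N)" using unif j by simp
    qed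
    finally show ?thesis by (simp add: power_one_over)
  qed
  then have "(\<Sum>f\<in>A. prob (B f)) = real (card A) / real (2 * N) ^ m" by simp
  moreover have "prob (\<Union>f\<in>A. B f) \<le> (\<Sum>f\<in>A. prob (B f))"
    using finA Bm by (intro finite_measure_subadditive_finite) auto
  ultimately show "prob {\<omega>\<in>space M. (\<lambda>j\<in>{..<m}. L j \<omega>) \<in> A} \<le> real (card A) / real (2 * N) ^ m"
    unfolding eq by simp
qed

lemma uniform_labels_half:
  assumes L: "indep_vars (\<lambda>_. count_space UNIV) L {..<m}" and N: "N > 0"
    and range: "\<And>j \<omega>. j < m \<Longrightarrow> \<omega> \<in> space M \<Longrightarrow> L j \<omega> < 2 * N"
    and unif: "\<And>j l. j < m \<Longrightarrow> l < 2 * N \<Longrightarrow> prob {\<omega>\<in>space M. L j \<omega> = l} = 1 / real (2 * N)"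
    and m: "m > 0" and s: "s \<ge> 0"
  obtains E where "E \<in> events" "prob E \<le> 2 * exp (- (m * s\<^sup>2 / 2))"
    "\<And>\<omega> i. \<omega> \<in> space M - E \<Longrightarrow> i \<le> N \<Longrightarrow> \<bar>discrepancy N m (\<lambda>j. L j \<omega>) i\<bar> < s"
proof -
  define A where "A \<sigma> = {f\<in>labellings N m. \<exists>i\<le>N. \<sigma> * excess N m f i \<ge> m * s}" for \<sigma> :: real
  define E where "E \<sigma> = {\<omega>\<in>space M. (\<lambda>j\<in>{..<m}. L j \<omega>) \<in> A \<sigma>}" for \<sigma>
  have sub: "A \<sigma> \<subseteq> labellings N m" for \<sigma> by (auto simp: A_def)
  have Em: "E \<sigma> \<in> events" for \<sigma>
    unfolding E_def by (rule uniform_labels_prob_le(1)[OF L N range unif sub m])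
  have Ep: "prob (E \<sigma>) \<le> exp (- (m * s\<^sup>2 / 2))" if "\<bar>\<sigma>\<bar> = 1" for \<sigma>
  proof -
    have "prob (E \<sigma>) \<le> real (card (A \<sigma>)) / real (2 * N) ^ m"
      unfolding E_def by (rule uniform_labels_prob_le(2)[OF L N range unif sub m])
    also have "\<dots> \<le> (real (2 * N) ^ m * exp (- (m * s\<^sup>2 / 2))) / real (2 * N) ^ m"
      using excess_maximal[OF N s that, of m] by (intro divide_right_mono) (auto simp: A_def)
    also have "\<dots> = exp (- (m * s\<^sup>2 / 2))" using N by simp
    finally show ?thesis .
  qed
  show ?thesis
  proof (rule that[of "E 1 \<union> E (- 1)"])
    show "E 1 \<union> E (- 1) \<in> events" using Em by auto
    have "prob (E 1 \<union> E (- 1)) \<le> prob (E 1) + prob (E (- 1))" by (intro measure_Un_le Em)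
    then show "prob (E 1 \<union> E (- 1)) \<le> 2 * exp (- (m * s\<^sup>2 / 2))" using Ep[of 1] Ep[of "-1"] by simp
    fix \<omega> i assume \<omega>: "\<omega> \<in> space M - (E 1 \<union> E (- 1))" and i: "i \<le> N"
    define f where "f = (\<lambda>j\<in>{..<m}. L j \<omega>)"
    have f: "f \<in> labellings N m" using range \<omega> by (auto simp: f_def)
    have notA: "f \<notin> A 1" "f \<notin> A (- 1)" using \<omega> by (simp_all add: E_def f_def)
    have "\<not> (\<sigma> * excess N m f i \<ge> m * s)" if "f \<notin> A \<sigma>" for \<sigma>
      using that f i unfolding A_def by blast
    from this[OF notA(1)] this[OF notA(2)]
    have "\<not> (1 * excess N m f i \<ge> m * s)" "\<not> (- 1 * excess N m f i \<ge> m * s)" .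
    then have "\<bar>excess N m f i\<bar> < m * s" by linarith
    then have "\<bar>excess N m f i\<bar> / m < s" using m by (simp add: divide_less_eq mult.commute)
    moreover have "discrepancy N m (\<lambda>j. L j \<omega>) i = discrepancy N m f i"
      unfolding discrepancy_def f_def by (auto intro!: arg_cong[where f=card])
    ultimately show "\<bar>discrepancy N m (\<lambda>j. L j \<omega>) i\<bar> < s"
      using discrepancy_le_excess[OF m N i, of f] by linarith
  qed
qed

text \<open>
  The second half of the indices is the first half for the reversed labels, so the factor
  \<open>1 - i / (2 * N)\<close> in \<open>excess\<close> never falls below \<open>1 / 2\<close>. The constant \<open>4\<close> counts two halves and
  two signs.
\<close>

lemma uniform_labels_discrepancy:
  assumes L: "indep_vars (\<lambda>_. count_space UNIV) L {..<m}" and N: "N > 0"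
    and range: "\<And>j \<omega>. j < m \<Longrightarrow> \<omega> \<in> space M \<Longrightarrow> L j \<omega> < 2 * N"
    and unif: "\<And>j l. j < m \<Longrightarrow> l < 2 * N \<Longrightarrow> prob {\<omega>\<in>space M. L j \<omega> = l} = 1 / real (2 * N)"
    and m: "m > 0" and s: "s \<ge> 0"
  obtains E where "E \<in> events" "prob E \<le> 4 * exp (- (m * s\<^sup>2 / 2))"
    "\<And>\<omega> i. \<omega> \<in> space M - E \<Longrightarrow> i \<le> 2 * N \<Longrightarrow> \<bar>discrepancy N m (\<lambda>j. L j \<omega>) i\<bar> < s"
proof -
  obtain E1 where E1: "E1 \<in> events" "prob E1 \<le> 2 * exp (- (m * s\<^sup>2 / 2))"
    "\<And>\<omega> i. \<omega> \<in> space M - E1 \<Longrightarrow> i \<le> N \<Longrightarrow> \<bar>discrepancy N m (\<lambda>j. L j \<omega>) i\<bar> < s"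
    by (rule uniform_labels_half[OF L N range unif m s]) blast+
  define L' where "L' j \<omega> = 2 * N - 1 - L j \<omega>" for j \<omega>
  have L': "indep_vars (\<lambda>_. count_space UNIV) L' {..<m}"
    unfolding L'_def[abs_def] using L by (rule indep_vars_compose2) auto
  have range': "L' j \<omega> < 2 * N" for j \<omega> using N by (simp add: L'_def)
  have unif': "prob {\<omega>\<in>space M. L' j \<omega> = l} = 1 / real (2 * N)" if "j < m" "l < 2 * N" for j l
  proof -
    have "{\<omega>\<in>space M. L' j \<omega> = l} = {\<omega>\<in>space M. L j \<omega> = 2 * N - 1 - l}"
      using range[OF that(1)] that(2) by (force simp: L'_def)
    then show ?thesis using unif[of j "2 * N - 1 - l"] that N by simp
  qed
  obtain E2 where E2: "E2 \<in> events" "prob E2 \<le> 2 * exp (- (m * s\<^sup>2 / 2))"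
    "\<And>\<omega> i. \<omega> \<in> space M - E2 \<Longrightarrow> i \<le> N \<Longrightarrow> \<bar>discrepancy N m (\<lambda>j. L' j \<omega>) i\<bar> < s"
    by (rule uniform_labels_half[OF L' N range' unif' m s]) blast+
  show ?thesis
  proof (rule that[of "E1 \<union> E2"])
    show "E1 \<union> E2 \<in> events" using E1 E2 by auto
    show "prob (E1 \<union> E2) \<le> 4 * exp (- (m * s\<^sup>2 / 2))"
      using measure_Un_le[OF E1(1) E2(1)] E1(2) E2(2) by linarith
    fix \<omega> i assume \<omega>: "\<omega> \<in> space M - (E1 \<union> E2)" and i: "i \<le> 2 * N"
    show "\<bar>discrepancy N m (\<lambda>j. L j \<omega>) i\<bar> < s"
    proof (cases "i \<le> N")
      case False
      have "discrepancy N m (\<lambda>j. L' j \<omega>) (2 * N - i) = - discrepancy N m (\<lambda>j. L j \<omega>) i"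
        unfolding L'_def by (rule discrepancy_reverse[OF m N i]) (use range \<omega> in auto)
      moreover have "\<bar>discrepancy N m (\<lambda>j. L' j \<omega>) (2 * N - i)\<bar> < s"
        using E2(3)[of \<omega> "2 * N - i"] \<omega> False by auto
      ultimately show ?thesis by simp
    qed (use E1(3) \<omega> in auto)
  qed
qed

end

section \<open>Summation by parts against the discrepancy\<close>

lemma summation_by_parts:
  fixes c F :: "nat \<Rightarrow> real"
  assumes "F 0 = 0"
  shows "(\<Sum>i<Suc n. c i * (F (Suc i) - F i)) = c n * F (Suc n) + (\<Sum>i<n. (c i - c (Suc i)) * F (Suc i))"
  using assms by (induction n) (auto simp: algebra_simps)

text \<open>
  Summation by parts turns the sum of \<open>c\<close> against the increments of the discrepancy into a sum of the
  discrepancy against the increments of \<open>c\<close>; the boundary terms vanish.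
\<close>

lemma discrepancy_sum_bound:
  fixes c :: "nat \<Rightarrow> real" and \<Delta> V :: real
  assumes m: "m > 0" and N: "N > 0" and f: "\<And>j. j < m \<Longrightarrow> f j < 2 * N"
    and \<Delta>: "\<And>i. i \<le> 2 * N \<Longrightarrow> \<bar>discrepancy N m f i\<bar> \<le> \<Delta>"
    and V: "(\<Sum>i<2 * N - 1. \<bar>c i - c (Suc i)\<bar>) \<le> V"
  shows "\<bar>(\<Sum>j<m. c (f j)) / m - (\<Sum>i<2 * N. c i) / real (2 * N)\<bar> \<le> \<Delta> * V"
    and "\<And>i. i < 2 * N \<Longrightarrow> real (card {j. j < m \<and> f j = i}) / m \<le> 2 * \<Delta> + 1 / real (2 * N)"
proof -
  define F where "F = discrepancy N m f"
  have step: "F (Suc i) - F i = real (card {j. j < m \<and> f j = i}) / m - 1 / real (2 * N)" for i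
  proof -
    have "{j. j < m \<and> f j < Suc i} = {j. j < m \<and> f j < i} \<union> {j. j < m \<and> f j = i}" by auto
    then have "card {j. j < m \<and> f j < Suc i} = card {j. j < m \<and> f j < i} + card {j. j < m \<and> f j = i}"
      by (simp only:) (rule card_Un_disjoint, auto)
    then show ?thesis by (simp add: F_def discrepancy_def add_divide_distrib)
  qed
  have F0: "F 0 = 0" by (simp add: F_def discrepancy_def)
  have "{j. j < m \<and> f j < 2 * N} = {..<m}" using f by auto
  then have Fn: "F (2 * N) = 0" using m N by (simp add: F_def discrepancy_def)
  have \<Delta>0: "\<Delta> \<ge> 0" using \<Delta>[of 0] by simp
  have "(\<Sum>j<m. c (f j)) = (\<Sum>i<2 * N. \<Sum>j\<in>{j\<in>{..<m}. f j = i}. c (f j))"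
    by (rule sum.group[symmetric]) (use f in auto)
  also have "\<dots> = (\<Sum>i<2 * N. real (card {j. j < m \<and> f j = i}) * c i)"
    by (intro sum.cong refl) (auto intro!: arg_cong[where f=card])
  finally have s1: "(\<Sum>j<m. c (f j)) / m = (\<Sum>i<2 * N. c i * (real (card {j. j < m \<and> f j = i}) / m))"
    by (simp only:) (simp add: sum_divide_distrib mult.commute)
  have s2: "(\<Sum>i<2 * N. c i) / real (2 * N) = (\<Sum>i<2 * N. c i * (1 / real (2 * N)))"
    by (simp add: sum_divide_distrib)
  have "(\<Sum>j<m. c (f j)) / m - (\<Sum>i<2 * N. c i) / real (2 * N)
      = (\<Sum>i<2 * N. c i * (F (Suc i) - F i))"
    unfolding s1 s2 step sum_subtractf[symmetric] right_diff_distrib ..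
  also have "\<dots> = (\<Sum>i<2 * N - 1. (c i - c (Suc i)) * F (Suc i))"
    using summation_by_parts[of F c "2 * N - 1"] F0 Fn N by simp
  also have "\<bar>\<dots>\<bar> \<le> (\<Sum>i<2 * N - 1. \<bar>c i - c (Suc i)\<bar> * \<Delta>)"
    using \<Delta> by (intro order_trans[OF sum_abs] sum_mono) (auto simp: abs_mult F_def intro!: mult_left_mono)
  also have "\<dots> \<le> V * \<Delta>"
    unfolding sum_distrib_right[symmetric] using V \<Delta>0 by (rule mult_right_mono)
  finally show "\<bar>(\<Sum>j<m. c (f j)) / m - (\<Sum>i<2 * N. c i) / real (2 * N)\<bar> \<le> \<Delta> * V"
    by (simp add: mult.commute)
  show "real (card {j. j < m \<and> f j = i}) / m \<le> 2 * \<Delta> + 1 / real (2 * N)" if "i < 2 * N" for i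
    using step[of i] \<Delta>[of i] \<Delta>[of "Suc i"] that by (simp add: F_def)
qed

section \<open>Half-circle sign patterns\<close>

definition cell :: "nat \<Rightarrow> real \<Rightarrow> nat"
  where "cell N t = nat \<lfloor>t * real (2 * N) / pi\<rfloor>"

lemma cell_bounds:
  assumes N: "N > 0" and t: "0 \<le> t" "t < pi"
  shows "pi * cell N t / real (2 * N) \<le> t" "t < pi * (cell N t + 1) / real (2 * N)" "cell N t < 2 * N"
proof -
  have n0: "0 \<le> t * real (2 * N) / pi" using t by simp
  then have c: "real (cell N t) \<le> t * real (2 * N) / pi" "t * real (2 * N) / pi < real (cell N t) + 1"
    by (simp_all add: cell_def)
  show "pi * cell N t / real (2 * N) \<le> t" "t < pi * (cell N t + 1) / real (2 * N)"
    using c N by (simp_all add: field_simps)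
  have "t * real (2 * N) / pi < real (2 * N)" using t N by (simp add: field_simps)
  then show "cell N t < 2 * N" using c(1) by linarith
qed

lemma cell_mono: "0 \<le> s \<Longrightarrow> s \<le> t \<Longrightarrow> cell N s \<le> cell N t"
  unfolding cell_def by (intro nat_mono floor_mono divide_right_mono mult_right_mono) auto

text \<open>
  Shifting the zero of the cosine into \<open>[0, pi)\<close> by a multiple of \<open>pi\<close>.
\<close>

lemma cos_phase:
  fixes \<xi> :: real
  obtains t0 \<sigma> where "0 \<le> t0" "t0 < pi" "\<sigma> = 1 \<or> \<sigma> = - 1" "\<And>t. cos (t - \<xi>) = \<sigma> * sin (t0 - t)"
proof -
  define k where "k = \<lfloor>(\<xi> + pi / 2) / pi\<rfloor>"
  define t0 where "t0 = \<xi> + pi / 2 - of_int k * pi"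
  have "of_int k \<le> (\<xi> + pi / 2) / pi" "(\<xi> + pi / 2) / pi < of_int k + 1" by (auto simp: k_def)
  then have t0: "0 \<le> t0" "t0 < pi" by (auto simp: t0_def field_simps)
  have sc: "sin (of_int k * pi) = 0" "cos (of_int k * pi) = 1 \<or> cos (of_int k * pi) = - 1"
  proof -
    show s: "sin (of_int k * pi) = 0" using sin_int_times_real[of k 1] by (metis sin_zero_iff_int2)
    have "(cos (of_int k * pi))\<^sup>2 = 1" using sin_cos_squared_add[of "of_int k * pi"] s by simp
    then show "cos (of_int k * pi) = 1 \<or> cos (of_int k * pi) = - 1" by (simp add: power2_eq_1_iff)
  qed
  have "cos (t - \<xi>) = cos (of_int k * pi) * sin (t0 - t)" for t
  proof -
    have "t0 - t = pi / 2 - (t - \<xi>) - of_int k * pi" by (simp add: t0_def)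
    then have "sin (t0 - t) = cos (t - \<xi>) * cos (of_int k * pi)"
      by (simp only: sin_diff[of "pi / 2 - (t - \<xi>)"] sc(1)) (simp add: sin_cos_eq[symmetric] cos_sin_eq)
    then show ?thesis using sc(2) by auto
  qed
  then show ?thesis using that[of t0 "cos (of_int k * pi)"] t0 sc(2) by blast
qed

lemma abs_cos_diff_le: "\<bar>cos x - cos y\<bar> \<le> \<bar>x - y\<bar>" for x y :: real
proof -
  have "\<bar>cos x - cos y\<bar> = 2 * (\<bar>sin ((x + y) / 2)\<bar> * \<bar>sin ((y - x) / 2)\<bar>)"
    by (simp add: cos_diff_cos abs_mult)
  also have "\<dots> \<le> 2 * (1 * \<bar>(y - x) / 2\<bar>)"
    by (intro mult_left_mono mult_mono abs_sin_x_le_abs_x) auto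
  finally show ?thesis by (simp add: abs_minus_commute)
qed

text \<open>
  On a half circle the sign of \<open>cos (t - \<xi>)\<close> changes once. Up to the cell in which this happens,
  the product of the sign and \<open>cos (t - \<zeta>)\<close> is close to a step function of total variation at
  most \<open>pi + 2\<close>: the steps of the cosine contribute at most \<open>pi\<close>, and putting the value \<open>0\<close> in the
  exceptional cell splits the jump in two, each at most \<open>1\<close>.
\<close>

lemma step_approximation:
  fixes \<xi> \<zeta> :: real
  assumes N: "N > 0"
  obtains c :: "nat \<Rightarrow> real" and k where
    "(\<Sum>i<2 * N - 1. \<bar>c i - c (Suc i)\<bar>) \<le> pi + 2" "k < 2 * N"
    "\<forall>t s. 0 \<le> t \<longrightarrow> t < pi \<longrightarrow> \<bar>s\<bar> \<le> 1 \<longrightarrow> (cos (t - \<xi>) \<noteq> 0 \<longrightarrow> s = sgn (cos (t - \<xi>))) \<longrightarrow>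
       \<bar>s * cos (t - \<zeta>) - c (cell N t)\<bar> \<le> pi / real (2 * N) + of_bool (cell N t = k)"
proof -
  obtain t0 \<sigma> where t0: "0 \<le> t0" "t0 < pi" and \<sigma>: "\<sigma> = 1 \<or> \<sigma> = - 1"
    and cs: "\<And>t. cos (t - \<xi>) = \<sigma> * sin (t0 - t)" using cos_phase[of \<xi>] by metis
  define k where "k = cell N t0"
  define g where "g i = cos (pi * real i / real (2 * N) - \<zeta>)" for i :: nat
  define c where "c i = (if i < k then \<sigma> else if i = k then 0 else - \<sigma>) * g i" for i
  let ?h = "pi / real (2 * N)"
  have h0: "?h \<ge> 0" by simp
  have kN: "k < 2 * N" unfolding k_def by (rule cell_bounds(3)[OF N t0])
  have gstep: "\<bar>g i - g (Suc i)\<bar> \<le> ?h" for i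
    using abs_cos_diff_le[of "pi * real i / real (2 * N) - \<zeta>" "pi * real (Suc i) / real (2 * N) - \<zeta>"]
    by (simp add: g_def field_simps flip: diff_divide_distrib)
  have g1: "\<bar>g i\<bar> \<le> 1" for i by (simp add: g_def)
  have cstep: "\<bar>c i - c (Suc i)\<bar> \<le> ?h + of_bool (i = k) + of_bool (Suc i = k)" for i
  proof (cases "i = k \<or> Suc i = k")
    case True
    have "\<bar>c i - c (Suc i)\<bar> \<le> 1"
      using True \<sigma> g1[of i] g1[of "Suc i"] by (auto simp: c_def abs_mult)
    moreover have "(1::real) \<le> of_bool (i = k) + of_bool (Suc i = k)" using True by auto
    ultimately show ?thesis using h0 by linarith
  next
    case False
    then have "c i - c (Suc i) = (if i < k then \<sigma> else - \<sigma>) * (g i - g (Suc i))"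
      by (auto simp: c_def algebra_simps)
    then have "\<bar>c i - c (Suc i)\<bar> = \<bar>g i - g (Suc i)\<bar>" using \<sigma> by (auto simp: abs_mult)
    then show ?thesis using gstep[of i] False by simp
  qed
  have "(\<Sum>i<2 * N - 1. \<bar>c i - c (Suc i)\<bar>)
      \<le> (\<Sum>i<2 * N - 1. ?h + of_bool (i = k) + of_bool (Suc i = k))"
    by (intro sum_mono cstep)
  also have "\<dots> = real (2 * N - 1) * ?h + (\<Sum>i<2 * N - 1. of_bool (i = k)) + (\<Sum>i<2 * N - 1. of_bool (Suc i = k))"
    by (simp add: sum.distrib)
  also have "\<dots> \<le> real (2 * N) * ?h + 1 + 1"
  proof (intro add_mono mult_right_mono h0)
    have one: "(\<Sum>i<n. of_bool (i = l) :: real) \<le> 1" for n l :: nat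
      by (simp add: of_bool_def)
    show "(\<Sum>i<2 * N - 1. of_bool (i = k) :: real) \<le> 1" by (rule one)
    have "(\<Sum>i<2 * N - 1. of_bool (Suc i = k) :: real) \<le> (\<Sum>i<2 * N - 1. of_bool (i = k - 1))"
      by (intro sum_mono) auto
    also have "\<dots> \<le> 1" by (rule one)
    finally show "(\<Sum>i<2 * N - 1. of_bool (Suc i = k) :: real) \<le> 1" .
  qed simp
  also have "real (2 * N) * ?h + 1 + 1 = pi + 2" using N by simp
  finally have var: "(\<Sum>i<2 * N - 1. \<bar>c i - c (Suc i)\<bar>) \<le> pi + 2" .
  have approx: "\<bar>s * cos (t - \<zeta>) - c (cell N t)\<bar> \<le> ?h + of_bool (cell N t = k)"
    if t: "0 \<le> t" "t < pi" and s: "\<bar>s\<bar> \<le> 1" "cos (t - \<xi>) \<noteq> 0 \<Longrightarrow> s = sgn (cos (t - \<xi>))" for t s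
  proof (cases "cell N t = k")
    case True
    have "\<bar>s * cos (t - \<zeta>)\<bar> \<le> 1 * 1" unfolding abs_mult using s(1) by (intro mult_mono) auto
    then have "\<bar>s * cos (t - \<zeta>) - c (cell N t)\<bar> \<le> 1" using True by (simp add: c_def)
    moreover have "of_bool (cell N t = k) = (1::real)" using True by simp
    ultimately show ?thesis using h0 by linarith
  next
    case False
    define \<tau> where "\<tau> = (if cell N t < k then \<sigma> else - \<sigma>)"
    have "s = \<tau>"
    proof (cases "t < t0")
      case True
      then have "cell N t < k" using cell_mono[of t t0 N] t False by (simp add: k_def)
      moreover have "sin (t0 - t) > 0" using True t t0 by (intro sin_gt_zero) auto
      ultimately show ?thesis using s(2) \<sigma> cs[of t] by (auto simp: \<tau>_def)
    next
      case False
      then have "\<not> cell N t < k" using cell_mono[of t0 t N] t0 by (simp add: k_def)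
      moreover have "t \<noteq> t0" using \<open>cell N t \<noteq> k\<close> by (auto simp: k_def)
      then have "sin (t - t0) > 0" using False t t0 by (intro sin_gt_zero) auto
      then have "sin (t0 - t) < 0" using sin_minus[of "t - t0"] by simp
      ultimately show ?thesis using s(2) \<sigma> cs[of t] by (auto simp: \<tau>_def)
    qed
    moreover have "c (cell N t) = \<tau> * g (cell N t)" using False by (simp add: c_def \<tau>_def)
    ultimately have "\<bar>s * cos (t - \<zeta>) - c (cell N t)\<bar> = \<bar>cos (t - \<zeta>) - g (cell N t)\<bar>"
      using \<sigma> by (auto simp: \<tau>_def abs_minus_commute split: if_splits)
    also have "\<dots> \<le> \<bar>t - pi * cell N t / real (2 * N)\<bar>"
      using abs_cos_diff_le[of "t - \<zeta>" "pi * real (cell N t) / real (2 * N) - \<zeta>"] by (simp add: g_def)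
    also have "\<dots> \<le> ?h"
      using cell_bounds(1,2)[OF N t] by (simp add: distrib_left add_divide_distrib)
    finally show ?thesis using False by simp
  qed
  show ?thesis by (rule that[OF var kN]) (use approx in blast)
qed

section \<open>Projections onto lines of the real plane\<close>

lemma borel_measurable_Arg2pi [measurable]: "Arg2pi \<in> borel_measurable borel"
proof -
  have "Arg2pi = (\<lambda>z. indicator (UNIV - \<real>\<^sub>\<ge>\<^sub>0) z *\<^sub>R Arg2pi z)"
    by (auto simp: fun_eq_iff indicator_def Arg2pi_eq_0 complex_nonneg_Reals_iff complex_is_Real_iff)
  moreover have "(\<lambda>z. indicator (UNIV - \<real>\<^sub>\<ge>\<^sub>0) z *\<^sub>R Arg2pi z) \<in> borel_measurable borel"
    by (rule borel_measurable_continuous_on_indicator)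
       (auto intro!: continuous_at_imp_continuous_on continuous_at_Arg2pi)
  ultimately show ?thesis by simp
qed

lemma of_real_rc_re:
  fixes z :: "'a::real_or_complex"
  assumes "DIM('a) = 1"
  shows "of_real (rc_re z) = z"
proof -
  have "UNIV \<subseteq> span {1::'a}"
    by (rule card_ge_dim_independent) (use assms in \<open>auto simp: dim_UNIV\<close>)
  then obtain r where "z = r *\<^sub>R 1" by (auto simp: span_singleton)
  then show ?thesis by (simp add: rc_re_def of_real_def)
qed

lemma norm_cip_real:
  fixes x y :: "'a::real_or_complex^'d"
  assumes "DIM('a) = 1"
  shows "norm (cip x y) = \<bar>x \<bullet> y\<bar>"
  by (metis norm_of_real of_real_rc_re[OF assms] rc_re_cip)

text \<open>
  The scalar field is \<open>\<real>\<close>, and \<open>e\<close>, \<open>e'\<close> are orthonormal coordinates of the plane.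
\<close>

locale real_plane =
  fixes e e' :: "'a::real_or_complex^'d"
  assumes DIM1: "DIM('a) = 1" and e: "norm e = 1" "norm e' = 1" "e \<bullet> e' = 0"
    and span: "\<And>x. x = (x \<bullet> e) *\<^sub>R e + (x \<bullet> e') *\<^sub>R e'"
begin

lemma inner_e: "e \<bullet> e = 1" "e' \<bullet> e' = 1" "e' \<bullet> e = 0"
  using e by (simp_all add: norm_eq_1 inner_commute)

definition dir :: "real \<Rightarrow> 'a^'d" where "dir \<theta> = cos \<theta> *\<^sub>R e + sin \<theta> *\<^sub>R e'"

lemma inner_dir: "dir \<theta> \<bullet> dir \<phi> = cos (\<theta> - \<phi>)"
  by (simp add: dir_def inner_simps inner_e e cos_diff)

lemma norm_dir [simp]: "norm (dir \<theta>) = 1"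
  using inner_dir[of \<theta> \<theta>] by (simp add: norm_eq_1)

lemma dir_exists:
  assumes x: "norm x = 1"
  obtains \<theta> where "x = dir \<theta>"
proof -
  have "(x \<bullet> e)\<^sup>2 + (x \<bullet> e')\<^sup>2 = x \<bullet> x"
    by (subst (3 4) span[of x]) (simp add: inner_simps inner_e e power2_eq_square inner_commute)
  then have "(x \<bullet> e)\<^sup>2 + (x \<bullet> e')\<^sup>2 = 1" using x by (simp add: norm_eq_1)
  then obtain \<theta> where "x \<bullet> e = cos \<theta>" "x \<bullet> e' = sin \<theta>" by (rule sincos_total_2pi)
  then show ?thesis using that[of \<theta>] span[of x] by (simp add: dir_def)
qed

lemma qf_outer: "qf (outer p) y = (p \<bullet> y)\<^sup>2" for p y :: "'a^'d"
  by (simp add: qf_def inner_outer norm_cip_real[OF DIM1])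

text \<open>
  Doubling the angle of a line identifies opposite directions, and squaring once more identifies a line
  with its orthogonal complement.
\<close>

definition turn :: "'a^'d^'d \<Rightarrow> complex"
  where "turn P = (Complex (qf P e - qf P e') (qf P (e + e') - qf P e - qf P e'))\<^sup>2"

lemma turn_dir: "turn (outer (dir \<theta>)) = (cis (2 * \<theta>))\<^sup>2"
proof -
  have c: "dir \<theta> \<bullet> e = cos \<theta>" "dir \<theta> \<bullet> e' = sin \<theta>" by (simp_all add: dir_def inner_simps inner_e e)
  have "Complex (qf (outer (dir \<theta>)) e - qf (outer (dir \<theta>)) e')
      (qf (outer (dir \<theta>)) (e + e') - qf (outer (dir \<theta>)) e - qf (outer (dir \<theta>)) e') = cis (2 * \<theta>)"
    unfolding complex_eq_iff complex.sel cis.sel qf_outer inner_add_right c cos_double sin_double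
    by (simp add: power2_eq_square algebra_simps)
  then show ?thesis by (simp add: turn_def)
qed

lemma Proj_dir:
  assumes "P \<in> Proj 1"
  obtains \<theta> where "P = outer (dir \<theta>)"
proof -
  obtain x where "P = outer x" "norm x = 1" using assms unfolding Proj_1_eq by blast
  then show ?thesis using dir_exists[of x] that by metis
qed

text \<open>
  The reflection maps the angle \<open>\<theta>\<close> of a line to \<open>2 * \<alpha> - \<theta>\<close>, up to multiples of \<open>pi\<close>.
\<close>

lemma turn_householder:
  assumes "P \<in> Proj 1"
  shows "turn (householder (dir \<alpha>) ** P ** householder (dir \<alpha>)) = cis (8 * \<alpha>) * cnj (turn P)"
proof -
  obtain \<theta> where P: "P = outer (dir \<theta>)" by (rule Proj_dir[OF assms])
  have "cip (dir \<alpha>) (dir \<theta>) = of_real (cos (\<alpha> - \<theta>))"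
    by (metis inner_dir of_real_rc_re[OF DIM1] rc_re_cip)
  then have "householder (dir \<alpha>) *v dir \<theta> = dir \<theta> - (2 * cos (\<alpha> - \<theta>)) *\<^sub>R dir \<alpha>"
    unfolding householder_mult scaleR_eq_smult by simp
  also have "\<dots> = dir (2 * \<alpha> - \<theta> + pi)"
  proof -
    have "cos \<theta> - 2 * cos (\<alpha> - \<theta>) * cos \<alpha> = - cos (2 * \<alpha> - \<theta>)"
      using cos_add[of \<alpha> "\<alpha> - \<theta>"] cos_diff[of \<alpha> "\<alpha> - \<theta>"] by simp
    moreover have "sin \<theta> - 2 * cos (\<alpha> - \<theta>) * sin \<alpha> = - sin (2 * \<alpha> - \<theta>)"
      using sin_add[of \<alpha> "\<alpha> - \<theta>"] sin_diff[of \<alpha> "\<alpha> - \<theta>"] by simp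
    moreover have "dir \<theta> - (2 * cos (\<alpha> - \<theta>)) *\<^sub>R dir \<alpha>
        = (cos \<theta> - 2 * cos (\<alpha> - \<theta>) * cos \<alpha>) *\<^sub>R e + (sin \<theta> - 2 * cos (\<alpha> - \<theta>) * sin \<alpha>) *\<^sub>R e'"
      by (simp add: dir_def algebra_simps)
    ultimately show ?thesis by (simp add: dir_def)
  qed
  finally have h: "householder (dir \<alpha>) *v dir \<theta> = dir (2 * \<alpha> - \<theta> + pi)" .
  have "householder (dir \<alpha>) ** P ** householder (dir \<alpha>) = outer (householder (dir \<alpha>) *v dir \<theta>)"
    unfolding matrix_eq P
    by (simp add: matrix_vector_mul_assoc[symmetric] outer_mult matrix_smult_vector
        cip_matrix ctranspose_householder)
  then have "turn (householder (dir \<alpha>) ** P ** householder (dir \<alpha>)) = (cis (2 * (2 * \<alpha> - \<theta> + pi)))\<^sup>2"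
    unfolding h by (simp add: turn_dir)
  also have "cis (2 * (2 * \<alpha> - \<theta> + pi)) = cis (4 * \<alpha> - 2 * \<theta>)"
  proof -
    have "2 * (2 * \<alpha> - \<theta> + pi) = (4 * \<alpha> - 2 * \<theta>) + 2 * pi" by simp
    then show ?thesis by (simp only: complex_eq_iff cis.sel cos_periodic sin_periodic simp_thms)
  qed
  also have "(cis (4 * \<alpha> - 2 * \<theta>))\<^sup>2 = cis (8 * \<alpha>) * cnj (turn P)"
    unfolding P turn_dir power2_eq_square complex_cnj_mult cis_cnj cis_mult
    by (rule arg_cong[of _ _ cis]) simp
  finally show ?thesis .
qed

definition label :: "nat \<Rightarrow> 'a^'d^'d \<Rightarrow> nat"
  where "label N P = cell N (Arg2pi (turn P) / 2)"

text \<open>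
  Replacing a line by its complement changes both the sign of the measurement and the quadratic form,
  so only the half angle \<open>t\<close> of \<open>turn\<close> matters. The value of \<open>s\<close> at a zero of the cosine is left
  open because it depends on which of the two lines occurs.
\<close>

lemma rform_sign:
  assumes P: "P \<in> Proj 1"
  defines "t \<equiv> Arg2pi (turn P) / 2"
  obtains s where "\<bar>s\<bar> \<le> 1" "cos (t - 2 * \<alpha>) \<noteq> 0 \<Longrightarrow> s = sgn (cos (t - 2 * \<alpha>))"
    "2 * rform P (dir \<alpha>) (dir \<gamma>) - 1 = s * cos (t - 2 * \<gamma>)"
proof -
  obtain \<theta> where Pd: "P = outer (dir \<theta>)" by (rule Proj_dir[OF P])
  have "turn P = cis (2 * t)"
    using Arg2pi_eq[of "turn P"] by (simp add: Pd turn_dir norm_power t_def cis_conv_exp mult.commute)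
  then have "(cis t)\<^sup>2 = (cis (2 * \<theta>))\<^sup>2" by (simp add: Pd turn_dir power2_eq_square cis_mult)
  then consider "cis t = cis (2 * \<theta>)" | "cis t = - cis (2 * \<theta>)" by (auto simp: power2_eq_iff)
  then have "\<exists>\<eta> :: real. (\<eta> = 1 \<or> \<eta> = - 1) \<and> cos (2 * \<theta>) = \<eta> * cos t \<and> sin (2 * \<theta>) = \<eta> * sin t"
  proof cases
    case 1
    then have "Re (cis t) = Re (cis (2 * \<theta>))" "Im (cis t) = Im (cis (2 * \<theta>))" by (simp_all only:)
    then show ?thesis by (intro exI[of _ 1]) simp
  next
    case 2
    then have "Re (cis t) = - Re (cis (2 * \<theta>))" "Im (cis t) = - Im (cis (2 * \<theta>))" by (simp_all only: uminus_complex.sel)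
    then show ?thesis by (intro exI[of _ "- 1"]) simp
  qed
  then obtain \<eta> :: real where \<eta>: "\<eta> = 1 \<or> \<eta> = - 1" and ct: "cos (2 * \<theta>) = \<eta> * cos t" "sin (2 * \<theta>) = \<eta> * sin t"
    by blast
  have cosd: "cos (2 * \<theta> - u) = \<eta> * cos (t - u)" for u
    by (simp only: cos_diff ct distrib_left mult.assoc)
  have sq: "(dir \<theta> \<bullet> dir u)\<^sup>2 = (1 + cos (2 * \<theta> - 2 * u)) / 2" for u
    using cos_double_cos[of "\<theta> - u"] by (simp add: inner_dir algebra_simps)
  define s where "s = \<eta> * (if \<eta> * cos (t - 2 * \<alpha>) \<ge> 0 then 1 else - 1)"
  have "2 * rform P (dir \<alpha>) (dir \<gamma>) - 1 = s * cos (t - 2 * \<gamma>)"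
    unfolding rform_def Pd qf_outer sq cosd s_def by (auto simp: field_simps)
  moreover have "s = sgn (cos (t - 2 * \<alpha>))" if "cos (t - 2 * \<alpha>) \<noteq> 0"
    using \<eta> that by (auto simp: s_def sgn_if)
  moreover have "\<bar>s\<bar> \<le> 1" using \<eta> by (auto simp: s_def)
  ultimately show ?thesis using that by blast
qed

lemma Arg2pi_half_bounds: "0 \<le> Arg2pi z / 2" "Arg2pi z / 2 < pi"
  using Arg2pi_ge_0[of z] Arg2pi_lt_2pi[of z] by auto

lemma measurable_turn [measurable]: "turn \<in> borel_measurable borel"
  unfolding turn_def[abs_def]
  by (intro borel_measurable_continuous_onI) (simp add: Complex_eq, intro continuous_intros)

lemma measurable_cell_Arg2pi: "(\<lambda>z. cell N (Arg2pi z / 2)) \<in> borel \<rightarrow>\<^sub>M count_space UNIV"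
  unfolding cell_def by measurable

lemma measurable_label: "label N \<in> borel \<rightarrow>\<^sub>M count_space UNIV"
  unfolding label_def[abs_def] using measurable_turn measurable_cell_Arg2pi by (rule measurable_compose)

text \<open>
  The rotation subtracts the left end of cell \<open>l\<close> from the angle. An angle below that end wraps around to
  at least \<open>2 * pi - pi * l / N\<close>, which is never in cell \<open>0\<close>.
\<close>

lemma cell_rotate:
  assumes N: "N > 0" and l: "l < 2 * N" and w: "norm w = 1"
  shows "cell N (Arg2pi (cis (- (pi * l / N)) * w) / 2) = 0 \<longleftrightarrow> cell N (Arg2pi w / 2) = l"
proof -
  define \<psi> where "\<psi> = Arg2pi w"
  define \<tau> where "\<tau> = pi * l / N"
  have w': "w = cis \<psi>" using Arg2pi_eq[of w] w by (simp add: \<psi>_def cis_conv_exp mult.commute)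
  have \<psi>: "0 \<le> \<psi>" "\<psi> < 2 * pi" using Arg2pi_ge_0[of w] Arg2pi_lt_2pi[of w] by (auto simp: \<psi>_def)
  have prod: "cis (- \<tau>) * w = cis (\<psi> - \<tau>)" by (simp add: w' cis_mult)
  have cb: "cell N (\<psi> / 2) = k \<longleftrightarrow> pi * k / N \<le> \<psi> \<and> \<psi> < pi * (k + 1) / N" if "0 \<le> \<psi>" for \<psi> and k :: nat
  proof -
    have "cell N (\<psi> / 2) = k \<longleftrightarrow> \<lfloor>\<psi> * real N / pi\<rfloor> = int k"
      using that by (auto simp: cell_def nat_eq_iff)
    also have "\<dots> \<longleftrightarrow> real k \<le> \<psi> * real N / pi \<and> \<psi> * real N / pi < real k + 1"
      by (simp add: floor_eq_iff)
    also have "\<dots> \<longleftrightarrow> pi * k / N \<le> \<psi> \<and> \<psi> < pi * (k + 1) / N"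
      using N by (simp add: field_simps)
    finally show ?thesis .
  qed
  have \<tau>: "\<tau> \<ge> 0" "\<tau> + pi / N \<le> 2 * pi"
  proof -
    have "real l + 1 \<le> 2 * real N" using l by linarith
    then have "pi * (real l + 1) \<le> pi * (2 * real N)" by (rule mult_left_mono) simp
    then show "\<tau> + pi / N \<le> 2 * pi" using N by (simp add: \<tau>_def field_simps)
  qed (simp add: \<tau>_def)
  have cbl: "cell N (\<psi> / 2) = l \<longleftrightarrow> \<tau> \<le> \<psi> \<and> \<psi> < \<tau> + pi / N"
    using cb[OF \<psi>(1), of l] by (simp add: \<tau>_def add_divide_distrib distrib_left add.commute)
  show ?thesis
  proof (cases "\<psi> \<ge> \<tau>")
    case True
    then have "Arg2pi (cis (\<psi> - \<tau>)) = \<psi> - \<tau>"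
      using \<psi> \<tau> by (intro Arg2pi_unique[of 1]) (auto simp: cis_conv_exp mult.commute)
    moreover have "cell N ((\<psi> - \<tau>) / 2) = 0 \<longleftrightarrow> \<psi> - \<tau> < pi / N"
      using cb[of "\<psi> - \<tau>" 0] True by simp
    ultimately show ?thesis
      unfolding \<tau>_def[symmetric] prod \<psi>_def[symmetric] using True cbl by auto
  next
    case False
    have "pi / N \<ge> 0" by simp
    then have nn: "0 \<le> \<psi> - \<tau> + 2 * pi" using \<psi> \<tau> by linarith
    have "cis (\<psi> - \<tau>) = cis (\<psi> - \<tau> + 2 * pi)" by (simp add: cis.code complex_eq_iff)
    then have "Arg2pi (cis (\<psi> - \<tau>)) = \<psi> - \<tau> + 2 * pi"
      using \<psi> \<tau> False nn
      by (intro Arg2pi_unique[of 1]) (auto simp: cis_conv_exp mult.commute)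
    moreover have "cell N ((\<psi> - \<tau> + 2 * pi) / 2) = 0 \<longleftrightarrow> \<psi> - \<tau> + 2 * pi < pi / N"
    proof -
      show ?thesis using cb[OF nn, of 0] nn by simp
    qed
    moreover have "\<not> \<psi> - \<tau> + 2 * pi < pi / N" using \<psi> \<tau> by linarith
    ultimately show ?thesis
      unfolding \<tau>_def[symmetric] prod \<psi>_def[symmetric] using False cbl by auto
  qed
qed

lemma norm_turn: "P \<in> Proj 1 \<Longrightarrow> norm (turn P) = 1"
  by (metis Proj_dir turn_dir norm_cis norm_power power_one)

text \<open>
  Two reflections compose to a rotation, so the law of \<open>turn\<close> is invariant under rotations, and these
  permute the cells.
\<close>

lemma label_uniform:
  assumes U: "uniform_projection 1 \<mu>" and N: "N > 0" and l: "l < 2 * N"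
  shows "measure \<mu> {P \<in> space \<mu>. label N P = l} = 1 / real (2 * N)"
proof -
  interpret U: uniform_projection 1 \<mu> by (rule U)
  have turn\<mu> [measurable]: "turn \<in> borel_measurable \<mu>"
    using measurable_compose[OF U.measurable_into_borel measurable_turn] by simp
  have lab\<mu> [measurable]: "label N \<in> \<mu> \<rightarrow>\<^sub>M count_space UNIV"
    using measurable_compose[OF U.measurable_into_borel measurable_label] by simp
  have dir0: "dir \<alpha> \<noteq> 0" for \<alpha> using norm_dir[of \<alpha>] by (metis norm_zero zero_neq_one)
  have mirror: "(\<integral>\<^sup>+P. g (cis (8 * \<alpha>) * cnj (turn P)) \<partial>\<mu>) = (\<integral>\<^sup>+P. g (turn P) \<partial>\<mu>)"
    if [measurable]: "g \<in> borel_measurable borel" for g :: "complex \<Rightarrow> ennreal" and \<alpha>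
  proof -
    have "(\<integral>\<^sup>+P. g (cis (8 * \<alpha>) * cnj (turn P)) \<partial>\<mu>)
        = (\<integral>\<^sup>+P. g (turn (householder (dir \<alpha>) ** P ** householder (dir \<alpha>))) \<partial>\<mu>)"
      by (rule nn_integral_cong) (simp add: U.space_\<mu> turn_householder)
    also have "\<dots> = (\<integral>\<^sup>+P. g (turn P) \<partial>\<mu>)"
      by (rule U.nn_integral_conj[OF dir0]) measurable
    finally show ?thesis .
  qed
  have rot: "(\<integral>\<^sup>+P. g (cis \<tau> * turn P) \<partial>\<mu>) = (\<integral>\<^sup>+P. g (turn P) \<partial>\<mu>)"
    if [measurable]: "g \<in> borel_measurable borel" for g :: "complex \<Rightarrow> ennreal" and \<tau>
  proof -
    have "(\<lambda>z. cis \<tau> * z) \<in> borel_measurable borel"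
      by (intro borel_measurable_continuous_onI continuous_intros)
    then have m: "(\<lambda>z. g (cis \<tau> * z)) \<in> borel_measurable borel" by measurable
    show ?thesis using mirror[OF m, of 0] mirror[OF that, of "\<tau> / 8"] by simp
  qed
  define p where "p k = measure \<mu> {P \<in> space \<mu>. label N P = k}" for k
  have em: "ennreal (p k) = (\<integral>\<^sup>+P. indicator {k} (label N P) \<partial>\<mu>)" for k
  proof -
    have "(\<integral>\<^sup>+P. indicator {k} (label N P) \<partial>\<mu>) = (\<integral>\<^sup>+P. indicator {P \<in> space \<mu>. label N P = k} P \<partial>\<mu>)"
      by (rule nn_integral_cong) (auto simp: indicator_def)
    then show ?thesis by (simp add: p_def U.emeasure_eq_measure)
  qed
  have same: "p k = p 0" if k: "k < 2 * N" for k
  proof -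
    have "(\<lambda>z. indicator {0} (cell N (Arg2pi z / 2)) :: ennreal) \<in> borel_measurable borel"
      using measurable_cell_Arg2pi by (rule measurable_compose) auto
    from rot[OF this, of "- (pi * k / N)"]
    have "(\<integral>\<^sup>+P. indicator {0} (cell N (Arg2pi (cis (- (pi * k / N)) * turn P) / 2)) \<partial>\<mu>) = ennreal (p 0)"
      unfolding em label_def .
    moreover have "(\<integral>\<^sup>+P. indicator {0} (cell N (Arg2pi (cis (- (pi * k / N)) * turn P) / 2)) \<partial>\<mu>)
        = (\<integral>\<^sup>+P. indicator {k} (label N P) \<partial>\<mu>)"
    proof (rule nn_integral_cong)
      fix P assume "P \<in> space \<mu>"
      then have "norm (turn P) = 1" by (simp add: U.space_\<mu> norm_turn)
      from cell_rotate[OF N k this]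
      show "indicator {0} (cell N (Arg2pi (cis (- (pi * k / N)) * turn P) / 2)) = (indicator {k} (label N P) :: ennreal)"
        by (simp add: indicator_def label_def)
    qed
    ultimately have "ennreal (p k) = ennreal (p 0)" unfolding em by simp
    then show ?thesis by (simp add: p_def)
  qed
  have lt: "label N P < 2 * N" for P
    unfolding label_def by (rule cell_bounds(3)[OF N Arg2pi_half_bounds])
  have "1 = measure \<mu> (\<Union>k<2 * N. {P \<in> space \<mu>. label N P = k})"
  proof -
    have "(\<Union>k<2 * N. {P \<in> space \<mu>. label N P = k}) = space \<mu>" using lt by auto
    then show ?thesis by (simp add: U.prob_space)
  qed
  also have "\<dots> = (\<Sum>k<2 * N. p k)"
    unfolding p_def by (rule U.finite_measure_finite_Union) (auto simp: disjoint_family_on_def)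
  also have "\<dots> = (\<Sum>k<2 * N. p 0)" by (rule sum.cong[OF refl]) (rule same, simp)
  also have "\<dots> = real (2 * N) * p 0" by simp
  finally have "p 0 = 1 / real (2 * N)" using N by (simp add: field_simps)
  then show ?thesis using same[OF l] by (simp add: p_def)
qed

end

section \<open>Uniform deviation on the circle\<close>

lemma integral_two_minus_one:
  fixes f :: "'b \<Rightarrow> real"
  assumes "prob_space N" "integrable N f"
  shows "(\<integral>A. 2 * f A - 1 \<partial>N) = 2 * (\<integral>A. f A \<partial>N) - 1"
proof -
  interpret prob_space N by (rule assms)
  show ?thesis using assms(2) by (simp add: prob_space)
qed

context random_projections
begin

text \<open>
  Twice the deviation is that of the step function from \<open>step_approximation\<close>, which is at most
  \<open>(pi + 2) * \<epsilon>\<close> by \<open>discrepancy_sum_bound\<close>, plus the error in the exceptional cell, which contains a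
  fraction of at most \<open>2 * \<epsilon>\<close> of the labels up to the size of a cell, plus discretization errors. The
  total is close to \<open>(pi + 4) * \<epsilon>\<close>, less than \<open>8 * \<epsilon>\<close>.
\<close>

lemma uniform_deviation_circle:
  fixes \<epsilon> \<beta> \<nu> \<kappa> :: real
  assumes DIM1: "DIM('a) = 1" and n1: "n = 1" and \<epsilon>: "\<epsilon> > 0"
  defines "\<beta> \<equiv> rc_beta TYPE('a)"
  defines "\<nu> \<equiv> mu2 \<beta> n" and "\<kappa> \<equiv> mu1 \<beta> n - mu2 \<beta> n"
  obtains E K where "E \<in> events" "prob E \<le> 4 * exp (- (m * \<epsilon>\<^sup>2 / 2))" "K < 4 * \<epsilon>"
    "\<And>\<omega> x y. \<omega> \<in> space M - E \<Longrightarrow> norm x = 1 \<Longrightarrow> norm y = 1 \<Longrightarrow>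
        \<bar>dev m \<nu> \<kappa> (\<lambda>j. P j \<omega>) x y\<bar> \<le> K"
proof -
  have "card (Basis :: ('a^'d) set) = 2" using DIM1 d n1 by simp
  then obtain e e' :: "'a^'d" where B: "Basis = {e, e'}" "e \<noteq> e'" by (meson card_2_iff)
  have eB: "e \<in> Basis" "e' \<in> Basis" using B by auto
  interpret real_plane e e'
  proof
    show "e \<bullet> e' = 0" using eB B(2) by (simp add: inner_Basis)
    show "x = (x \<bullet> e) *\<^sub>R e + (x \<bullet> e') *\<^sub>R e'" for x
    proof -
      have "(\<Sum>b\<in>Basis. (x \<bullet> b) *\<^sub>R b) = (x \<bullet> e) *\<^sub>R e + (x \<bullet> e') *\<^sub>R e'"
        unfolding B(1) using B(2) by simp
      then show ?thesis unfolding euclidean_representation .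
    qed
  qed (use DIM1 eB in auto)
  \<comment> \<open>The partition is chosen so fine that the discretisation error fits below \<open>(4 - pi) * \<epsilon>\<close>.\<close>
  have gap: "(4 - pi) * \<epsilon> > 0" using \<epsilon> pi_less_4 by simp
  then obtain N' where N': "(pi + 1) / ((4 - pi) * \<epsilon>) < real N'" using reals_Archimedean2 by blast
  moreover have "(pi + 1) / ((4 - pi) * \<epsilon>) > 0" using gap by (intro divide_pos_pos) (simp_all add: add_pos_pos)
  ultimately have N'0: "real N' > 0" by linarith
  define N where "N = N'"
  have N: "N > 0" using N'0 by (simp add: N_def)
  have Nbig: "(pi + 1) / N < (4 - pi) * \<epsilon>"
    using N' gap N by (simp add: N_def field_simps)
  define K where "K = ((pi + 4) * \<epsilon> + (pi + 1) / N) / 2"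
  have K: "K < 4 * \<epsilon>" using Nbig by (simp add: K_def algebra_simps)
  define L where "L j \<omega> = label N (P j \<omega>)" for j \<omega>
  have labm: "label N \<in> Proj_borel n \<rightarrow>\<^sub>M count_space UNIV"
    by (rule measurable_restrict_space1[OF measurable_label])
  have Lindep: "indep_vars (\<lambda>_. count_space UNIV) L {..<m}"
    unfolding L_def[abs_def] using indep by (rule indep_vars_compose2) (rule labm)
  have lt: "label N A < 2 * N" for A
    unfolding label_def by (rule cell_bounds(3)[OF N Arg2pi_half_bounds])
  have U: "uniform_projection 1 (law j)" if "j < m" for j
    using uniform_projection_law[OF that] n1 by simp
  have Lunif: "prob {\<omega>\<in>space M. L j \<omega> = l} = 1 / real (2 * N)" if "j < m" "l < 2 * N" for j l
  proof -
    have "measure (law j) {A \<in> space (law j). label N A = l} = prob (P j -` {A \<in> space (law j). label N A = l} \<inter> space M)"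
      using that(1) measurable_sets[OF labm, of "{l}"]
      by (intro measure_distr) (auto simp: space_restrict_space vimage_def Int_def conj_commute)
    also have "P j -` {A \<in> space (law j). label N A = l} \<inter> space M = {\<omega>\<in>space M. L j \<omega> = l}"
      using P_Proj[OF that(1)] by (auto simp: L_def space_restrict_space)
    finally show ?thesis using label_uniform[OF U[OF that(1)] N that(2)] by simp
  qed
  obtain E where E: "E \<in> events" "prob E \<le> 4 * exp (- (m * \<epsilon>\<^sup>2 / 2))"
    "\<And>\<omega> i. \<omega> \<in> space M - E \<Longrightarrow> i \<le> 2 * N \<Longrightarrow> \<bar>discrepancy N m (\<lambda>j. L j \<omega>) i\<bar> < \<epsilon>"
    by (rule uniform_labels_discrepancy[OF Lindep N _ Lunif m, of \<epsilon>]) (use \<epsilon> lt in \<open>auto simp: L_def\<close>)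
  show ?thesis
  proof (rule that[OF E(1,2) K])
    fix \<omega> and x y :: "'a^'d" assume \<omega>: "\<omega> \<in> space M - E" and x: "norm x = 1" and y: "norm y = 1"
    obtain \<alpha> where \<alpha>: "x = dir \<alpha>" by (rule dir_exists[OF x])
    obtain \<gamma> where \<gamma>: "y = dir \<gamma>" by (rule dir_exists[OF y])
    let ?h = "pi / real (2 * N)"
    obtain c :: "nat \<Rightarrow> real" and k where c: "(\<Sum>i<2 * N - 1. \<bar>c i - c (Suc i)\<bar>) \<le> pi + 2" and k: "k < 2 * N"
      and ap: "\<forall>t s. 0 \<le> t \<longrightarrow> t < pi \<longrightarrow> \<bar>s\<bar> \<le> 1 \<longrightarrow> (cos (t - 2 * \<alpha>) \<noteq> 0 \<longrightarrow> s = sgn (cos (t - 2 * \<alpha>))) \<longrightarrow>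
       \<bar>s * cos (t - 2 * \<gamma>) - c (cell N t)\<bar> \<le> ?h + of_bool (cell N t = k)"
      by (rule step_approximation[OF N, where \<xi>="2 * \<alpha>" and \<zeta>="2 * \<gamma>"])
    define v where "v A = 2 * rform A x y - 1" for A
    have vap: "\<bar>v A - c (label N A)\<bar> \<le> ?h + of_bool (label N A = k)" if A: "A \<in> Proj 1" for A
    proof -
      obtain s where s: "\<bar>s\<bar> \<le> 1" "cos (Arg2pi (turn A) / 2 - 2 * \<alpha>) \<noteq> 0 \<Longrightarrow> s = sgn (cos (Arg2pi (turn A) / 2 - 2 * \<alpha>))"
        "2 * rform A (dir \<alpha>) (dir \<gamma>) - 1 = s * cos (Arg2pi (turn A) / 2 - 2 * \<gamma>)"
        using rform_sign[OF A, of \<alpha> \<gamma>] by metis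
      show ?thesis
        unfolding v_def \<alpha> \<gamma> s(3) label_def using ap Arg2pi_half_bounds s(1,2) by blast
    qed
    define f where "f j = L j \<omega>" for j
    have flt: "f j < 2 * N" for j by (simp add: f_def L_def lt)
    have D: "\<bar>discrepancy N m f i\<bar> \<le> \<epsilon>" if "i \<le> 2 * N" for i
      using E(3)[OF \<omega> that] by (simp add: f_def[abs_def] less_imp_le)
    have emp1: "\<bar>(\<Sum>j<m. c (f j)) / m - (\<Sum>i<2 * N. c i) / real (2 * N)\<bar> \<le> \<epsilon> * (pi + 2)"
      by (rule discrepancy_sum_bound(1)[OF m N flt D c])
    have cardk: "real (card {j. j < m \<and> f j = k}) / m \<le> 2 * \<epsilon> + 1 / real (2 * N)"
      by (rule discrepancy_sum_bound(2)[OF m N flt D c k])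
    have emp2: "\<bar>(\<Sum>j<m. v (P j \<omega>)) / m - (\<Sum>j<m. c (f j)) / m\<bar> \<le> ?h + 2 * \<epsilon> + 1 / real (2 * N)"
    proof -
      have "\<bar>(\<Sum>j<m. v (P j \<omega>)) / m - (\<Sum>j<m. c (f j)) / m\<bar> \<le> (\<Sum>j<m. ?h + of_bool (f j = k)) / m"
      proof (rule average_diff_le)
        fix j assume "j < m"
        then have "P j \<omega> \<in> Proj 1" using P_Proj[of j \<omega>] \<omega> n1 by simp
        then show "\<bar>v (P j \<omega>) - c (f j)\<bar> \<le> ?h + of_bool (f j = k)"
          using vap by (simp add: f_def L_def)
      qed
      also have "(\<Sum>j<m. ?h + of_bool (f j = k)) = m * ?h + real (card {j. j < m \<and> f j = k})"
        by (simp add: sum.distrib of_bool_def sum.If_cases Int_def)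
      also have "\<dots> / m = ?h + real (card {j. j < m \<and> f j = k}) / m"
        using m by (simp add: add_divide_distrib)
      finally show ?thesis using cardk by linarith
    qed
    interpret U0: uniform_projection 1 "law 0" by (rule U[OF m])
    have labl [measurable]: "label N \<in> law 0 \<rightarrow>\<^sub>M count_space UNIV" using labm by simp
    have intv: "integrable (law 0) v" unfolding v_def using U0.integrable_rform[of x y] by simp
    have intc: "integrable (law 0) (\<lambda>A. c (label N A))"
    proof (rule U0.integrable_const_bound[where B="\<Sum>i<2 * N. \<bar>c i\<bar>"])
      show "AE A in law 0. norm (c (label N A)) \<le> (\<Sum>i<2 * N. \<bar>c i\<bar>)"
        using lt by (intro AE_I2) (auto intro: member_le_sum)
    qed measurable
    have inti: "integrable (law 0) (\<lambda>A. of_bool (label N A = i) :: real)" for i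
      by (rule U0.integrable_const_bound[where B=1]) (auto intro!: AE_I2)
    have Ei: "(\<integral>A. of_bool (label N A = i) \<partial>law 0) = 1 / real (2 * N)" if "i < 2 * N" for i
    proof -
      have "(\<integral>A. of_bool (label N A = i) \<partial>law 0) = (\<integral>A. indicator {A \<in> space (law 0). label N A = i} A \<partial>law 0)"
        by (rule Bochner_Integration.integral_cong) (auto simp: indicator_def)
      also have "\<dots> = measure (law 0) {A \<in> space (law 0). label N A = i}"
        unfolding Bochner_Integration.integral_indicator by (auto intro!: arg_cong[where f="measure _"])
      finally show ?thesis using label_uniform[OF U[OF m] N that] by simp
    qed
    have Ec: "(\<integral>A. c (label N A) \<partial>law 0) = (\<Sum>i<2 * N. c i) / real (2 * N)"
    proof -
      have "(\<integral>A. c (label N A) \<partial>law 0) = (\<integral>A. (\<Sum>i<2 * N. c i * of_bool (label N A = i)) \<partial>law 0)"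
        by (rule Bochner_Integration.integral_cong) (use lt in \<open>auto simp: of_bool_def if_distrib cong: if_cong\<close>)
      also have "\<dots> = (\<Sum>i<2 * N. c i * (\<integral>A. of_bool (label N A = i) \<partial>law 0))"
        using inti by (subst Bochner_Integration.integral_sum) auto
      also have "\<dots> = (\<Sum>i<2 * N. c i) / real (2 * N)"
        using Ei by (simp add: sum_divide_distrib)
      finally show ?thesis .
    qed
    have mean: "\<bar>(\<integral>A. v A \<partial>law 0) - (\<Sum>i<2 * N. c i) / real (2 * N)\<bar> \<le> ?h + 1 / real (2 * N)"
    proof -
      have "\<bar>(\<integral>A. v A \<partial>law 0) - (\<Sum>i<2 * N. c i) / real (2 * N)\<bar> = \<bar>\<integral>A. v A - c (label N A) \<partial>law 0\<bar>"
        unfolding Ec[symmetric] using intv intc by simp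
      also have "\<dots> \<le> (\<integral>A. \<bar>v A - c (label N A)\<bar> \<partial>law 0)" by (rule integral_abs_bound)
      also have "\<dots> \<le> (\<integral>A. ?h + of_bool (label N A = k) \<partial>law 0)"
      proof (rule integral_mono)
        show "integrable (law 0) (\<lambda>A. \<bar>v A - c (label N A)\<bar>)" using intv intc by simp
        show "integrable (law 0) (\<lambda>A. ?h + of_bool (label N A = k))" using inti by simp
        show "\<bar>v A - c (label N A)\<bar> \<le> ?h + of_bool (label N A = k)" if "A \<in> space (law 0)" for A
          using that by (intro vap) (simp add: U0.space_\<mu> del: space_distr)
      qed
      also have "\<dots> = ?h + 1 / real (2 * N)"
        using inti Ei[OF k] U0.prob_space by simp
      finally show ?thesis .
    qed
    have Ev: "(\<integral>A. v A \<partial>law 0) = 2 * (\<nu> + \<kappa> * (norm (cip x y))\<^sup>2) - 1"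
    proof -
      have "(\<integral>A. v A \<partial>law 0) = 2 * U0.mean_form x y - 1"
        unfolding v_def U0.mean_form_def
        by (rule integral_two_minus_one[OF U0.prob_space_axioms U0.integrable_rform])
      then show ?thesis using U0.mean_form_eq[OF x y] n1 by (simp add: \<nu>_def \<kappa>_def \<beta>_def)
    qed
    have "(\<Sum>j<m. v (P j \<omega>)) / m = 2 * ((\<Sum>j<m. rform (P j \<omega>) x y) / m) - 1"
      using m by (simp add: v_def sum_subtractf sum_distrib_left[symmetric] diff_divide_distrib)
    then have "2 * dev m \<nu> \<kappa> (\<lambda>j. P j \<omega>) x y = (\<Sum>j<m. v (P j \<omega>)) / m - (\<integral>A. v A \<partial>law 0)"
      unfolding Ev dev_def by simp
    then have "2 * \<bar>dev m \<nu> \<kappa> (\<lambda>j. P j \<omega>) x y\<bar> = \<bar>(\<Sum>j<m. v (P j \<omega>)) / m - (\<integral>A. v A \<partial>law 0)\<bar>" by linarith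
    also have "\<dots> \<le> \<epsilon> * (pi + 2) + 2 * \<epsilon> + 2 * ?h + 2 * (1 / real (2 * N))"
      using emp1 emp2 mean by linarith
    also have "\<dots> = 2 * K"
      using N by (simp add: K_def field_simps)
    finally show "\<bar>dev m \<nu> \<kappa> (\<lambda>j. P j \<omega>) x y\<bar> \<le> K" by simp
  qed
qed

end

section \<open>Measurability of the recovery event\<close>

text \<open>
  The tube lemma: finitely many of the boxes that separate \<open>y\<close> from \<open>T\<close> cover \<open>S\<close>.
\<close>

lemma closed_projection_compact:
  fixes T :: "('b::topological_space \<times> 'c::topological_space) set"
  assumes S: "compact S" and T: "closed T"
  shows "closed {y. \<exists>x\<in>S. (x, y) \<in> T}"
  unfolding closed_def
proof (subst open_subopen, intro ballI)
  fix y assume "y \<in> - {y. \<exists>x\<in>S. (x, y) \<in> T}"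
  then have "\<forall>x\<in>S. \<exists>A B. open A \<and> open B \<and> (x, y) \<in> A \<times> B \<and> A \<times> B \<subseteq> - T"
    using T unfolding closed_def by (auto elim!: open_prod_elim) 
  then obtain A B where AB: "\<And>x. x \<in> S \<Longrightarrow> open (A x) \<and> open (B x) \<and> (x, y) \<in> A x \<times> B x \<and> A x \<times> B x \<subseteq> - T"
    by metis
  obtain C where C: "C \<subseteq> S" "finite C" "S \<subseteq> (\<Union>x\<in>C. A x)"
    by (rule compactE_image[OF S, of S A]) (use AB in blast)+
  show "\<exists>V. open V \<and> y \<in> V \<and> V \<subseteq> - {y. \<exists>x\<in>S. (x, y) \<in> T}"
  proof (intro exI[of _ "\<Inter>x\<in>C. B x"] conjI)
    show "open (\<Inter>x\<in>C. B x)" using C AB by (intro open_INT) auto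
    show "y \<in> (\<Inter>x\<in>C. B x)" using C AB by auto
    show "(\<Inter>x\<in>C. B x) \<subseteq> - {y. \<exists>x\<in>S. (x, y) \<in> T}"
    proof clarify
      fix z x assume z: "z \<in> (\<Inter>x\<in>C. B x)" and x: "x \<in> S" "(x, z) \<in> T"
      obtain w where "w \<in> C" "x \<in> A w" using C(3) x(1) by auto
      then show False using AB[of w] C(1) z x(2) by blast
    qed
  qed
qed

text \<open>
  If \<open>l\<close> is the maximum of the quadratic form on the sphere, then \<open>l |z|\<^sup>2 - qf Q z\<close> is nonnegative
  and vanishes at \<open>x\<close>. Its first variation at \<open>x\<close>, in the direction \<open>b = l x - Q x\<close>, is a multiple of
  \<open>|b|\<^sup>2\<close>, which must therefore vanish.
\<close>

lemma pep_optimal_top_eigenspace: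
  fixes Q :: "'a::real_or_complex^'d^'d"
  assumes herm: "ctranspose Q = Q" and opt: "pep_optimal Q (outer x)" and x: "norm x = 1"
  shows "range ((*v) (outer x)) \<subseteq> top_eigenspace Q"
proof -
  define l where "l = qf Q x"
  have le: "qf Q y \<le> l * (y \<bullet> y)" for y
  proof (cases "y = 0")
    case False
    have "qf Q ((1 / norm y) *\<^sub>R y) \<le> l"
      unfolding l_def by (rule pep_optimal_outer[OF opt]) (use False in simp)
    then show ?thesis
      using False by (simp add: qf_scaleR power_divide field_simps flip: power2_norm_eq_inner)
  qed (simp add: qf_def)
  define b where "b = l *\<^sub>R x - Q *v x"
  define k where "k = l * (b \<bullet> b) - qf Q b"
  have k: "k \<ge> 0" using le[of b] by (simp add: k_def)
  have xx: "x \<bullet> x = 1" using x by (simp add: norm_eq_1)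
  have quad: "0 \<le> 2 * t * (b \<bullet> b) + t\<^sup>2 * k" for t
  proof -
    have "x \<bullet> (Q *v b) = b \<bullet> (Q *v x)" using inner_hermitian[OF herm, of x b] by (simp add: inner_commute)
    then have "l * ((x + t *\<^sub>R b) \<bullet> (x + t *\<^sub>R b)) - qf Q (x + t *\<^sub>R b)
        = (l - qf Q x) + 2 * t * (l * (b \<bullet> x) - b \<bullet> (Q *v x)) + t\<^sup>2 * k"
      by (simp add: qf_def k_def inner_simps matrix_vector_right_distrib matrix_scaleR_vector xx
          inner_commute[of x b] power2_eq_square algebra_simps)
    also have "l * (b \<bullet> x) - b \<bullet> (Q *v x) = b \<bullet> b" by (simp add: b_def inner_simps)
    finally show ?thesis using le[of "x + t *\<^sub>R b"] by (simp add: l_def)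
  qed
  have "b \<bullet> b = 0"
  proof (rule ccontr)
    assume "b \<bullet> b \<noteq> 0"
    then have bb: "b \<bullet> b > 0" by simp
    \<comment> \<open>The minimum over \<open>t\<close> would be at \<open>- (b \<bullet> b) / k\<close>; adding \<open>1\<close> avoids the case \<open>k = 0\<close>.\<close>
    define t where "t = - (b \<bullet> b) / (k + 1)"
    have kt: "(k + 1) * t = - (b \<bullet> b)" using k by (simp add: t_def)
    have "(k + 1)\<^sup>2 * (2 * t * (b \<bullet> b) + t\<^sup>2 * k) = 2 * (k + 1) * ((k + 1) * t) * (b \<bullet> b) + ((k + 1) * t)\<^sup>2 * k"
      by (simp add: power2_eq_square algebra_simps)
    also have "\<dots> = - ((k + 2) * (b \<bullet> b)\<^sup>2)"
      unfolding kt by (simp add: power2_eq_square algebra_simps)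
    also have "\<dots> < 0" using bb k by simp
    finally have "2 * t * (b \<bullet> b) + t\<^sup>2 * k < 0" by (simp add: mult_less_0_iff)
    then show False using quad[of t] by simp
  qed
  then have eig: "Q *v x = l *\<^sub>R x" by (simp add: b_def)
  have x0: "x \<noteq> 0" using x by auto
  have "l \<in> real_eigenvalues Q" using eig x0 by (auto simp: real_eigenvalues_def)
  moreover have "l' \<le> l" if l': "l' \<in> real_eigenvalues Q" for l'
  proof -
    obtain v where v: "v \<noteq> 0" "Q *v v = l' *\<^sub>R v" using l' by (auto simp: real_eigenvalues_def)
    have "l' * (v \<bullet> v) \<le> l * (v \<bullet> v)" using le[of v] by (simp add: qf_def v(2))
    then show ?thesis using v(1) by simp
  qed
  moreover have "Q *v (c *s x) = l *\<^sub>R (c *s x)" for c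
    by (simp add: matrix_smult_vector eig scaleR_eq_smult vec_eq_iff mult.left_commute)
  ultimately show ?thesis by (auto simp: top_eigenspace_def outer_mult)
qed

lemma continuous_trace_mult [continuous_intros]:
  fixes f :: "'t::topological_space \<Rightarrow> 'a::real_or_complex^'d^'d"
  assumes "continuous_on S f"
  shows "continuous_on S (\<lambda>t. rc_re (trace (f t ** Y)))"
  unfolding trace_def matrix_matrix_mult_def vec_lambda_beta
  by (intro continuous_intros assms)

lemma continuous_Q_mat [continuous_intros]:
  fixes f :: "'t::topological_space \<Rightarrow> nat \<Rightarrow> 'a::real_or_complex^'d^'d"
  assumes "\<And>j. continuous_on S (\<lambda>t. f t j)"
  shows "continuous_on S (\<lambda>t. Q_mat m (f t) b)"
proof -
  have "continuous_on S (\<lambda>t. if b j then f t j else mat 1 - f t j)" for j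
    by (cases "b j") (auto intro!: continuous_intros assms)
  then show ?thesis unfolding Q_mat_def by (intro continuous_intros) auto
qed

text \<open>
  With the sign pattern and the distance of the negative measurements from the threshold fixed,
  failure of recovery is a closed condition on the projections and the two unit vectors; the
  vectors range over a compact set.
\<close>

definition failure_set :: "nat \<Rightarrow> real \<Rightarrow> nat set \<Rightarrow> nat \<Rightarrow> (nat \<Rightarrow> 'a::real_or_complex^'d^'d) set"
  where "failure_set m \<delta> S k = {f. \<exists>x x'. norm x = 1 \<and> norm x' = 1 \<and>
    (\<forall>j\<in>S. qf (f j) x \<ge> 1/2) \<and> (\<forall>j\<in>{..<m} - S. qf (f j) x \<le> 1/2 - 1 / real (Suc k)) \<and>
    pep_optimal (Q_mat m f (\<lambda>j. j \<in> S)) (outer x') \<and> \<delta> \<le> sqrt (1 - (norm (cip x x'))\<^sup>2)}"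

lemma closed_failure_set: "closed (failure_set m \<delta> S k :: (nat \<Rightarrow> 'a::real_or_complex^'d^'d) set)"
proof -
  define T where "T = {p :: (('a^'d) \<times> ('a^'d)) \<times> (nat \<Rightarrow> 'a^'d^'d).
    (\<forall>j\<in>S. qf (snd p j) (fst (fst p)) \<ge> 1/2) \<and>
    (\<forall>j\<in>{..<m} - S. qf (snd p j) (fst (fst p)) \<le> 1/2 - 1 / real (Suc k)) \<and>
    (\<forall>Y\<in>{Y. psd Y \<and> rc_re (trace Y) \<le> 1}. rc_re (trace (Q_mat m (snd p) (\<lambda>j. j \<in> S) ** Y))
        \<le> qf (Q_mat m (snd p) (\<lambda>j. j \<in> S)) (snd (fst p))) \<and>
    \<delta> \<le> sqrt (1 - (norm (cip (fst (fst p)) (snd (fst p))))\<^sup>2)}"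
  have coord: "continuous_on UNIV (\<lambda>p :: (('a^'d) \<times> ('a^'d)) \<times> (nat \<Rightarrow> 'a^'d^'d). snd p j)" for j
    by (rule continuous_on_compose2[OF continuous_on_product_coordinates]) (auto intro: continuous_intros)
  have "closed T"
    unfolding T_def Ball_def
    by (intro closed_Collect_conj closed_Collect_all closed_Collect_imp open_Collect_const
        closed_Collect_le continuous_intros coord)
  moreover have "compact (sphere (0::'a^'d) 1 \<times> sphere (0::'a^'d) 1)"
    by (intro compact_Times) auto
  ultimately have "closed {f. \<exists>p\<in>sphere 0 1 \<times> sphere 0 1. (p, f) \<in> T}"
    by (rule closed_projection_compact[rotated])
  also have "{f. \<exists>p\<in>sphere 0 1 \<times> sphere 0 1. (p, f) \<in> T} = failure_set m \<delta> S k"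
  proof -
    have "pep_optimal Q (outer x') \<longleftrightarrow> (\<forall>Y\<in>{Y. psd Y \<and> rc_re (trace Y) \<le> 1}. rc_re (trace (Q ** Y)) \<le> qf Q x')"
      if "norm x' = 1" for Q :: "'a^'d^'d" and x'
      using that psd_outer[of x'] trace_outer[of x']
      by (auto simp: pep_optimal_def is_arg_max_linorder trace_mult_outer qf_def)
    then have inT: "((x, x'), f) \<in> T \<longleftrightarrow> (\<forall>j\<in>S. qf (f j) x \<ge> 1/2) \<and>
        (\<forall>j\<in>{..<m} - S. qf (f j) x \<le> 1/2 - 1 / real (Suc k)) \<and>
        pep_optimal (Q_mat m f (\<lambda>j. j \<in> S)) (outer x') \<and> \<delta> \<le> sqrt (1 - (norm (cip x x'))\<^sup>2)"
      if "norm x' = 1" for x x' f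
      unfolding T_def mem_Collect_eq fst_conv snd_conv using that by (simp only:)
    have "(\<exists>p\<in>sphere 0 1 \<times> sphere 0 1. (p, f) \<in> T) \<longleftrightarrow>
        (\<exists>x x'. norm x = 1 \<and> norm x' = 1 \<and> ((x, x'), f) \<in> T)" for f
      by (simp add: Bex_def)
    then show ?thesis unfolding failure_set_def using inT by (auto cong: conj_cong)
  qed
  finally show ?thesis .
qed

context random_projections
begin

definition recovers :: "real \<Rightarrow> 'w \<Rightarrow> bool"
  where "recovers \<delta> \<omega> \<longleftrightarrow> (\<forall>X\<in>Proj 1. \<forall>X'.
    pep_solution m (\<lambda>j. P j \<omega>) (Phi (\<lambda>j. P j \<omega>) X) X' \<longrightarrow> onorm ((*v) (X' - X)) < \<delta>)"

text \<open>
  Every rank-one projection is \<open>outer x\<close> for a unit vector, and the eigenspace condition follows from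
  optimality. What remains are conditions on vectors in a compact set.
\<close>

lemma recovers_iff:
  assumes \<omega>: "\<omega> \<in> space M"
  shows "recovers \<delta> \<omega>
    \<longleftrightarrow> (\<forall>x x'. norm x = 1 \<longrightarrow> norm x' = 1 \<longrightarrow>
          pep_optimal (Q_mat m (\<lambda>j. P j \<omega>) (Phi (\<lambda>j. P j \<omega>) (outer x))) (outer x') \<longrightarrow>
          sqrt (1 - (norm (cip x x'))\<^sup>2) < \<delta>)"
proof -
  have herm: "ctranspose (Q_mat m (\<lambda>j. P j \<omega>) b) = Q_mat m (\<lambda>j. P j \<omega>) b" for b
    by (rule ctranspose_Q_mat) (rule Proj_hermitian[OF P_Proj[OF _ \<omega>]])
  have sol: "pep_solution m (\<lambda>j. P j \<omega>) b (outer x') \<longleftrightarrow> pep_optimal (Q_mat m (\<lambda>j. P j \<omega>) b) (outer x')"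
    if "norm x' = 1" for b x'
    using pep_optimal_top_eigenspace[OF herm] that unfolding pep_solution_def Proj_1_eq by auto
  have "recovers \<delta> \<omega>
    \<longleftrightarrow> (\<forall>X\<in>Proj 1. \<forall>X'\<in>Proj 1. pep_solution m (\<lambda>j. P j \<omega>) (Phi (\<lambda>j. P j \<omega>) X) X' \<longrightarrow> onorm ((*v) (X' - X)) < \<delta>)"
    by (auto simp: recovers_def pep_solution_def)
  also have "\<dots> \<longleftrightarrow> (\<forall>x x'. norm x = 1 \<longrightarrow> norm x' = 1 \<longrightarrow>
          pep_solution m (\<lambda>j. P j \<omega>) (Phi (\<lambda>j. P j \<omega>) (outer x)) (outer x') \<longrightarrow>
          onorm ((*v) (outer x' - outer x)) < \<delta>)"
    unfolding Proj_1_eq by blast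
  also have "\<dots> \<longleftrightarrow> (\<forall>x x'. norm x = 1 \<longrightarrow> norm x' = 1 \<longrightarrow>
          pep_optimal (Q_mat m (\<lambda>j. P j \<omega>) (Phi (\<lambda>j. P j \<omega>) (outer x))) (outer x') \<longrightarrow>
          sqrt (1 - (norm (cip x x'))\<^sup>2) < \<delta>)"
    by (intro iff_allI imp_cong refl) (simp_all add: sol onorm_outer_diff)
  finally show ?thesis .
qed

text \<open>
  The sign pattern takes finitely many values, and the strict inequalities for the negative measurements
  hold with some margin \<open>1 / (k + 1)\<close>. So failure is a countable union of preimages of closed sets.
\<close>

lemma recovery_event_measurable:
  "{\<omega> \<in> space M. recovers \<delta> \<omega>} \<in> events" (is "?G \<in> _")
proof -
  define F where "F \<omega> = (\<lambda>j. if j < m then P j \<omega> else 0)" for \<omega>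
  have Fm: "F \<in> borel_measurable M"
  proof (rule measurable_coordinatewise_then_product)
    show "(\<lambda>\<omega>. F \<omega> j) \<in> borel_measurable M" for j
      using P_borel[of j] by (cases "j < m") (simp_all add: F_def)
  qed
  define B where "B S k = F -` failure_set m \<delta> S k \<inter> space M" for S k
  have Bm: "B S k \<in> events" for S k
    unfolding B_def by (rule measurable_sets[OF Fm]) (simp add: closed_failure_set)
  have Q: "Q_mat m (\<lambda>j. P j \<omega>) b = Q_mat m (F \<omega>) (\<lambda>j. j \<in> S)" if "\<And>j. j < m \<Longrightarrow> b j = (j \<in> S)" for \<omega> b S
    unfolding Q_mat_def using that by (auto simp: F_def intro!: sum.cong)
  have "space M - ?G = (\<Union>S\<in>Pow {..<m}. \<Union>k. B S k)"
  proof (intro equalityI subsetI)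
    fix \<omega> assume "\<omega> \<in> space M - ?G"
    then have \<omega>: "\<omega> \<in> space M" and "\<not> recovers \<delta> \<omega>" by auto
    then obtain x x' where x: "norm x = 1" "norm x' = 1"
      and opt: "pep_optimal (Q_mat m (\<lambda>j. P j \<omega>) (Phi (\<lambda>j. P j \<omega>) (outer x))) (outer x')"
      and far: "\<delta> \<le> sqrt (1 - (norm (cip x x'))\<^sup>2)"
      unfolding recovers_iff[OF \<omega>] by (auto simp: not_less)
    define S where "S = {j. j < m \<and> qf (P j \<omega>) x \<ge> 1/2}"
    have "eventually (\<lambda>k. \<forall>j\<in>{..<m} - S. 1 / real (Suc k) \<le> 1/2 - qf (P j \<omega>) x) sequentially"
    proof (rule eventually_ball_finite)
      show "\<forall>j\<in>{..<m} - S. eventually (\<lambda>k. 1 / real (Suc k) \<le> 1/2 - qf (P j \<omega>) x) sequentially"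
      proof
        fix j assume "j \<in> {..<m} - S"
        then have "0 < 1/2 - qf (P j \<omega>) x" by (auto simp: S_def)
        with LIMSEQ_inverse_real_of_nat have "eventually (\<lambda>k. inverse (real (Suc k)) < 1/2 - qf (P j \<omega>) x) sequentially"
          by (rule order_tendstoD(2))
        then show "eventually (\<lambda>k. 1 / real (Suc k) \<le> 1/2 - qf (P j \<omega>) x) sequentially"
          by (rule eventually_mono) (simp add: inverse_eq_divide)
      qed
    qed simp
    then obtain k where k: "\<forall>j\<in>{..<m} - S. 1 / real (Suc k) \<le> 1/2 - qf (P j \<omega>) x"
      using eventually_happens'[OF sequentially_bot] by blast
    have "pep_optimal (Q_mat m (F \<omega>) (\<lambda>j. j \<in> S)) (outer x')"
      using opt Q[of "Phi (\<lambda>j. P j \<omega>) (outer x)" S \<omega>] by (simp add: Phi_def phi_outer S_def)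
    moreover have "\<forall>j\<in>S. qf (F \<omega> j) x \<ge> 1/2" by (simp add: S_def F_def)
    moreover have "\<forall>j\<in>{..<m} - S. qf (F \<omega> j) x \<le> 1/2 - 1 / real (Suc k)"
    proof
      fix j assume j: "j \<in> {..<m} - S"
      then show "qf (F \<omega> j) x \<le> 1/2 - 1 / real (Suc k)" using bspec[OF k j] by (simp add: F_def)
    qed
    ultimately have "F \<omega> \<in> failure_set m \<delta> S k"
      unfolding failure_set_def using x far by blast
    then show "\<omega> \<in> (\<Union>S\<in>Pow {..<m}. \<Union>k. B S k)" using \<omega> by (auto simp: B_def S_def)
  next
    fix \<omega> assume "\<omega> \<in> (\<Union>S\<in>Pow {..<m}. \<Union>k. B S k)"
    then obtain S k where S: "S \<subseteq> {..<m}" and \<omega>: "\<omega> \<in> space M" and "F \<omega> \<in> failure_set m \<delta> S k"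
      by (auto simp: B_def)
    then obtain x x' where x: "norm x = 1" "norm x' = 1" and pos: "\<forall>j\<in>S. qf (F \<omega> j) x \<ge> 1/2"
      and neg: "\<forall>j\<in>{..<m} - S. qf (F \<omega> j) x \<le> 1/2 - 1 / real (Suc k)"
      and opt: "pep_optimal (Q_mat m (F \<omega>) (\<lambda>j. j \<in> S)) (outer x')"
      and far: "\<delta> \<le> sqrt (1 - (norm (cip x x'))\<^sup>2)"
      unfolding failure_set_def by blast
    have bits: "Phi (\<lambda>j. P j \<omega>) (outer x) j = (j \<in> S)" if j: "j < m" for j
    proof (cases "j \<in> S")
      case True
      then show ?thesis using bspec[OF pos True] j by (simp add: Phi_def phi_outer F_def)
    next
      case False
      then have "qf (P j \<omega>) x \<le> 1/2 - 1 / real (Suc k)" using bspec[OF neg, of j] j by (simp add: F_def)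
      moreover have "1 / real (Suc k) > 0" by simp
      ultimately have "qf (P j \<omega>) x < 1/2" by linarith
      then show ?thesis using False by (simp add: Phi_def phi_outer)
    qed
    have "pep_optimal (Q_mat m (\<lambda>j. P j \<omega>) (Phi (\<lambda>j. P j \<omega>) (outer x))) (outer x')"
      using opt Q[of "Phi (\<lambda>j. P j \<omega>) (outer x)" S \<omega>] bits by simp
    then have "\<not> recovers \<delta> \<omega>"
      unfolding recovers_iff[OF \<omega>] using x far by (meson not_less)
    then show "\<omega> \<in> space M - ?G" using \<omega> by blast
  qed
  also have "\<dots> \<in> events" using Bm by (intro sets.finite_UN sets.countable_UN) auto
  finally have "space M - (space M - ?G) \<in> events" by (rule sets.compl_sets)
  moreover have "space M - (space M - ?G) = ?G" by blast
  ultimately show ?thesis by (simp only:)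
qed

section \<open>The probability of recovery\<close>

lemma recovery_probability:
  fixes \<delta> D \<beta> \<epsilon> :: real
  assumes \<beta>: "\<beta> = rc_beta TYPE('a)" and \<delta>: "\<delta> > 0"
    and \<epsilon>: "\<epsilon> = (mu1 \<beta> n - mu2 \<beta> n) / 8 * \<delta>"
    and m_bound: "real m \<ge> 2 * (1 / \<epsilon>\<^sup>2) *
           (8 * \<beta> * real n *
              ln (1 + 128 * (sqrt (2 * \<beta> * real n - 1) / (2 * sqrt (2 * pi))) * (1 / \<epsilon>))
            + 2 * ln 2 + D)"
  shows "prob {\<omega> \<in> space M. recovers \<delta> \<omega>} \<ge> 1 - exp (- D)" (is "prob ?G \<ge> _")
proof -
  define \<kappa> where "\<kappa> = mu1 \<beta> n - mu2 \<beta> n"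
  define \<nu> where "\<nu> = mu2 \<beta> n"
  define c where "c = sqrt (2 * \<beta> * n - 1) / (2 * sqrt (2 * pi))"
  define N where "N = (1 + 128 * c * (1 / \<epsilon>)) ^ DIM('a^'d)"
  have \<beta>n: "2 * (\<beta> * n) = real (DIM('a) * n)" by (simp add: \<beta> rc_beta_def)
  have \<kappa>: "\<kappa> > 0" unfolding \<kappa>_def using n by (intro mu_gap_pos) (simp_all add: \<beta> rc_beta_def)
  have \<epsilon>0: "\<epsilon> > 0" and K8: "\<kappa> * \<delta> = 8 * \<epsilon>" using \<kappa> \<delta> by (simp_all add: \<epsilon> \<kappa>_def)
  have "DIM('a) * n \<ge> 1" using n by simp
  from of_nat_mono[OF this, where 'a=real] have dn1: "real (DIM('a) * n) \<ge> 1" by (simp only: of_nat_1)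
  have "2 * \<beta> * n - 1 \<ge> 0" using dn1 \<beta>n by linarith
  then have c0: "c \<ge> 0" unfolding c_def by (intro divide_nonneg_nonneg) auto
  have N1: "N \<ge> 1" unfolding N_def using c0 \<epsilon>0 by (intro one_le_power) simp
  obtain E K where E: "E \<in> events" "prob E \<le> 4 * N\<^sup>2 * exp (- (m * \<epsilon>\<^sup>2 / 2))" "K < 4 * \<epsilon>"
    "\<And>\<omega> x y. \<omega> \<in> space M - E \<Longrightarrow> norm x = 1 \<Longrightarrow> norm y = 1 \<Longrightarrow>
        \<bar>dev m \<nu> \<kappa> (\<lambda>j. P j \<omega>) x y\<bar> \<le> K"
  proof (cases "DIM('a) * n = 1")
    case True
    then have "DIM('a) = 1" "n = 1" by auto
    from uniform_deviation_circle[OF this \<epsilon>0] obtain E K where E: "E \<in> events"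
      "prob E \<le> 4 * exp (- (m * \<epsilon>\<^sup>2 / 2))" "K < 4 * \<epsilon>"
      "\<And>\<omega> x y. \<omega> \<in> space M - E \<Longrightarrow> norm x = 1 \<Longrightarrow> norm y = 1 \<Longrightarrow>
        \<bar>dev m \<nu> \<kappa> (\<lambda>j. P j \<omega>) x y\<bar> \<le> K"
      unfolding \<nu>_def \<kappa>_def \<beta> by blast
    have "4 * 1 * exp (- (m * \<epsilon>\<^sup>2 / 2)) \<le> 4 * N\<^sup>2 * exp (- (m * \<epsilon>\<^sup>2 / 2))"
      using one_le_power[OF N1, of 2] by (intro mult_right_mono mult_left_mono) simp_all
    then show ?thesis using that[OF E(1) _ E(3,4)] E(2) by linarith
  next
    case False
    then have "DIM('a) * n \<ge> 2" using \<open>DIM('a) * n \<ge> 1\<close> by linarith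
    from of_nat_mono[OF this, where 'a=real] have "real (DIM('a) * n) \<ge> 2" by (simp only: of_nat_numeral)
    then have a1: "rc_beta TYPE('a) * real n \<ge> 1" using \<beta>n unfolding \<beta> by linarith
    from uniform_deviation_net[OF a1 \<epsilon>0] obtain E where E: "E \<in> events"
      "prob E \<le> 4 * N\<^sup>2 * exp (- (m * \<epsilon>\<^sup>2 / 2))"
      "\<And>\<omega> x y. \<omega> \<in> space M - E \<Longrightarrow> norm x = 1 \<Longrightarrow> norm y = 1 \<Longrightarrow>
        \<bar>dev m \<nu> \<kappa> (\<lambda>j. P j \<omega>) x y\<bar> \<le> 2 * \<epsilon>"
      unfolding N_def c_def \<nu>_def \<kappa>_def \<beta> mult.assoc by blast
    show ?thesis by (rule that[OF E(1,2) _ E(3)]) (use \<epsilon>0 in simp)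
  qed
  have "4 * N\<^sup>2 * exp (- (m * \<epsilon>\<^sup>2 / 2)) \<le> exp (- D)"
  proof -
    define l where "l = ln (1 + 128 * c * (1 / \<epsilon>))"
    have base: "1 + 128 * c * (1 / \<epsilon>) > 0" using c0 \<epsilon>0 by (simp add: add_pos_nonneg)
    have "N = exp (real DIM('a^'d) * l)"
      unfolding N_def l_def exp_of_nat_mult using base by simp
    also have "real DIM('a^'d) = 2 * real (DIM('a) * n)" using d by simp
    also have "\<dots> = 4 * (\<beta> * n)" unfolding \<beta>n[symmetric] by simp
    finally have N2: "N\<^sup>2 = exp (8 * \<beta> * n * l)" by (simp add: power2_eq_square mult.assoc flip: exp_add)
    have four: "(4::real) = exp (2 * ln 2)" using exp_of_nat_mult[of 2 "ln 2 :: real"] by simp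
    have "2 * (1 / \<epsilon>\<^sup>2) * (8 * \<beta> * n * l + 2 * ln 2 + D) \<le> m"
      using m_bound unfolding l_def c_def by simp
    then have "8 * \<beta> * n * l + 2 * ln 2 + D \<le> m * \<epsilon>\<^sup>2 / 2"
      using \<epsilon>0 by (simp add: field_simps)
    then have "2 * ln 2 + 8 * \<beta> * n * l + (- (m * \<epsilon>\<^sup>2 / 2)) \<le> - D" by linarith
    then have "exp (2 * ln 2 + 8 * \<beta> * n * l + (- (m * \<epsilon>\<^sup>2 / 2))) \<le> exp (- D)" by (simp only: exp_le_cancel_iff)
    then show ?thesis unfolding exp_add N2 four[symmetric] .
  qed
  then have pE: "prob E \<le> exp (- D)" using E(2) by linarith
  have "space M - E \<subseteq> ?G"
  proof
    fix \<omega> assume \<omega>: "\<omega> \<in> space M - E"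
    then have \<omega>M: "\<omega> \<in> space M" by simp
    have "sqrt (1 - (norm (cip x x'))\<^sup>2) < \<delta>" if x: "norm x = 1" "norm x' = 1"
      and opt: "pep_optimal (Q_mat m (\<lambda>j. P j \<omega>) (Phi (\<lambda>j. P j \<omega>) (outer x))) (outer x')" for x x'
      by (rule pep_stability[OF Proj_hermitian[OF P_Proj[OF _ \<omega>M]] x E(4)[OF \<omega> x(1)] opt \<kappa> _ \<delta>])
         (use E(3) K8 in auto)
    then show "\<omega> \<in> ?G" using \<omega>M recovers_iff[OF \<omega>M, of \<delta>] by simp
  qed
  then have "prob (space M - E) \<le> prob ?G"
    by (intro finite_measure_mono recovery_event_measurable)
  then show ?thesis using prob_compl[OF E(1)] pE by linarith
qed

end

theorem theorem3p3p1:
  fixes M :: "'w measure"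
    and P :: "nat \<Rightarrow> 'w \<Rightarrow> 'a::real_or_complex^'d^'d"
    and n m :: nat
    and \<delta> D \<beta> \<epsilon> :: real
  assumes "n \<ge> 1"
    and "CARD('d) = 2 * n"
    and "\<beta> = rc_beta TYPE('a)"
    and "\<delta> > 0"
    and "\<epsilon> = (mu1 \<beta> n - mu2 \<beta> n) / 8 * \<delta>"
    and "m > 0"
    and "real m \<ge> 2 * (1 / \<epsilon>\<^sup>2) *
           (8 * \<beta> * real n *
              ln (1 + 128 * (sqrt (2 * \<beta> * real n - 1) / (2 * sqrt (2 * pi))) * (1 / \<epsilon>))
            + 2 * ln 2 + D)"
    and "prob_space M"
    and "prob_space.indep_vars M (\<lambda>_. Proj_borel n) P {..<m}"
    and "\<And>j. j < m \<Longrightarrow> uniform_on_Proj n (distr M (Proj_borel n) (P j))"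
  shows "measure M {\<omega> \<in> space M. \<forall>X \<in> Proj 1. \<forall>X'.
             pep_solution m (\<lambda>j. P j \<omega>) (Phi (\<lambda>j. P j \<omega>) X) X'
             \<longrightarrow> onorm ((*v) (X' - X)) < \<delta>}
         \<ge> 1 - exp (- D)"
proof -
  interpret prob_space M by (rule assms(8))
  interpret random_projections M P n m
    by unfold_locales (use assms in auto)
  show ?thesis using recovery_probability[OF assms(3,4,5,7)] unfolding recovers_def .
qed

end
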